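(* Let $C$ be a perfectoid field with norm $|\cdot|: C\to \mathbb{R}_{\geq 0}$, let $n\geq 2$, and let $R_n=C\langle x_1^{1/p^\infty},\dots,x_n^{1/p^\infty}\rangle$ be the perfectoid Tate algebra in $n$ variables. Suppose that the value group $|C^\times|$ is a proper subset of $\mathbb{R}^{+}=\mathbb{R}_{>0}$. Then $(C,R_n)$ is not a Nullstellensatz pair, i.e. there exists a maximal ideal $I\subseteq R_n$ such that the natural map $C\to R_n/I$ is not an isomorphism.
   Context: A perfectoid field is a complete non-archimedean nontrivially valued field $C$ of residue characteristic $p$ in the sense of Scholze. For a field $C$ and a $C$-algebra $R$, an ideal $I\subseteq R$ is an evaluation ideal if the composite $C\to R\to R/I$ is an isomorphism; $(C,R)$ is called a Nullstellensatz pair if every maximal ideal of $R$ is an evaluation ideal. The perfectoid Tate algebra $C\langle x_1^{1/p^\infty},\dots,x_n^{1/p^\infty}\rangle$ is the completion (for the Gauss norm) of $C[x_1^{1/p^\infty},\dots,x_n^{1/p^\infty}]$, i.e. convergent power series with exponents in $\mathbb{Z}[1/p]_{\geq 0}$. *)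

theory Defs
  imports
    "HOL-Analysis.Analysis"
    "HOL-Algebra.Algebra"
    "HOL-Algebra.Algebraic_Closure_Type"
    "HOL-Library.Poly_Mapping"
    "HOL-Computational_Algebra.Primes"
begin

section \<open>Perfectoid fields\<close>

text \<open>
  The field \<open>C\<close> is a type, with its absolute value \<open>vnorm\<close>; the topology is the one
  induced by the metric \<open>vnorm (x - y)\<close>. The library's \<open>norm\<close> is only available on real normed
  vector spaces, which excludes non-archimedean fields.
\<close>

class complete_nonarch_field = field + complete_space +
  fixes vnorm :: "'a \<Rightarrow> real"
  assumes dist_vnorm: "dist x y = vnorm (x - y)"
    and vnorm_mult: "vnorm (x * y) = vnorm x * vnorm y"
    and vnorm_add: "vnorm (x + y) \<le> max (vnorm x) (vnorm y)"

definition (in complete_nonarch_field) value_group :: "'a itself \<Rightarrow> real set" where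
  "value_group _ = vnorm ` (UNIV - {0::'a})"

text \<open>
  The characteristic of the residue field \<open>{x. vnorm x \<le> 1} / {x. vnorm x < 1}\<close>. Same shape as the
  library's definition of \<open>CHAR('a)\<close>, with \<open>of_nat m = 0\<close> read in the residue field; in
  particular it is 0 if the residue field has characteristic 0.
\<close>

definition (in complete_nonarch_field) residue_char :: "'a itself \<Rightarrow> nat" where
  "residue_char _ = Gcd {m. vnorm (of_nat m :: 'a) < 1}"

text \<open>
  Perfectoid fields in the sense of Scholze. A non-discrete value group is in particular
  nontrivial. The last condition says that the Frobenius \<open>y \<mapsto> y ^ p\<close> of
  \<open>{x. vnorm x \<le> 1} / p\<close> is surjective.
\<close>

class perfectoid_field = complete_nonarch_field +
  assumes value_group_nondiscrete: "\<not> discrete (value_group TYPE('a))"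
    and prime_residue_char: "Factorial_Ring.prime (residue_char TYPE('a))"
    and frobenius_surj: "vnorm x \<le> 1 \<Longrightarrow>
      \<exists>y z. vnorm y \<le> 1 \<and> vnorm z \<le> 1 \<and>
        x = y ^ residue_char TYPE('a) + of_nat (residue_char TYPE('a)) * z"

section \<open>Perfectoid Tate algebras\<close>

text \<open>
  Multi-exponents in the variables \<open>x\<^sub>0, \<dots>, x\<^sub>n\<^sub>-\<^sub>1\<close> with entries in \<open>\<int>[1/p]\<^sub>\<ge>\<^sub>0\<close>.
\<close>

definition p_exponents :: "nat \<Rightarrow> nat \<Rightarrow> (nat \<Rightarrow>\<^sub>0 rat) set" where
  "p_exponents p n =
    {e. Poly_Mapping.keys e \<subseteq> {..<n} \<and>
        (\<forall>i. \<exists>m k. Poly_Mapping.lookup e i = of_nat m / of_nat p ^ k)}"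

text \<open>
  The completion of \<open>C[x\<^sub>i^(1/p^\<infinity>) | i < n]\<close> for the Gauss norm (the supremum of the norms of the
  coefficients), as series: families of coefficients tending to 0, where \<open>f e\<close> is
  the coefficient of \<open>x\<^sup>e\<close>. An exponent \<open>e\<close> splits as \<open>a + b\<close> in infinitely many ways, so the
  coefficients of a product are infinite (unconditionally convergent) sums in \<open>C\<close>.
\<close>

definition perfectoid_tate_algebra ::
    "nat \<Rightarrow> ('c::perfectoid_field, (nat \<Rightarrow>\<^sub>0 rat) \<Rightarrow> 'c) module" where
  "perfectoid_tate_algebra n =
    (let E = p_exponents (residue_char TYPE('c)) n in
     \<lparr>carrier = {f. (\<forall>e. e \<notin> E \<longrightarrow> f e = 0) \<and> (\<forall>\<epsilon>>0. finite {e. vnorm (f e) \<ge> \<epsilon>})},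
      monoid.mult = (\<lambda>f g e. \<Sum>\<^sub>\<infinity>(a, b)\<in>{(a, b) \<in> E \<times> E. a + b = e}. f a * g b),
      monoid.one = (\<lambda>e. if e = 0 then 1 else 0),
      ring.zero = (\<lambda>e. 0),
      ring.add = (\<lambda>f g e. f e + g e),
      module.smult = (\<lambda>c f e. c * f e)\<rparr>)"

section \<open>Nullstellensatz pairs\<close>

text \<open>
  For a \<open>C\<close>-algebra \<open>R\<close>, with structure map \<open>c \<mapsto> c \<odot> \<one>\<close>.
\<close>

definition evaluation_ideal ::
    "('c, 'd) ring_scheme \<Rightarrow> ('c, 'r, 'm) module_scheme \<Rightarrow> 'r set \<Rightarrow> bool" where
  "evaluation_ideal C R I \<longleftrightarrow>
    ideal I R \<and> (\<lambda>c. I +>\<^bsub>R\<^esub> (c \<odot>\<^bsub>R\<^esub> \<one>\<^bsub>R\<^esub>)) \<in> ring_iso C (R Quot I)"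

definition nullstellensatz_pair ::
    "('c, 'd) ring_scheme \<Rightarrow> ('c, 'r, 'm) module_scheme \<Rightarrow> bool" where
  "nullstellensatz_pair C R \<longleftrightarrow> (\<forall>I. maximalideal I R \<longrightarrow> evaluation_ideal C R I)"

end

theory Submission
  imports Defs
begin

text \<open>
  Take \<open>0 < \<gamma> < 1\<close> outside the value group. Choose points \<open>P\<^sub>k = (\<alpha>\<^sub>k, v\<^sub>k)\<close> with coordinates in \<open>C\<close>
  and with compatible \<open>p\<close>-power roots, such that \<open>|\<alpha>\<^sub>k| \<rightarrow> \<gamma>\<close> and \<open>v\<^sub>k\<close> is close to a partial sum of a
  series \<open>\<Sum>\<^sub>j a\<^sub>j\<close> of monomials \<open>a\<^sub>j = \<varpi>^q\<^sub>j \<alpha>\<^sub>k^n\<^sub>j\<close>, with integers \<open>n\<^sub>j\<close> of alternating sign and norms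
  tending to 0 very slowly compared to \<open>|n\<^sub>j|\<close>. The ideal of all \<open>f\<close> with \<open>f(P\<^sub>k) \<rightarrow> 0\<close> is proper; let \<open>I\<close> be a
  maximal ideal above it.

  Subtracting \<open>a\<^sub>0, \<dots>, a\<^sub>j\<^sub>-\<^sub>1\<close> from \<open>y\<close> leaves a function that is close to \<open>a\<^sub>j\<close> at the points, and passing
  to \<open>p^m\<close>-th roots with \<open>m\<close> large makes the loss in norm negligible. Hence every power \<open>\<alpha>\<^sub>k^i\<close>, also
  for negative \<open>i\<close>, is approximated by values \<open>f(P\<^sub>k)\<close> with the Gauss norm of \<open>f\<close> bounded by a constant
  multiple of \<open>\<gamma>^i\<close>, and by successive approximation it is a limit of such values. If \<open>C \<rightarrow> R\<^sub>n/I\<close> were an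
  isomorphism, this character of \<open>R\<^sub>n\<close>, which cannot increase Gauss norms, would give an element \<open>c\<close> of
  \<open>C\<close> with \<open>|c|^i \<le> K \<gamma>^i\<close> for all integers \<open>i\<close>, that is, \<open>|c| = \<gamma>\<close>.
\<close>

text \<open>The obstacle is that roots do not commute with the sum behind the second coordinate: a
  p^m-th root of \<Sum> a_j agrees with the sum of the p^m-th roots of the a_j only up to an error
  of norm |p|, and this error does not shrink as m grows. What changes with m is the size of the
  terms: |a_j|^(1/p^m) tends to 1, so for large m the term singled out by a subtraction exceeds the
  error.

  Clearing the denominators of a_0, ..., a_(j-1) costs valuation, and the cost per unit of exponent
  of \<alpha>_k has to tend to 0. It can, because q_j is free: with \<gamma> = |\<varpi>|^\<theta>,
  the number q_j + \<theta> n_j can be kept in a fixed unit interval while |n_j| grows without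
  bound. Both signs of n_j are needed. A positive power \<alpha>_k^i is trivially the value of a
  series, but of one with Gauss norm 1, not of the order of \<gamma>^i.

  One constant K has to serve all i, since K disappears only when the bound is applied to m i and
  m-th roots are taken.\<close>

section \<open>Summation and convolution over a complete non-archimedean field\<close>

lemma vnorm_zero [simp]: "vnorm (0 :: 'a::complete_nonarch_field) = 0"
  using dist_vnorm[of "0::'a" 0] by simp

lemma vnorm_ge_0 [simp]: "0 \<le> vnorm (x :: 'a::complete_nonarch_field)"
  using dist_vnorm[of x 0] by (metis diff_zero zero_le_dist)

lemma vnorm_eq_0 [simp]: "vnorm (x :: 'a::complete_nonarch_field) = 0 \<longleftrightarrow> x = 0"
  using dist_vnorm[of x 0] by (metis diff_zero dist_eq_0_iff)

lemma vnorm_pos [simp]: "0 < vnorm (x :: 'a::complete_nonarch_field) \<longleftrightarrow> x \<noteq> 0"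
  by (metis vnorm_eq_0 vnorm_ge_0 less_le)

lemma vnorm_one [simp]: "vnorm (1 :: 'a::complete_nonarch_field) = 1"
  using vnorm_mult[of "1::'a" 1] by (metis mult_cancel_left1 mult.right_neutral vnorm_eq_0 zero_neq_one)

lemma vnorm_minus [simp]: "vnorm (- x) = vnorm (x :: 'a::complete_nonarch_field)"
  using dist_vnorm[of 0 x] dist_vnorm[of x 0] by (simp add: dist_commute)

lemma vnorm_minus_commute: "vnorm (x - y) = vnorm (y - x :: 'a::complete_nonarch_field)"
  by (metis minus_diff_eq vnorm_minus)

lemma vnorm_diff: "vnorm (x - y) \<le> max (vnorm x) (vnorm (y :: 'a::complete_nonarch_field))"
  using vnorm_add[of x "- y"] by simp

lemma vnorm_power: "vnorm (x ^ k) = vnorm (x :: 'a::complete_nonarch_field) ^ k"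
  by (induction k) (simp_all add: vnorm_mult)

lemma vnorm_inverse: "vnorm (inverse x) = inverse (vnorm (x :: 'a::complete_nonarch_field))"
proof (cases "x = 0")
  case False
  then have "vnorm x * vnorm (inverse x) = 1"
    by (simp flip: vnorm_mult)
  then show ?thesis
    by (metis inverse_unique)
qed simp

lemma vnorm_add_le:
  assumes "vnorm x \<le> s" "vnorm y \<le> s"
  shows "vnorm (x + y :: 'a::complete_nonarch_field) \<le> s"
  using vnorm_add[of x y] assms by simp

lemma vnorm_diff_le:
  assumes "vnorm x \<le> s" "vnorm y \<le> s"
  shows "vnorm (x - y :: 'a::complete_nonarch_field) \<le> s"
  using vnorm_diff[of x y] assms by simp

lemma vnorm_sum_le:
  assumes "\<And>i. i \<in> A \<Longrightarrow> vnorm (f i :: 'a::complete_nonarch_field) \<le> s" "0 \<le> s"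
  shows "vnorm (sum f A) \<le> s"
  using assms by (induction A rule: infinite_finite_induct) (auto intro: vnorm_add_le)

lemma vnorm_of_nat_le: "vnorm (of_nat k :: 'a::complete_nonarch_field) \<le> 1"
  by (induction k) (auto intro: vnorm_add_le)

lemma vnorm_mult_le:
  assumes "vnorm x \<le> s" "vnorm y \<le> t"
  shows "vnorm (x * y :: 'a::complete_nonarch_field) \<le> s * t"
  using mult_mono'[OF assms] by (simp add: vnorm_mult)

text \<open>The isosceles principle: of the three sides of an ultrametric triangle the two longest
  are equal.\<close>

lemma vnorm_eq_of_diff_less:
  assumes "vnorm (x - y) < vnorm (y :: 'a::complete_nonarch_field)"
  shows "vnorm x = vnorm y"
  using vnorm_add[of "x - y" y] vnorm_diff[of x "x - y"] assms by (auto simp: max_def split: if_splits)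

section \<open>Continuity of addition and multiplication\<close>

instance complete_nonarch_field \<subseteq> topological_ab_group_add
proof
  fix a b :: 'a
  show "((\<lambda>x. fst x + snd x) \<longlongrightarrow> a + b) (nhds a \<times>\<^sub>F nhds b)"
  proof (rule tendstoI)
    fix e :: real assume e: "e > 0"
    have "\<forall>\<^sub>F x in nhds a. dist x a < e" "\<forall>\<^sub>F x in nhds b. dist x b < e"
      using e by (auto intro: tendstoD[OF filterlim_ident])
    then show "\<forall>\<^sub>F x in nhds a \<times>\<^sub>F nhds b. dist (fst x + snd x) (a + b) < e"
      unfolding eventually_prod_filter
    proof (intro exI conjI allI impI)
      fix x y assume "dist x a < e" "dist y b < e"
      then show "dist (fst (x, y) + snd (x, y)) (a + b) < e"
        using vnorm_add[of "x - a" "y - b"] by (simp add: dist_vnorm algebra_simps)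
    qed auto
  qed
  show "(uminus \<longlongrightarrow> - a) (nhds a)"
  proof (rule tendstoI)
    fix e :: real assume "e > 0"
    then have "\<forall>\<^sub>F x in nhds a. dist x a < e"
      by (auto intro: tendstoD[OF filterlim_ident])
    then show "\<forall>\<^sub>F x in nhds a. dist (- x) (- a) < e"
      by eventually_elim (simp add: dist_vnorm vnorm_minus_commute algebra_simps)
  qed
qed

instance complete_nonarch_field \<subseteq> topological_semigroup_mult
proof
  fix a b :: 'a
  show "((\<lambda>x. fst x * snd x) \<longlongrightarrow> a * b) (nhds a \<times>\<^sub>F nhds b)"
  proof (rule tendstoI)
    fix e :: real assume e: "e > 0"
    define M where "M = 1 + vnorm a + vnorm b"
    have M: "M \<ge> 1" "vnorm a \<le> M" "vnorm b \<le> M"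
      using vnorm_ge_0[of a] vnorm_ge_0[of b] by (auto simp: M_def)
    define d where "d = min 1 (e / (2 * M))"
    have d: "0 < d" "d \<le> 1" "d * M < e"
      using M e by (auto simp: d_def min_def field_simps)
    have "\<forall>\<^sub>F x in nhds a. dist x a < d" "\<forall>\<^sub>F x in nhds b. dist x b < d"
      using d by (auto intro: tendstoD[OF filterlim_ident])
    then show "\<forall>\<^sub>F x in nhds a \<times>\<^sub>F nhds b. dist (fst x * snd x) (a * b) < e"
      unfolding eventually_prod_filter
    proof (intro exI conjI allI impI)
      fix x y assume xy: "dist x a < d" "dist y b < d"
      have 1: "vnorm ((x - a) * b) \<le> d * M" "vnorm (a * (y - b)) \<le> M * d"
        using xy M by (auto intro!: vnorm_mult_le simp: dist_vnorm)
      have "vnorm ((x - a) * (y - b)) \<le> d * d"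
        using xy by (auto intro!: vnorm_mult_le simp: dist_vnorm)
      also have "\<dots> \<le> d * M"
        using d M by auto
      finally have "vnorm ((x - a) * (y - b) + ((x - a) * b + a * (y - b))) \<le> d * M"
        using 1 by (intro vnorm_add_le) (auto simp: mult.commute)
      then show "dist (fst (x, y) * snd (x, y)) (a * b) < e"
        using d by (simp add: dist_vnorm algebra_simps)
    qed auto
  qed
qed

text \<open>Over a complete non-archimedean field this condition already gives unconditional
  summability over every set of indices (\<open>null_family_summable\<close>), so it takes the place
  that absolute summability has over the reals.\<close>

definition null_family :: "('i \<Rightarrow> 'a::complete_nonarch_field) \<Rightarrow> bool" where
  "null_family f \<longleftrightarrow> (\<forall>\<epsilon>>0. finite {i. vnorm (f i) \<ge> \<epsilon>})"

lemma null_family_bounded: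
  assumes "null_family f"
  obtains B where "B > 0" "\<And>i. vnorm (f i) \<le> B"
proof
  let ?A = "insert 1 ((\<lambda>i. vnorm (f i)) ` {i. vnorm (f i) \<ge> 1})"
  have fin: "finite ?A"
    using assms by (auto simp: null_family_def)
  show "vnorm (f i) \<le> Max ?A" for i
    by (cases "vnorm (f i) \<ge> 1") (use fin in \<open>auto simp: Max_ge_iff\<close>)
  show "Max ?A > 0"
    using fin by (subst Max_gr_iff) auto
qed

lemma null_family_finite_support:
  assumes "finite A" "\<And>i. i \<notin> A \<Longrightarrow> f i = 0"
  shows "null_family f"
  unfolding null_family_def
proof (intro allI impI)
  fix \<epsilon> :: real assume "\<epsilon> > 0"
  then have "{i. vnorm (f i) \<ge> \<epsilon>} \<subseteq> A"
    using assms(2) by fastforce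
  then show "finite {i. vnorm (f i) \<ge> \<epsilon>}"
    using assms(1) finite_subset by blast
qed

lemma null_family_add:
  assumes "null_family f" "null_family g"
  shows "null_family (\<lambda>i. f i + g i)"
  unfolding null_family_def
proof (intro allI impI)
  fix \<epsilon> :: real assume "\<epsilon> > 0"
  moreover have "{i. vnorm (f i + g i) \<ge> \<epsilon>} \<subseteq> {i. vnorm (f i) \<ge> \<epsilon>} \<union> {i. vnorm (g i) \<ge> \<epsilon>}"
  proof
    fix i assume "i \<in> {i. vnorm (f i + g i) \<ge> \<epsilon>}"
    then show "i \<in> {i. vnorm (f i) \<ge> \<epsilon>} \<union> {i. vnorm (g i) \<ge> \<epsilon>}"
      using vnorm_add[of "f i" "g i"] by (auto simp: max_def split: if_splits)
  qed
  ultimately show "finite {i. vnorm (f i + g i) \<ge> \<epsilon>}"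
    using assms by (auto simp: null_family_def intro: finite_subset)
qed

lemma null_family_dominated:
  assumes "null_family f" "\<And>i. vnorm (g i) \<le> B * vnorm (f i)" "B > 0"
  shows "null_family g"
  unfolding null_family_def
proof (intro allI impI)
  fix \<epsilon> :: real assume "\<epsilon> > 0"
  moreover have "{i. vnorm (g i) \<ge> \<epsilon>} \<subseteq> {i. vnorm (f i) \<ge> \<epsilon> / B}"
  proof
    fix i assume "i \<in> {i. vnorm (g i) \<ge> \<epsilon>}"
    then show "i \<in> {i. vnorm (f i) \<ge> \<epsilon> / B}"
      using assms(2)[of i] assms(3) by (simp add: field_simps)
  qed
  ultimately show "finite {i. vnorm (g i) \<ge> \<epsilon>}"
    using assms(1,3) by (auto simp: null_family_def intro: finite_subset)
qed

text \<open>Both families are bounded, so a product of norm at least \<epsilon> forces a positive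
  lower bound on each of its factors.\<close>

lemma null_family_tensor:
  assumes "null_family f" "null_family g"
  shows "null_family (\<lambda>(a, b). f a * g b)"
  unfolding null_family_def
proof (intro allI impI)
  fix \<epsilon> :: real assume \<epsilon>: "\<epsilon> > 0"
  obtain F where F: "F > 0" "\<And>i. vnorm (f i) \<le> F"
    using null_family_bounded[OF assms(1)] by blast
  obtain G where G: "G > 0" "\<And>i. vnorm (g i) \<le> G"
    using null_family_bounded[OF assms(2)] by blast
  have "{(a, b). vnorm (f a * g b) \<ge> \<epsilon>} \<subseteq> {a. vnorm (f a) \<ge> \<epsilon> / G} \<times> {b. vnorm (g b) \<ge> \<epsilon> / F}"
  proof (clarsimp simp: vnorm_mult F(1) G(1) divide_le_eq)
    fix a b assume "\<epsilon> \<le> vnorm (f a) * vnorm (g b)"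
    moreover have "vnorm (f a) * vnorm (g b) \<le> vnorm (f a) * G" "vnorm (f a) * vnorm (g b) \<le> F * vnorm (g b)"
      using F G by (auto intro: mult_left_mono mult_right_mono)
    ultimately show "\<epsilon> \<le> vnorm (f a) * G \<and> \<epsilon> \<le> vnorm (g b) * F"
      by (simp add: mult.commute)
  qed
  moreover have "finite ({a. vnorm (f a) \<ge> \<epsilon> / G} \<times> {b. vnorm (g b) \<ge> \<epsilon> / F})"
    using assms F(1) G(1) \<epsilon> by (auto simp: null_family_def)
  ultimately show "finite {i. vnorm (case i of (a, b) \<Rightarrow> f a * g b) \<ge> \<epsilon>}"
    by (simp add: case_prod_unfold finite_subset)
qed

text \<open>Let \<open>D k\<close> be the finite set of indices whose terms have norm at least
  1/(k+1). By the ultrametric inequality, enlarging \<open>D k\<close> by any finite set changes the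
  sum by at most 1/(k+1). Hence the sums over the \<open>D k\<close> form a Cauchy sequence, and its
  limit is the unordered sum.\<close>

lemma null_family_summable:
  assumes "null_family f"
  shows "f summable_on S"
proof -
  define D where "D k = {i \<in> S. vnorm (f i) \<ge> 1 / real (Suc k)}" for k
  have fin: "finite (D k)" for k
  proof (rule finite_subset)
    show "D k \<subseteq> {i. vnorm (f i) \<ge> 1 / real (Suc k)}"
      by (auto simp: D_def)
    have "1 / real (Suc k) > 0"
      by simp
    then show "finite {i. vnorm (f i) \<ge> 1 / real (Suc k)}"
      using assms unfolding null_family_def by blast
  qed
  have tail: "vnorm (sum f F - sum f (D k)) \<le> 1 / real (Suc k)"
    if "finite F" "D k \<subseteq> F" "F \<subseteq> S" for F k
  proof -
    have "sum f F - sum f (D k) = sum f (F - D k)"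
      using that by (simp add: sum_diff)
    also have "vnorm \<dots> \<le> 1 / real (Suc k)"
      using that by (intro vnorm_sum_le) (auto simp: D_def)
    finally show ?thesis .
  qed
  have mono: "D k \<subseteq> D m" if "k \<le> m" for k m
  proof
    fix i assume "i \<in> D k"
    moreover have "1 / real (Suc m) \<le> 1 / real (Suc k)"
      using that by (simp add: frac_le)
    ultimately show "i \<in> D m"
      unfolding D_def by simp
  qed
  have "Cauchy (\<lambda>k. sum f (D k))"
  proof (rule metric_CauchyI)
    fix e :: real assume "e > 0"
    then obtain M where M: "inverse (real (Suc M)) < e"
      using reals_Archimedean by blast
    have "dist (sum f (D m)) (sum f (D k)) < e" if "m \<ge> M" "k \<ge> M" for m k
    proof -
      have 1: "vnorm (sum f (D j) - sum f (D M)) \<le> 1 / real (Suc M)" if "j \<ge> M" for j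
        using tail[OF fin mono[OF that]] by (simp add: D_def)
      have "vnorm ((sum f (D m) - sum f (D M)) - (sum f (D k) - sum f (D M))) \<le> 1 / real (Suc M)"
        using 1 that by (blast intro: vnorm_diff_le)
      then show ?thesis
        using M by (simp add: dist_vnorm inverse_eq_divide)
    qed
    then show "\<exists>M. \<forall>m\<ge>M. \<forall>k\<ge>M. dist (sum f (D m)) (sum f (D k)) < e"
      by blast
  qed
  then obtain L where L: "(\<lambda>k. sum f (D k)) \<longlonglongrightarrow> L"
    using Cauchy_convergent convergent_def by blast
  have "(f has_sum L) S"
    unfolding has_sum_def
  proof (rule tendstoI)
    fix e :: real assume e: "e > 0"
    obtain k1 where k1: "inverse (real (Suc k1)) < e"
      using reals_Archimedean[OF e] by blast
    obtain k2 where k2: "\<And>k. k \<ge> k2 \<Longrightarrow> dist (sum f (D k)) L < e"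
      using tendstoD[OF L e] unfolding eventually_sequentially by blast
    define k where "k = max k1 k2"
    have "1 / real (Suc k) \<le> inverse (real (Suc k1))"
      by (simp add: k_def divide_simps)
    then have k: "1 / real (Suc k) < e" "dist (sum f (D k)) L < e"
      using k1 k2[of k] by (auto simp only: k_def intro: le_less_trans)
    show "\<forall>\<^sub>F F in finite_subsets_at_top S. dist (sum f F) L < e"
      unfolding eventually_finite_subsets_at_top
    proof (intro exI[of _ "D k"] conjI allI impI)
      fix F assume "finite F \<and> D k \<subseteq> F \<and> F \<subseteq> S"
      then have "vnorm (sum f F - sum f (D k)) < e"
        using tail[of F k] k by simp
      then show "dist (sum f F) L < e"
        using vnorm_add[of "sum f F - sum f (D k)" "sum f (D k) - L"] k by (simp add: dist_vnorm)
    qed (use fin in \<open>auto simp: D_def\<close>)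
  qed
  then show ?thesis
    by (auto simp: summable_on_def)
qed

lemma vnorm_infsum_le:
  assumes "\<And>i. i \<in> S \<Longrightarrow> vnorm (f i) \<le> B" "0 \<le> B"
  shows "vnorm (infsum f S) \<le> B"
\<comment> \<open>Without summability \<open>infsum\<close> is 0 by convention, and 0 \<le> B covers
  that case.\<close>
proof (cases "f summable_on S")
  case True
  show ?thesis
  proof (rule ccontr)
    assume *: "\<not> vnorm (infsum f S) \<le> B"
    define \<epsilon> where "\<epsilon> = (B + vnorm (infsum f S)) / 2"
    have \<epsilon>: "\<epsilon> > 0" "\<epsilon> < vnorm (infsum f S)" "B < \<epsilon>"
      using * assms(2) by (auto simp: \<epsilon>_def)
    obtain F where F: "finite F" "F \<subseteq> S" "dist (sum f F) (infsum f S) \<le> \<epsilon>"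
      using infsum_finite_approximation[OF True \<epsilon>(1)] by blast
    have "vnorm (sum f F) \<le> \<epsilon>"
    proof (intro vnorm_sum_le)
      fix i assume "i \<in> F"
      then show "vnorm (f i) \<le> \<epsilon>"
        using assms(1)[of i] F(2) \<epsilon>(3) by force
    qed (use \<epsilon> in simp)
    moreover have "vnorm (infsum f S - sum f F) \<le> \<epsilon>"
      using F(3) by (simp add: dist_vnorm vnorm_minus_commute)
    ultimately have "vnorm (infsum f S) \<le> \<epsilon>"
      using vnorm_add_le[of "infsum f S - sum f F" \<epsilon> "sum f F"] by simp
    then show False
      using \<epsilon> by simp
  qed
qed (use assms in \<open>simp add: infsum_not_exists\<close>)

text \<open>Summation along the fibres of \<open>h\<close>, like the image of a measure. Convolution
  becomes the image of a tensor product under addition, so that its algebraic laws reduce to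
  functoriality and relabelling.\<close>

definition pushforward :: "('i \<Rightarrow> 'j) \<Rightarrow> ('i \<Rightarrow> 'a) \<Rightarrow> 'j \<Rightarrow> 'a::complete_nonarch_field" where
  "pushforward h f j = infsum f (h -` {j})"

lemma null_family_pushforward:
  assumes "null_family f"
  shows "null_family (pushforward h f)"
  unfolding null_family_def
proof (intro allI impI)
  fix \<epsilon> :: real assume \<epsilon>: "\<epsilon> > 0"
  have "{j. vnorm (pushforward h f j) \<ge> \<epsilon>} \<subseteq> h ` {i. vnorm (f i) \<ge> \<epsilon> / 2}"
  proof (rule ccontr)
    assume "\<not> ?thesis"
    then obtain j where j: "vnorm (pushforward h f j) \<ge> \<epsilon>" "\<And>i. h i = j \<Longrightarrow> vnorm (f i) < \<epsilon> / 2"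
      by (force simp: not_le)
    have "vnorm (pushforward h f j) \<le> \<epsilon> / 2"
      unfolding pushforward_def using j(2) \<epsilon> by (intro vnorm_infsum_le) (auto intro: less_imp_le)
    then show False
      using j(1) \<epsilon> by simp
  qed
  moreover have "finite {i. vnorm (f i) \<ge> \<epsilon> / 2}"
    using assms \<epsilon> unfolding null_family_def by (meson half_gt_zero)
  ultimately show "finite {j. vnorm (pushforward h f j) \<ge> \<epsilon>}"
    using finite_subset by blast
qed

text \<open>Fubini for fibres: the index set may be grouped by the value of \<open>h\<close> because
  every subfamily of a null family is summable.\<close>

lemma infsum_pushforward:
  assumes "null_family f"
  shows "infsum (pushforward h f) A = infsum f (h -` A)"
proof -
  have inj: "inj_on snd (Sigma A (\<lambda>j. h -` {j}))"
    by (auto simp: inj_on_def)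
  have img: "snd ` Sigma A (\<lambda>j. h -` {j}) = h -` A"
    by force
  have "(f has_sum infsum f (h -` A)) (snd ` Sigma A (\<lambda>j. h -` {j}))"
    unfolding img using null_family_summable[OF assms] by simp
  then have "((f \<circ> snd) has_sum infsum f (h -` A)) (Sigma A (\<lambda>j. h -` {j}))"
    by (simp only: has_sum_reindex[OF inj])
  then have "(pushforward h f has_sum infsum f (h -` A)) A"
    by (rule has_sum_SigmaD)
      (use null_family_summable[OF assms] in \<open>simp add: pushforward_def has_sum_infsum\<close>)
  then show ?thesis
    by (rule infsumI)
qed

lemma pushforward_pushforward:
  assumes "null_family f"
  shows "pushforward h' (pushforward h f) = pushforward (h' \<circ> h) f"
proof
  show "pushforward h' (pushforward h f) k = pushforward (h' \<circ> h) f k" for k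
    using infsum_pushforward[OF assms, of h "h' -` {k}"]
    by (simp add: pushforward_def[of h'] pushforward_def[of "h' \<circ> h"] vimage_comp)
qed

text \<open>The fibre of \<open>map_prod h id\<close> over (a', b') is a copy of the fibre of
  \<open>h\<close> over a', and on it the factor \<open>g b'\<close> is constant.\<close>

lemma pushforward_tensor_left:
  fixes h :: "'i \<Rightarrow> 'j" and g :: "'k \<Rightarrow> 'a::complete_nonarch_field"
  assumes "null_family f" "null_family g"
  shows "pushforward (map_prod h id) (\<lambda>(a, b). f a * g b) = (\<lambda>(a, b). pushforward h f a * g b)"
proof
  fix z :: "'j \<times> 'k"
  obtain a' b' where z: "z = (a', b')"
    by (cases z)
  have inj: "inj_on (\<lambda>a. (a, b')) (h -` {a'})"
    by (auto simp: inj_on_def)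
  have "pushforward (map_prod h id) (\<lambda>(a, b). f a * g b) z
      = infsum (\<lambda>(a, b). f a * g b) ((\<lambda>a. (a, b')) ` (h -` {a'}))"
    unfolding pushforward_def by (rule arg_cong[where f = "infsum _"]) (auto simp: z)
  also have "\<dots> = infsum (\<lambda>a. f a * g b') (h -` {a'})"
    by (subst infsum_reindex[OF inj]) (simp add: o_def)
  also have "\<dots> = infsum f (h -` {a'}) * g b'"
    by (rule infsum_cmult_left) (use null_family_summable[OF assms(1)] in auto)
  finally show "pushforward (map_prod h id) (\<lambda>(a, b). f a * g b) z = (case z of (a, b) \<Rightarrow> pushforward h f a * g b)"
    by (simp add: z pushforward_def)
qed

lemma pushforward_inj:
  assumes "inj h"
  shows "pushforward h f (h i) = f i"
proof -
  have "h -` {h i} = {i}"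
    using assms by (auto simp: inj_def)
  then show ?thesis
    by (simp add: pushforward_def)
qed

lemma pushforward_outside:
  assumes "j \<notin> range h"
  shows "pushforward h f j = 0"
proof -
  have "h -` {j} = {}"
    using assms by auto
  then show ?thesis
    by (simp add: pushforward_def)
qed

lemma pushforward_id: "pushforward (\<lambda>x. x) f = f"
  by (rule ext) (simp add: pushforward_def vimage_def)

lemma pushforward_add:
  assumes "null_family f" "null_family g"
  shows "pushforward h (\<lambda>i. f i + g i) j = pushforward h f j + pushforward h g j"
  unfolding pushforward_def by (intro infsum_add null_family_summable assms)

section \<open>Convolution and its laws\<close>

definition convolution ::
    "('m::comm_monoid_add \<Rightarrow> 'a) \<Rightarrow> ('m \<Rightarrow> 'a) \<Rightarrow> 'm \<Rightarrow> 'a::complete_nonarch_field" where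
  "convolution f g = pushforward (\<lambda>(a, b). a + b) (\<lambda>(a, b). f a * g b)"

lemma null_family_convolution:
  assumes "null_family f" "null_family g"
  shows "null_family (convolution f g)"
  unfolding convolution_def by (intro null_family_pushforward null_family_tensor assms)

text \<open>The two tensor products are exchanged by \<open>prod.swap\<close>, and addition is
  invariant under it.\<close>

lemma convolution_commute:
  assumes "null_family f" "null_family g"
  shows "convolution f g = convolution g f"
proof -
  have "(\<lambda>(a, b). f a * g b) = pushforward prod.swap (\<lambda>(a, b). g a * f b)"
  proof
    fix z
    show "(case z of (a, b) \<Rightarrow> f a * g b) = pushforward prod.swap (\<lambda>(a, b). g a * f b) z"
      using pushforward_inj[OF inj_swap, of "\<lambda>(a, b). g a * f b" "prod.swap z"]
      by (cases z) (simp add: mult.commute)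
  qed
  moreover have "(\<lambda>(a, b). a + b) \<circ> prod.swap = (\<lambda>(a, b). a + (b::'a))"
    by (auto simp: add.commute)
  ultimately show ?thesis
    unfolding convolution_def
    by (simp add: pushforward_pushforward null_family_tensor assms)
qed

text \<open>A description of the triple product in which the three factors play symmetric roles: one
  image, under threefold addition, of the threefold tensor product.\<close>

lemma pushforward_convolution_assoc:
  assumes "null_family f" "null_family g" "null_family k"
  shows "convolution (convolution f g) k
    = pushforward (\<lambda>((a, b), c). a + b + c) (\<lambda>((a, b), c). f a * g b * k c)"
proof -
  have fg: "null_family (\<lambda>(a, b). f a * g b)"
    using assms by (intro null_family_tensor)
  have fgk: "null_family (\<lambda>(ab, c). (case ab of (a, b) \<Rightarrow> f a * g b) * k c)"
    by (intro null_family_tensor fg assms)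
  have comp: "(\<lambda>(a, b). a + b) \<circ> map_prod (\<lambda>(a, b). a + b) id = (\<lambda>((a, b), c). a + b + (c::'a))"
    by auto
  show ?thesis
    unfolding convolution_def pushforward_tensor_left[OF fg assms(3), symmetric]
      pushforward_pushforward[OF fgk] comp
    by (simp add: case_prod_unfold)
qed

text \<open>Rather than moving brackets, the three factors are rotated. By the symmetric description
  of triple products, (f g) k equals (g k) f, and commutativity does the rest.\<close>

lemma convolution_assoc:
  assumes "null_family f" "null_family g" "null_family k"
  shows "convolution (convolution f g) k = convolution f (convolution g k)"
proof -
  let ?r = "\<lambda>((b, c), a). ((a, b), c)"
  have inj: "inj (?r :: ('a \<times> 'a) \<times> 'a \<Rightarrow> _)"
    by (auto simp: inj_def)
  have null: "null_family (\<lambda>((b, c), a). g b * k c * f a)"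
    using null_family_tensor[OF null_family_tensor[OF assms(2,3)] assms(1)]
    by (simp add: case_prod_unfold)
  have "(\<lambda>((a, b), c). f a * g b * k c) = pushforward ?r (\<lambda>((b, c), a). g b * k c * f a)"
  proof
    fix z :: "('a \<times> 'a) \<times> 'a"
    obtain a b c where z: "z = ((a, b), c)"
      by (metis prod.exhaust)
    show "(case z of (x, xa) \<Rightarrow> (case x of (a, b) \<Rightarrow> \<lambda>c. f a * g b * k c) xa)
        = pushforward ?r (\<lambda>((b, c), a). g b * k c * f a) z"
      using pushforward_inj[OF inj, of "\<lambda>((b, c), a). g b * k c * f a" "((b, c), a)"]
      by (simp add: z mult.commute mult.left_commute)
  qed
  then have "convolution (convolution f g) k
      = pushforward ((\<lambda>((a, b), c). a + b + c) \<circ> ?r) (\<lambda>((b, c), a). g b * k c * f a)"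
    using assms by (simp add: pushforward_convolution_assoc pushforward_pushforward[OF null])
  also have "(\<lambda>((a, b), c). a + b + c) \<circ> ?r = (\<lambda>((a, b), c). a + b + (c::'a))"
    by (auto simp: add_ac)
  also have "pushforward \<dots> (\<lambda>((b, c), a). g b * k c * f a) = convolution (convolution g k) f"
    using assms by (simp add: pushforward_convolution_assoc)
  also have "\<dots> = convolution f (convolution g k)"
    by (intro convolution_commute null_family_convolution assms)
  finally show ?thesis .
qed

lemma convolution_add_left:
  assumes "null_family f" "null_family g" "null_family k"
  shows "convolution (\<lambda>e. f e + g e) k = (\<lambda>e. convolution f k e + convolution g k e)"
  unfolding convolution_def
  by (auto simp: fun_eq_iff distrib_right case_prod_unfold
      intro!: pushforward_add[unfolded fun_eq_iff] null_family_tensor[unfolded case_prod_unfold] assms)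

text \<open>Submultiplicativity of the Gauss norm, phrased with upper bounds in place of
  suprema.\<close>

lemma vnorm_convolution_le:
  assumes "\<And>e. vnorm (f e) \<le> s" "\<And>e. vnorm (g e) \<le> t"
  shows "vnorm (convolution f g e) \<le> s * t"
proof -
  have "0 \<le> s" "0 \<le> t"
    using assms vnorm_ge_0 order_trans by blast+
  then show ?thesis
    unfolding convolution_def pushforward_def
    by (intro vnorm_infsum_le) (auto intro!: vnorm_mult_le assms)
qed

definition monomial :: "'m \<Rightarrow> 'a::complete_nonarch_field \<Rightarrow> 'm \<Rightarrow> 'a" where
  "monomial e c = (\<lambda>e'. if e' = e then c else 0)"

lemma null_family_monomial: "null_family (monomial e c)"
  by (rule null_family_finite_support[of "{e}"]) (auto simp: monomial_def)

text \<open>The tensor product with the unit lives on the pairs (a, 0), so it is the image of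
  \<open>f\<close> under a \<mapsto> (a, 0); followed by addition, this map is the identity.\<close>

lemma convolution_one:
  assumes "null_family f"
  shows "convolution f (monomial 0 1) = f"
proof -
  have inj: "inj (\<lambda>a::'a. (a, 0::'a))"
    by (auto simp: inj_def)
  have "(\<lambda>(a, b). f a * monomial 0 1 b) = pushforward (\<lambda>a. (a, 0::'a)) f"
  proof
    fix z :: "'a \<times> 'a"
    obtain a b where z: "z = (a, b)"
      by fastforce
    show "(case z of (a, b) \<Rightarrow> f a * monomial 0 1 b) = pushforward (\<lambda>a. (a, 0)) f z"
      using pushforward_inj[OF inj, of f a] pushforward_outside[of "(a, b)" "\<lambda>a. (a, 0)" f]
      by (auto simp: z monomial_def)
  qed
  then show ?thesis
    unfolding convolution_def
    by (simp add: pushforward_pushforward[OF assms] o_def pushforward_id)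
qed

text \<open>Evaluation at the point whose monomials take the values \<open>\<psi> e\<close>.\<close>

definition evaluate :: "('m \<Rightarrow> 'a) \<Rightarrow> ('m \<Rightarrow> 'a) \<Rightarrow> 'a::complete_nonarch_field" where
  "evaluate \<psi> f = infsum (\<lambda>e. f e * \<psi> e) UNIV"

text \<open>The family (f a \<psi> a)(g b \<psi> b) is summed over all pairs in two ways. Grouped by
  a + b it gives the value of the product, since \<psi> is multiplicative on \<open>E\<close> and
  pairs outside \<open>E\<close> \<times> \<open>E\<close> contribute 0 on both sides. Grouped by b
  it gives the product of the values.\<close>

lemma evaluate_convolution:
  fixes f g :: "'m::comm_monoid_add \<Rightarrow> 'a::complete_nonarch_field"
  assumes "null_family f" "null_family g"
    and supp: "\<And>e. e \<notin> E \<Longrightarrow> f e = 0" "\<And>e. e \<notin> E \<Longrightarrow> g e = 0"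
    and \<psi>: "\<And>a b. a \<in> E \<Longrightarrow> b \<in> E \<Longrightarrow> \<psi> (a + b) = \<psi> a * \<psi> b"
      "\<And>e. e \<in> E \<Longrightarrow> vnorm (\<psi> e) \<le> 1"
  shows "evaluate \<psi> (convolution f g) = evaluate \<psi> f * evaluate \<psi> g"
proof -
  have null: "null_family (\<lambda>e. h e * \<psi> e)"
    if "null_family h" "\<And>e. e \<notin> E \<Longrightarrow> h e = 0" for h
  proof (rule null_family_dominated[OF that(1), of _ 1])
    show "vnorm (h e * \<psi> e) \<le> 1 * vnorm (h e)" for e
      using that(2)[of e] \<psi>(2)[of e] by (cases "e \<in> E") (auto simp: vnorm_mult mult_left_le)
  qed simp
  note nf = null[OF assms(1) supp(1)] and ng = null[OF assms(2) supp(2)]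
  note nfg = null_family_tensor[OF nf ng]
  have eq: "convolution f g e * \<psi> e = pushforward (\<lambda>(a, b). a + b) (\<lambda>(a, b). (f a * \<psi> a) * (g b * \<psi> b)) e" for e
  proof -
    have "convolution f g e * \<psi> e = infsum (\<lambda>z. (case z of (a, b) \<Rightarrow> f a * g b) * \<psi> e) ((\<lambda>(a, b). a + b) -` {e})"
      unfolding convolution_def pushforward_def
      by (rule infsum_cmult_left[symmetric]) (intro null_family_summable null_family_tensor assms)
    also have "\<dots> = infsum (\<lambda>(a, b). (f a * \<psi> a) * (g b * \<psi> b)) ((\<lambda>(a, b). a + b) -` {e})"
    proof (rule infsum_cong)
      fix z assume z: "z \<in> (\<lambda>(a, b). a + b) -` {e}"
      obtain a b where ab: "z = (a, b)"
        by (cases z)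
      show "(case z of (a, b) \<Rightarrow> f a * g b) * \<psi> e = (case z of (a, b) \<Rightarrow> f a * \<psi> a * (g b * \<psi> b))"
        using z ab supp[of a] supp[of b] \<psi>(1)[of a b] by (cases "a \<in> E \<and> b \<in> E") auto
    qed
    finally show ?thesis
      by (simp add: pushforward_def)
  qed
  have "evaluate \<psi> (convolution f g) = infsum (\<lambda>(a, b). (f a * \<psi> a) * (g b * \<psi> b)) UNIV"
    unfolding evaluate_def eq using infsum_pushforward[OF nfg, of _ UNIV] by simp
  also have "\<dots> = infsum (pushforward snd (\<lambda>(a, b). (f a * \<psi> a) * (g b * \<psi> b))) UNIV"
    using infsum_pushforward[OF nfg, of snd UNIV] by simp
  also have "pushforward snd (\<lambda>(a, b). (f a * \<psi> a) * (g b * \<psi> b)) = (\<lambda>b. evaluate \<psi> f * (g b * \<psi> b))"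
  proof
    fix b :: 'm
    have inj: "inj (\<lambda>a::'m. (a, b))"
      by (auto simp: inj_def)
    have "pushforward snd (\<lambda>(a, b). (f a * \<psi> a) * (g b * \<psi> b)) b
        = infsum (\<lambda>(a, b). (f a * \<psi> a) * (g b * \<psi> b)) (range (\<lambda>a. (a, b)))"
      unfolding pushforward_def by (rule arg_cong[where f = "infsum _"]) auto
    also have "\<dots> = infsum (\<lambda>a. (f a * \<psi> a) * (g b * \<psi> b)) UNIV"
      by (subst infsum_reindex[OF inj]) (simp add: o_def)
    also have "\<dots> = evaluate \<psi> f * (g b * \<psi> b)"
      unfolding evaluate_def by (rule infsum_cmult_left) (intro null_family_summable nf)
    finally show "pushforward snd (\<lambda>(a, b). (f a * \<psi> a) * (g b * \<psi> b)) b = evaluate \<psi> f * (g b * \<psi> b)" .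
  qed
  also have "infsum (\<lambda>b. evaluate \<psi> f * (g b * \<psi> b)) UNIV = evaluate \<psi> f * evaluate \<psi> g"
    unfolding evaluate_def by (rule infsum_cmult_right) (intro null_family_summable ng)
  finally show ?thesis .
qed

section \<open>The ring of convergent series\<close>

lemma residue_char_pos: "residue_char TYPE('c::perfectoid_field) > 0"
  using prime_residue_char[where 'a = 'c] by (rule prime_gt_0_nat)

lemma zero_mem_p_exponents [simp]: "0 \<in> p_exponents p n"
  by (auto simp: p_exponents_def intro!: exI[of _ 0])

lemma p_exponents_add:
  assumes "p > 0" "a \<in> p_exponents p n" "b \<in> p_exponents p n"
  shows "a + b \<in> p_exponents p n"
  unfolding p_exponents_def
proof (clarify, intro conjI allI)
  show "Poly_Mapping.keys (a + b) \<subseteq> {..<n}"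
    using assms(2,3) Poly_Mapping.keys_add[of a b] by (auto simp: p_exponents_def)
  fix i
  obtain m k where 1: "Poly_Mapping.lookup a i = of_nat m / of_nat p ^ k"
    using assms(2) unfolding p_exponents_def by blast
  obtain m' k' where 2: "Poly_Mapping.lookup b i = of_nat m' / of_nat p ^ k'"
    using assms(3) unfolding p_exponents_def by blast
  show "\<exists>m k. Poly_Mapping.lookup (a + b) i = of_nat m / of_nat p ^ k"
    using assms(1)
    unfolding lookup_add 1 2
    by (intro exI[of _ "m * p ^ k' + m' * p ^ k"] exI[of _ "k + k'"])
       (simp add: add_frac_eq power_add)
qed

lemma tate_carrier:
  fixes f :: "(nat \<Rightarrow>\<^sub>0 rat) \<Rightarrow> 'c::perfectoid_field"
  shows "f \<in> carrier (perfectoid_tate_algebra n) \<longleftrightarrow>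
    (\<forall>e. e \<notin> p_exponents (residue_char TYPE('c)) n \<longrightarrow> f e = 0) \<and> null_family f"
  by (simp add: perfectoid_tate_algebra_def Let_def null_family_def)

lemma tate_add: "f \<oplus>\<^bsub>perfectoid_tate_algebra n\<^esub> g = (\<lambda>e. f e + g e)"
  by (simp add: perfectoid_tate_algebra_def Let_def)

lemma tate_zero: "\<zero>\<^bsub>perfectoid_tate_algebra n\<^esub> = (\<lambda>e. 0)"
  by (simp add: perfectoid_tate_algebra_def Let_def)

lemma tate_one: "\<one>\<^bsub>perfectoid_tate_algebra n\<^esub> = monomial 0 1"
  by (simp add: perfectoid_tate_algebra_def Let_def monomial_def)

lemma tate_smult: "c \<odot>\<^bsub>perfectoid_tate_algebra n\<^esub> f = (\<lambda>e. c * f e)"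
  by (simp add: perfectoid_tate_algebra_def Let_def)

text \<open>The sum over pairs of admissible exponents extends to all pairs, because elements of the
  carrier vanish elsewhere. This makes the laws of \<open>convolution\<close> applicable.\<close>

lemma tate_mult:
  fixes f g :: "(nat \<Rightarrow>\<^sub>0 rat) \<Rightarrow> 'c::perfectoid_field"
  assumes "f \<in> carrier (perfectoid_tate_algebra n)" "g \<in> carrier (perfectoid_tate_algebra n)"
  shows "f \<otimes>\<^bsub>perfectoid_tate_algebra n\<^esub> g = convolution f g"
proof
  fix e
  let ?E = "p_exponents (residue_char TYPE('c)) n"
  have "(f \<otimes>\<^bsub>perfectoid_tate_algebra n\<^esub> g) e = infsum (\<lambda>(a, b). f a * g b) {(a, b) \<in> ?E \<times> ?E. a + b = e}"
    by (simp add: perfectoid_tate_algebra_def Let_def)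
  also have "\<dots> = convolution f g e"
    unfolding convolution_def pushforward_def
    by (rule infsum_cong_neutral) (use assms in \<open>auto simp: tate_carrier\<close>)
  finally show "(f \<otimes>\<^bsub>perfectoid_tate_algebra n\<^esub> g) e = convolution f g e" .
qed

lemma convolution_mem_tate_carrier:
  fixes f g :: "(nat \<Rightarrow>\<^sub>0 rat) \<Rightarrow> 'c::perfectoid_field"
  assumes "f \<in> carrier (perfectoid_tate_algebra n)" "g \<in> carrier (perfectoid_tate_algebra n)"
  shows "convolution f g \<in> carrier (perfectoid_tate_algebra n)"
  unfolding tate_carrier
proof (intro conjI allI impI)
  show "null_family (convolution f g)"
    using assms by (intro null_family_convolution) (auto simp: tate_carrier)
  fix e
  assume e: "e \<notin> p_exponents (residue_char TYPE('c)) n"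
  have "f a * g b = 0" if "a + b = e" for a b
    using assms p_exponents_add[OF residue_char_pos[where 'c = 'c], of a n b] e that
    by (auto simp: tate_carrier)
  then show "convolution f g e = 0"
    unfolding convolution_def pushforward_def by (intro infsum_0) auto
qed

lemma tate_add_closed:
  assumes "f \<in> carrier (perfectoid_tate_algebra n)" "g \<in> carrier (perfectoid_tate_algebra n)"
  shows "(\<lambda>e. f e + g e) \<in> carrier (perfectoid_tate_algebra n)"
  using assms by (auto simp: tate_carrier intro: null_family_add)

lemma tate_cmult_closed:
  assumes "f \<in> carrier (perfectoid_tate_algebra n)"
  shows "(\<lambda>e. c * f e) \<in> carrier (perfectoid_tate_algebra n)"
  \<comment> \<open>The factor is \<open>vnorm c + 1\<close> since
    \<open>null_family_dominated\<close> asks for a positive one, also when c = 0.\<close>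
  using assms
  by (auto simp: tate_carrier vnorm_mult intro!: null_family_dominated[of f _ "vnorm c + 1"] mult_right_mono
      add_nonneg_pos)

lemma tate_minus_closed:
  assumes "f \<in> carrier (perfectoid_tate_algebra n)"
  shows "(\<lambda>e. - f e) \<in> carrier (perfectoid_tate_algebra n)"
  using tate_cmult_closed[OF assms, of "-1"] by simp

lemma tate_diff_closed:
  assumes "f \<in> carrier (perfectoid_tate_algebra n)" "g \<in> carrier (perfectoid_tate_algebra n)"
  shows "(\<lambda>e. f e - g e) \<in> carrier (perfectoid_tate_algebra n)"
  using tate_add_closed[OF assms(1) tate_minus_closed[OF assms(2)]] by simp

lemma tate_zero_closed: "(\<lambda>e. 0) \<in> carrier (perfectoid_tate_algebra n)"
  by (auto simp: tate_carrier intro: null_family_finite_support[of "{}"])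

lemma tate_monomial_closed:
  assumes "e \<in> p_exponents (residue_char TYPE('c)) n"
  shows "monomial e (c :: 'c::perfectoid_field) \<in> carrier (perfectoid_tate_algebra n)"
  using assms by (auto simp: tate_carrier null_family_monomial) (auto simp: monomial_def)

lemma cring_tate:
  "cring (perfectoid_tate_algebra n :: ('c::perfectoid_field, (nat \<Rightarrow>\<^sub>0 rat) \<Rightarrow> 'c) module)"
    (is "cring ?R")
proof (rule cringI)
  show "abelian_group ?R"
  proof (rule abelian_groupI)
    fix f assume "f \<in> carrier ?R"
    then show "\<exists>g\<in>carrier ?R. g \<oplus>\<^bsub>?R\<^esub> f = \<zero>\<^bsub>?R\<^esub>"
      by (intro bexI[of _ "\<lambda>e. - f e"]) (auto simp: tate_add tate_zero tate_minus_closed)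
  qed (auto simp: tate_add tate_zero tate_zero_closed tate_add_closed add_ac)
  have closed: "f \<otimes>\<^bsub>?R\<^esub> g \<in> carrier ?R" if "f \<in> carrier ?R" "g \<in> carrier ?R" for f g
    using that by (simp add: tate_mult convolution_mem_tate_carrier)
  have comm: "f \<otimes>\<^bsub>?R\<^esub> g = g \<otimes>\<^bsub>?R\<^esub> f" if "f \<in> carrier ?R" "g \<in> carrier ?R" for f g
    using that convolution_commute by (auto simp: tate_mult tate_carrier)
  have one: "\<one>\<^bsub>?R\<^esub> \<in> carrier ?R"
    by (simp add: tate_one tate_monomial_closed)
  show "comm_monoid ?R"
  proof (rule comm_monoidI[OF closed one _ _ comm])
    fix f g k assume *: "f \<in> carrier ?R" "g \<in> carrier ?R" "k \<in> carrier ?R"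
    then show "f \<otimes>\<^bsub>?R\<^esub> g \<otimes>\<^bsub>?R\<^esub> k = f \<otimes>\<^bsub>?R\<^esub> (g \<otimes>\<^bsub>?R\<^esub> k)"
      by (simp add: tate_mult convolution_mem_tate_carrier convolution_assoc tate_carrier[of f]
          tate_carrier[of g] tate_carrier[of k])
  next
    fix f assume f: "f \<in> carrier ?R"
    have "f \<otimes>\<^bsub>?R\<^esub> \<one>\<^bsub>?R\<^esub> = f"
      using f convolution_one[of f] by (simp add: tate_mult tate_one tate_monomial_closed tate_carrier[of f])
    then show "\<one>\<^bsub>?R\<^esub> \<otimes>\<^bsub>?R\<^esub> f = f"
      using comm[OF f one] by simp
  qed
  show "(f \<oplus>\<^bsub>?R\<^esub> g) \<otimes>\<^bsub>?R\<^esub> k = f \<otimes>\<^bsub>?R\<^esub> k \<oplus>\<^bsub>?R\<^esub> g \<otimes>\<^bsub>?R\<^esub> k"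
    if "f \<in> carrier ?R" "g \<in> carrier ?R" "k \<in> carrier ?R" for f g k
    using that convolution_add_left[of f g k]
    by (simp add: tate_add tate_mult tate_add_closed tate_carrier[of f] tate_carrier[of g] tate_carrier[of k])
qed

lemma tate_a_inv:
  fixes f :: "(nat \<Rightarrow>\<^sub>0 rat) \<Rightarrow> 'c::perfectoid_field"
  assumes "f \<in> carrier (perfectoid_tate_algebra n)"
  shows "\<ominus>\<^bsub>perfectoid_tate_algebra n\<^esub> f = (\<lambda>e. - f e)"
proof -
  interpret cring "perfectoid_tate_algebra n :: ('c, (nat \<Rightarrow>\<^sub>0 rat) \<Rightarrow> 'c) module"
    by (rule cring_tate)
  show ?thesis
    by (rule minus_equality) (auto simp: tate_add tate_zero tate_minus_closed assms)
qed

text \<open>Completeness for the Gauss norm, with an explicit geometric rate since the distance to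
  each \<open>S h\<close> is used later. The limit is taken coefficientwise. It is again a null
  family because its coefficients of norm at least \<epsilon> sit where a single sufficiently late
  \<open>S M\<close> has coefficients of norm at least \<epsilon>.\<close>

lemma tate_complete:
  fixes S :: "nat \<Rightarrow> (nat \<Rightarrow>\<^sub>0 rat) \<Rightarrow> 'c::perfectoid_field"
  assumes S: "\<And>h. S h \<in> carrier (perfectoid_tate_algebra n)"
    and step: "\<And>h e. vnorm (S (Suc h) e - S h e) \<le> K * \<delta> ^ h"
    and \<delta>: "0 \<le> \<delta>" "\<delta> < 1"
  obtains F where "F \<in> carrier (perfectoid_tate_algebra n)" "\<And>h e. vnorm (F e - S h e) \<le> K * \<delta> ^ h"
proof -
  have K: "K \<ge> 0"
    using order_trans[OF vnorm_ge_0 step[of 0 0]] by simp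
  have dist: "vnorm (S m e - S h e) \<le> K * \<delta> ^ h" if "h \<le> m" for h m e
    using that
  proof (induction m rule: dec_induct)
    case (step m)
    have "vnorm (S (Suc m) e - S m e) \<le> K * \<delta> ^ h"
      using assms(2)[of m e] mult_left_mono[OF power_decreasing[OF step(1) \<delta>(1)] K] \<delta>(2) by simp
    then show ?case
      using vnorm_add_le[OF _ step.IH, of "S (Suc m) e - S m e"] by simp
  qed (use K \<delta> in simp)
  have small: "\<exists>M. K * \<delta> ^ M < \<epsilon>" if "\<epsilon> > 0" for \<epsilon>
  proof -
    have "(\<lambda>h. K * \<delta> ^ h) \<longlonglongrightarrow> K * 0"
      using \<delta> by (intro tendsto_mult_left LIMSEQ_power_zero) simp
    then show ?thesis
      using that order_tendstoD(2)[of "\<lambda>h. K * \<delta> ^ h" 0 sequentially \<epsilon>]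
      by (auto simp: eventually_sequentially)
  qed
  have "convergent (\<lambda>h. S h e)" for e
  proof (rule Cauchy_convergent, rule metric_CauchyI)
    fix \<epsilon> :: real assume "\<epsilon> > 0"
    then obtain M where M: "K * \<delta> ^ M < \<epsilon>"
      using small by blast
    have "dist (S m e) (S h e) < \<epsilon>" if "m \<ge> M" "h \<ge> M" for m h
      using vnorm_diff_le[OF dist[OF that(1), of e] dist[OF that(2), of e]] M
      by (simp add: dist_vnorm)
    then show "\<exists>M. \<forall>m\<ge>M. \<forall>h\<ge>M. dist (S m e) (S h e) < \<epsilon>"
      by blast
  qed
  then obtain F where F: "\<And>e. (\<lambda>h. S h e) \<longlonglongrightarrow> F e"
    unfolding convergent_def by metis
  have bound: "vnorm (F e - S h e) \<le> K * \<delta> ^ h" for e h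
  proof -
    have "(\<lambda>m. dist (S m e) (S h e)) \<longlonglongrightarrow> dist (F e) (S h e)"
      by (intro tendsto_dist F tendsto_const)
    then have "dist (F e) (S h e) \<le> K * \<delta> ^ h"
      by (rule LIMSEQ_le_const2) (use dist in \<open>auto simp: dist_vnorm\<close>)
    then show ?thesis
      by (simp add: dist_vnorm)
  qed
  have "F e = 0" if "e \<notin> p_exponents (residue_char TYPE('c)) n" for e
  proof (rule ccontr)
    assume "F e \<noteq> 0"
    then obtain M where "K * \<delta> ^ M < vnorm (F e)"
      using small[of "vnorm (F e)"] by auto
    then show False
      using bound[of e M] that S[of M] by (simp add: tate_carrier)
  qed
  moreover have "null_family F"
    unfolding null_family_def
  proof (intro allI impI)
    fix \<epsilon> :: real assume \<epsilon>: "\<epsilon> > 0"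
    then obtain M where M: "K * \<delta> ^ M < \<epsilon>"
      using small by blast
    have "{e. vnorm (F e) \<ge> \<epsilon>} \<subseteq> {e. vnorm (S M e) \<ge> \<epsilon>}"
    proof
      fix e assume "e \<in> {e. vnorm (F e) \<ge> \<epsilon>}"
      then show "e \<in> {e. vnorm (S M e) \<ge> \<epsilon>}"
        using vnorm_add[of "F e - S M e" "S M e"] bound[of e M] M by simp
    qed
    then show "finite {e. vnorm (F e) \<ge> \<epsilon>}"
      using S[of M] \<epsilon> by (auto simp: tate_carrier null_family_def intro: finite_subset)
  qed
  ultimately show ?thesis
    using that[of F] bound by (auto simp: tate_carrier)
qed

section \<open>Maximal ideals and characters\<close>

lemma (in cring) exists_maximalideal:
  assumes "ideal J R" "\<one> \<notin> J"
  obtains I where "maximalideal I R" "J \<subseteq> I"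
proof -
  define A where "A = {I. ideal I R \<and> J \<subseteq> I \<and> \<one> \<notin> I}"
  have "\<exists>M\<in>A. \<forall>I\<in>A. M \<subseteq> I \<longrightarrow> I = M"
  proof (rule subset_Zorn_nonempty)
    show "A \<noteq> {}"
      using assms by (auto simp: A_def)
    fix C assume C: "C \<noteq> {}" "subset.chain A C"
    then have "subset.chain {I. ideal I R} C"
      unfolding pred_on.chain_def A_def by blast
    then have "ideal (\<Union>C) R"
      using chain_Union_is_ideal[of C] C(1) by simp
    then show "\<Union>C \<in> A"
      using C unfolding pred_on.chain_def A_def by blast
  qed
  then obtain M where M: "ideal M R" "J \<subseteq> M" "\<one> \<notin> M"
    "\<And>I. ideal I R \<Longrightarrow> J \<subseteq> I \<Longrightarrow> \<one> \<notin> I \<Longrightarrow> M \<subseteq> I \<Longrightarrow> I = M"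
    by (auto simp: A_def)
  have "maximalideal M R"
  proof (rule maximalidealI[OF M(1)])
    show "carrier R \<noteq> M"
      using M(3) by blast
    fix I assume I: "ideal I R" "M \<subseteq> I" "I \<subseteq> carrier R"
    show "I = M \<or> I = carrier R"
      using M(2,4) I ideal.one_imp_carrier[OF I(1)] by blast
  qed
  then show ?thesis
    using that M(2) by blast
qed

text \<open>The inverse of 1 - g, obtained by iterating s \<mapsto> 1 + g s from 0. Successive
  iterates differ by at most \<delta>^h in Gauss norm.\<close>

lemma tate_geometric_series:
  fixes g :: "(nat \<Rightarrow>\<^sub>0 rat) \<Rightarrow> 'c::perfectoid_field"
  assumes g: "g \<in> carrier (perfectoid_tate_algebra n)" "\<And>e. vnorm (g e) \<le> \<delta>" "\<delta> < 1"
  obtains F where "F \<in> carrier (perfectoid_tate_algebra n)"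
    "F = monomial 0 1 \<oplus>\<^bsub>perfectoid_tate_algebra n\<^esub> g \<otimes>\<^bsub>perfectoid_tate_algebra n\<^esub> F"
proof -
  let ?R = "perfectoid_tate_algebra n :: ('c, (nat \<Rightarrow>\<^sub>0 rat) \<Rightarrow> 'c) module"
  interpret cring ?R
    by (rule cring_tate)
  have \<delta>: "0 \<le> \<delta>"
    using g(2) vnorm_ge_0 order_trans by blast
  define S where "S = rec_nat (\<lambda>e. 0) (\<lambda>_ s e. monomial 0 1 e + convolution g s e)"
  have S_0: "S 0 = (\<lambda>e. 0)" and S_Suc: "S (Suc h) = (\<lambda>e. monomial 0 1 e + convolution g (S h) e)" for h
    by (simp_all add: S_def)
  have S: "S h \<in> carrier ?R" for h
    by (induction h) (auto simp: S_0 S_Suc tate_zero_closed g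
        intro!: tate_add_closed tate_monomial_closed convolution_mem_tate_carrier)
  have conv_diff: "convolution g a e - convolution g b e = convolution g (\<lambda>e. a e - b e) e"
    if "a \<in> carrier ?R" "b \<in> carrier ?R" for a b e
  proof -
    have "g \<otimes>\<^bsub>?R\<^esub> a \<ominus>\<^bsub>?R\<^esub> g \<otimes>\<^bsub>?R\<^esub> b = g \<otimes>\<^bsub>?R\<^esub> (a \<ominus>\<^bsub>?R\<^esub> b)"
      using that g by algebra
    then show ?thesis
      using that g
      by (simp add: a_minus_def tate_add tate_a_inv tate_mult tate_minus_closed tate_diff_closed
          convolution_mem_tate_carrier fun_eq_iff)
  qed
  have step: "vnorm (S (Suc h) e - S h e) \<le> 1 * \<delta> ^ h" for h e
  proof (induction h arbitrary: e)
    case 0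
    have "convolution g (\<lambda>e. 0) e = 0"
      unfolding convolution_def pushforward_def by (intro infsum_0) auto
    then show ?case
      by (auto simp: S_0 S_Suc monomial_def)
  next
    case (Suc h)
    have "S (Suc (Suc h)) e - S (Suc h) e = convolution g (\<lambda>e. S (Suc h) e - S h e) e"
      unfolding conv_diff[OF S S, symmetric] by (simp add: S_Suc)
    then show ?case
      using vnorm_convolution_le[OF g(2) Suc] by simp
  qed
  obtain F where F: "F \<in> carrier ?R" "\<And>h e. vnorm (F e - S h e) \<le> 1 * \<delta> ^ h"
    using tate_complete[OF S step \<delta> g(3)] by blast
  have "F e = monomial 0 1 e + convolution g F e" for e
  proof -
    have *: "vnorm (F e - (monomial 0 1 e + convolution g F e)) \<le> \<delta> ^ Suc h" for h
    proof -
      have "vnorm (convolution g F e - convolution g (S h) e) \<le> \<delta> * (1 * \<delta> ^ h)"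
        unfolding conv_diff[OF F(1) S] by (intro vnorm_convolution_le g F)
      then have "vnorm ((F e - S (Suc h) e) - (convolution g F e - convolution g (S h) e)) \<le> \<delta> ^ Suc h"
        using F(2)[of e "Suc h"] by (intro vnorm_diff_le[of "F e - S (Suc h) e"]) auto
      then show ?thesis
        by (simp add: S_Suc algebra_simps)
    qed
    have "(\<lambda>h. \<delta> ^ Suc h) \<longlonglongrightarrow> 0"
      using \<delta> g(3) by (intro LIMSEQ_power_zero[THEN LIMSEQ_Suc]) simp
    then have "vnorm (F e - (monomial 0 1 e + convolution g F e)) \<le> 0"
      by (rule LIMSEQ_le_const) (use * in blast)
    then show ?thesis
      by (metis eq_iff_diff_eq_0 order_antisym vnorm_eq_0 vnorm_ge_0)
  qed
  then show ?thesis
    using that[of F] F(1) g(1) by (auto simp: tate_add tate_mult)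
qed

text \<open>\<Psi> is reduction modulo a maximal ideal above \<open>J\<close>, followed by the
  inverse of the isomorphism from C to the quotient. It is therefore the identity on constants,
  which allows the rescaling behind the norm bound.\<close>

lemma character_of_nullstellensatz_pair:
  fixes J :: "((nat \<Rightarrow>\<^sub>0 rat) \<Rightarrow> 'c::perfectoid_field) set" and n :: nat
  defines "R \<equiv> perfectoid_tate_algebra n :: ('c, (nat \<Rightarrow>\<^sub>0 rat) \<Rightarrow> 'c) module"
  assumes pair: "nullstellensatz_pair (ring_of_type_algebra :: 'c ring) R"
    and J: "ideal J R" "\<one>\<^bsub>R\<^esub> \<notin> J"
  obtains \<Psi> where "\<And>f g. f \<in> carrier R \<Longrightarrow> g \<in> carrier R \<Longrightarrow> \<Psi> (f \<oplus>\<^bsub>R\<^esub> g) = \<Psi> f + \<Psi> g"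
    "\<And>f g. f \<in> carrier R \<Longrightarrow> g \<in> carrier R \<Longrightarrow> \<Psi> (f \<otimes>\<^bsub>R\<^esub> g) = \<Psi> f * \<Psi> g"
    "\<Psi> \<one>\<^bsub>R\<^esub> = (1 :: 'c)"
    "\<And>f. f \<in> J \<Longrightarrow> \<Psi> f = 0"
    "\<And>f s. f \<in> carrier R \<Longrightarrow> (\<And>e. vnorm (f e) \<le> s) \<Longrightarrow> vnorm (\<Psi> f) \<le> s"
proof -
  let ?C = "ring_of_type_algebra :: 'c ring"
  interpret R: cring R
    unfolding R_def by (rule cring_tate)
  obtain I where I: "maximalideal I R" "J \<subseteq> I"
    using R.exists_maximalideal[OF J] .
  then interpret I: maximalideal I R
    by simp
  define \<phi> where "\<phi> = (\<lambda>c. I +>\<^bsub>R\<^esub> (c \<odot>\<^bsub>R\<^esub> \<one>\<^bsub>R\<^esub>))"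
  have \<phi>: "\<phi> \<in> ring_iso ?C (R Quot I)"
    using pair I(1) unfolding nullstellensatz_pair_def evaluation_ideal_def \<phi>_def by blast
  have Cr: "ring ?C"
    by (rule ring_from_type_algebra)
  have Csimps: "carrier ?C = UNIV" "x \<oplus>\<^bsub>?C\<^esub> y = x + y" "x \<otimes>\<^bsub>?C\<^esub> y = x * y" "\<one>\<^bsub>?C\<^esub> = 1" "\<zero>\<^bsub>?C\<^esub> = 0" for x y
    by (simp_all add: ring_of_type_algebra_def)
  define \<psi> where "\<psi> = inv_into (carrier ?C) \<phi>"
  have \<psi>: "\<psi> \<in> ring_hom (R Quot I) ?C"
    using ring_iso_set_sym[OF Cr \<phi>] by (simp add: \<psi>_def ring_iso_def)
  have nat: "(+>\<^bsub>R\<^esub>) I \<in> ring_hom R (R Quot I)"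
    by (rule I.rcos_ring_hom)
  define \<Psi> where "\<Psi> f = \<psi> (I +>\<^bsub>R\<^esub> f)" for f
  have hom: "\<Psi> \<in> ring_hom R ?C"
    using ring_hom_trans[OF nat \<psi>] by (simp add: \<Psi>_def[abs_def] o_def)
  have add: "\<Psi> (f \<oplus>\<^bsub>R\<^esub> g) = \<Psi> f + \<Psi> g" and mult: "\<Psi> (f \<otimes>\<^bsub>R\<^esub> g) = \<Psi> f * \<Psi> g"
    if "f \<in> carrier R" "g \<in> carrier R" for f g
    using ring_hom_add[OF hom that] ring_hom_mult[OF hom that] by (simp_all add: Csimps)
  have one: "\<Psi> \<one>\<^bsub>R\<^esub> = 1"
    using ring_hom_one[OF hom] by (simp add: Csimps)
  have zero: "\<Psi> f = 0" if "f \<in> J" for f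
  proof -
    have "I +>\<^bsub>R\<^esub> f = I +>\<^bsub>R\<^esub> \<zero>\<^bsub>R\<^esub>"
      using that I(2) by (metis I.a_rcos_const I.additive_subgroup_axioms R.a_coset_add_zero additive_subgroup.a_subset subsetD)
    then have "\<Psi> f = \<Psi> \<zero>\<^bsub>R\<^esub>"
      by (simp add: \<Psi>_def)
    moreover have "\<Psi> \<zero>\<^bsub>R\<^esub> + \<Psi> \<zero>\<^bsub>R\<^esub> = \<Psi> \<zero>\<^bsub>R\<^esub> + 0"
      using add[of "\<zero>\<^bsub>R\<^esub>" "\<zero>\<^bsub>R\<^esub>"] by simp
    ultimately show ?thesis
      by (simp only: add_left_cancel)
  qed
  have inj: "inj \<phi>"
    using \<phi> by (simp add: ring_iso_def bij_betw_def Csimps)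
  have const: "\<Psi> (monomial 0 c) = c" for c
  proof -
    have "monomial 0 c = c \<odot>\<^bsub>R\<^esub> \<one>\<^bsub>R\<^esub>"
      by (auto simp: R_def tate_smult tate_one monomial_def)
    then have "\<Psi> (monomial 0 c) = \<psi> (\<phi> c)"
      by (simp add: \<Psi>_def \<phi>_def)
    then show ?thesis
      using inj by (simp add: \<psi>_def Csimps)
  qed
  have bound: "vnorm (\<Psi> f) \<le> s" if f: "f \<in> carrier R" "\<And>e. vnorm (f e) \<le> s" for f s
  proof (rule ccontr)
    assume less: "\<not> vnorm (\<Psi> f) \<le> s"
    then have nz: "\<Psi> f \<noteq> 0"
      using order_trans[OF vnorm_ge_0 f(2)[of 0]] by auto
    \<comment> \<open>Rescaling by the scalar \<Psi> f gives g with \<Psi> g = 1 and Gauss norm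
      below 1. Then 1 - g is killed by \<Psi> although it is invertible: applying \<Psi> to F = 1 +
      g F yields \<Psi> F = 1 + \<Psi> F.\<close>
    define c where "c = monomial (0 :: nat \<Rightarrow>\<^sub>0 rat) (inverse (\<Psi> f))"
    define g where "g = c \<otimes>\<^bsub>R\<^esub> f"
    have c: "c \<in> carrier R"
      by (simp add: c_def R_def tate_monomial_closed)
    then have g: "g \<in> carrier R" "\<Psi> g = 1"
      using f nz by (simp_all add: g_def mult) (simp add: c_def const)
    have "vnorm (g e) \<le> inverse (vnorm (\<Psi> f)) * s" for e
      unfolding g_def using c f unfolding R_def tate_mult[OF c[unfolded R_def] f(1)[unfolded R_def]]
      by (intro vnorm_convolution_le) (auto simp: c_def monomial_def vnorm_inverse)
    moreover have "inverse (vnorm (\<Psi> f)) * s < 1"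
      using less nz by (simp add: field_simps)
    ultimately obtain F where F: "F \<in> carrier R" "F = monomial 0 1 \<oplus>\<^bsub>R\<^esub> g \<otimes>\<^bsub>R\<^esub> F"
      using tate_geometric_series[OF g(1)[unfolded R_def]] unfolding R_def by metis
    have "\<Psi> F = \<Psi> (monomial 0 1 \<oplus>\<^bsub>R\<^esub> g \<otimes>\<^bsub>R\<^esub> F)"
      using F(2) by simp
    also have "\<dots> = \<Psi> (monomial 0 1) + \<Psi> (g \<otimes>\<^bsub>R\<^esub> F)"
      using F(1) g c by (intro add R.m_closed) (auto simp: R_def tate_monomial_closed)
    also have "\<dots> = 1 + \<Psi> F"
      using F(1) g by (simp add: mult const)
    finally show False
      by simp
  qed
  show ?thesis
    using that[of \<Psi>] add mult one zero bound by blast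
qed

section \<open>Additivity and norm bounds for evaluation\<close>

lemma evaluate_add:
  assumes "null_family f" "null_family g"
    and supp: "\<And>e. e \<notin> E \<Longrightarrow> f e = 0" "\<And>e. e \<notin> E \<Longrightarrow> g e = 0"
    and "\<And>e. e \<in> E \<Longrightarrow> vnorm (\<psi> e) \<le> 1"
  shows "evaluate \<psi> (\<lambda>e. f e + g e) = evaluate \<psi> f + evaluate \<psi> g"
proof -
  have "null_family (\<lambda>e. h e * \<psi> e)" if "null_family h" "\<And>e. e \<notin> E \<Longrightarrow> h e = 0" for h
  proof (rule null_family_dominated[OF that(1), of _ 1])
    show "vnorm (h e * \<psi> e) \<le> 1 * vnorm (h e)" for e
      using that(2)[of e] assms(5)[of e] by (cases "e \<in> E") (auto simp: vnorm_mult mult_left_le)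
  qed simp
  then show ?thesis
    unfolding evaluate_def distrib_right using assms by (intro infsum_add null_family_summable) auto
qed

lemma vnorm_evaluate_le:
  assumes "\<And>e. e \<notin> E \<Longrightarrow> f e = 0" "\<And>e. e \<in> E \<Longrightarrow> vnorm (\<psi> e) \<le> 1" "\<And>e. vnorm (f e) \<le> s"
  shows "vnorm (evaluate \<psi> f) \<le> s"
  unfolding evaluate_def
proof (rule vnorm_infsum_le)
  show "0 \<le> s"
    using assms(3) vnorm_ge_0 order_trans by blast
  show "vnorm (f e * \<psi> e) \<le> s" for e
    using assms(1)[of e] \<open>0 \<le> s\<close> vnorm_mult_le[OF assms(3)[of e] assms(2)[of e]] by (cases "e \<in> E") auto
qed

lemma evaluate_monomial: "evaluate \<psi> (monomial e c) = c * \<psi> e"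
proof -
  have "evaluate \<psi> (monomial e c) = infsum (\<lambda>e'. monomial e c e' * \<psi> e') {e}"
    unfolding evaluate_def by (rule infsum_cong_neutral) (auto simp: monomial_def)
  then show ?thesis
    by (simp add: monomial_def)
qed

section \<open>Compatible systems of p-power roots\<close>

lemma vnorm_divide: "vnorm (x / y) = vnorm x / vnorm (y :: 'a::complete_nonarch_field)"
  by (simp add: divide_inverse vnorm_mult vnorm_inverse)

text \<open>The gcd that defines \<open>residue_char\<close> is attained. It is nonzero, so
  \<open>S\<close> has a least positive element l; since \<open>S\<close> is closed under remainders
  modulo l, this l divides every element of \<open>S\<close>.\<close>

lemma vnorm_residue_char_less_1:
  "vnorm (of_nat (residue_char TYPE('c)) :: 'c::perfectoid_field) < 1"
proof -
  define S where "S = {m. vnorm (of_nat m :: 'c) < 1}"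
  have p: "residue_char TYPE('c) = Gcd S"
    by (simp add: residue_char_def S_def)
  have "\<not> S \<subseteq> {0}"
    using residue_char_pos[where 'c = 'c] p by (metis Gcd_0_iff not_gr_zero)
  then have ex: "\<exists>m. m \<in> S \<and> m > 0"
    by auto
  define l where "l = (LEAST m. m \<in> S \<and> m > 0)"
  have l: "l \<in> S" "l > 0"
    using LeastI_ex[OF ex] by (auto simp: l_def)
  have dvd: "l dvd m" if "m \<in> S" for m
  proof -
    have "(of_nat (m mod l) :: 'c) = of_nat m - of_nat l * of_nat (m div l)"
      by (metis add_diff_cancel_left' mult_div_mod_eq of_nat_add of_nat_mult)
    moreover have "vnorm (of_nat l * of_nat (m div l) :: 'c) < 1"
      using l(1) vnorm_of_nat_le[of "m div l", where 'a = 'c] mult_left_le[of "vnorm (of_nat (m div l) :: 'c)" "vnorm (of_nat l :: 'c)"]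
      by (auto simp: vnorm_mult S_def)
    ultimately have "m mod l \<in> S"
      using that vnorm_diff[of "of_nat m :: 'c" "of_nat l * of_nat (m div l)"] by (simp add: S_def)
    then have "\<not> m mod l > 0"
      using not_less_Least[of "m mod l" "\<lambda>m. m \<in> S \<and> m > 0"] mod_less_divisor[OF l(2), of m]
      by (auto simp: l_def)
    then show ?thesis
      by (simp add: dvd_eq_mod_eq_0)
  qed
  have "residue_char TYPE('c) = l"
    unfolding p using l(1) dvd by (intro dvd_antisym Gcd_dvd Gcd_greatest)
  then show ?thesis
    using l(1) by (simp add: S_def)
qed

lemma vnorm_of_nat_le_if_dvd:
  assumes "m dvd k"
  shows "vnorm (of_nat k :: 'a::complete_nonarch_field) \<le> vnorm (of_nat m :: 'a)"
proof -
  obtain j where "k = m * j"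
    using assms by blast
  then show ?thesis
    using vnorm_of_nat_le[of j, where 'a = 'a] by (simp add: vnorm_mult mult_left_le)
qed

lemma binomial_middle:
  fixes a b :: "'a::comm_ring_1"
  assumes "n > 0"
  shows "(a + b) ^ n - a ^ n - b ^ n = (\<Sum>k\<in>{1..<n}. of_nat (n choose k) * a ^ k * b ^ (n - k))"
proof -
  have "{..n} = insert 0 (insert n {1..<n})"
    using assms by auto
  then have "(a + b) ^ n = b ^ n + (a ^ n + (\<Sum>k\<in>{1..<n}. of_nat (n choose k) * a ^ k * b ^ (n - k)))"
    using assms by (simp add: binomial_ring)
  then show ?thesis
    by (simp add: algebra_simps)
qed

section \<open>Exponents in Z[1/p] and p-th powers modulo p\<close>

definition p_nonneg :: "nat \<Rightarrow> rat set" where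
  "p_nonneg p = {of_nat m / of_nat p ^ k | m k. True}"

definition p_rationals :: "nat \<Rightarrow> rat set" where
  "p_rationals p = {of_int a / of_nat p ^ k | a k. True}"

lemma p_nonnegI: "of_nat m / of_nat p ^ k \<in> p_nonneg p"
  unfolding p_nonneg_def by blast

lemma p_rationals_mult:
  assumes "q \<in> p_rationals p" "r \<in> p_rationals p"
  shows "q * r \<in> p_rationals p"
proof -
  obtain a k b l where "q = of_int a / of_nat p ^ k" "r = of_int b / of_nat p ^ l"
    using assms unfolding p_rationals_def by blast
  then have "q * r = of_int (a * b) / of_nat p ^ (k + l)"
    by (simp add: power_add)
  then show ?thesis
    unfolding p_rationals_def by blast
qed

lemma p_rationals_of_int: "of_int a \<in> p_rationals p"
  unfolding p_rationals_def by (force intro: exI[of _ 0])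

lemma p_rationals_inverse_power: "1 / of_nat p ^ k \<in> p_rationals p"
  unfolding p_rationals_def by (force intro: exI[of _ 1])

lemma p_rationals_uminus: "q \<in> p_rationals p \<Longrightarrow> - q \<in> p_rationals p"
  using p_rationals_mult[OF p_rationals_of_int[of "-1"]] by simp

context
  fixes p :: nat
  assumes prime: "Factorial_Ring.prime p"
begin

text \<open>The middle binomial coefficients are divisible by p, and each middle term contains a
  factor a. Keeping the bound \<open>s\<close> for that factor, and not only |p|, is what makes
  \<open>vnorm_power_diff_le\<close> a contraction.\<close>

lemma vnorm_frobenius_defect:
  fixes a b :: "'a::complete_nonarch_field"
  assumes "vnorm a \<le> s" "s \<le> 1" "vnorm b \<le> 1"
  shows "vnorm ((a + b) ^ p - a ^ p - b ^ p) \<le> vnorm (of_nat p :: 'a) * s"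
proof -
  have s: "0 \<le> s"
    using assms(1) vnorm_ge_0 order_trans by blast
  have "vnorm (of_nat (p choose k) * a ^ k * b ^ (p - k)) \<le> vnorm (of_nat p :: 'a) * s * 1"
    if k: "k \<in> {1..<p}" for k
  proof (intro vnorm_mult_le)
    show "vnorm (of_nat (p choose k) :: 'a) \<le> vnorm (of_nat p :: 'a)"
      using k prime by (intro vnorm_of_nat_le_if_dvd dvd_choose_prime) auto
    have "vnorm a ^ k \<le> s ^ k"
      using assms(1) by (intro power_mono) auto
    also have "\<dots> \<le> s ^ 1"
      using k assms(2) s by (intro power_decreasing) auto
    finally show "vnorm (a ^ k) \<le> s"
      by (simp add: vnorm_power)
    show "vnorm (b ^ (p - k)) \<le> 1"
      using assms(3) by (simp add: vnorm_power power_le_one)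
  qed
  then show ?thesis
    unfolding binomial_middle[OF prime_gt_0_nat[OF prime]]
    using s by (intro vnorm_sum_le) auto
qed

text \<open>Additivity of Frobenius modulo p. It is the reason why the sums of p^m-th roots of the
  monomials form an approximate system of p-power roots.\<close>

lemma vnorm_sum_power_defect:
  fixes x :: "'i \<Rightarrow> 'a::complete_nonarch_field"
  assumes "\<And>i. i \<in> A \<Longrightarrow> vnorm (x i) \<le> 1"
  shows "vnorm ((\<Sum>i\<in>A. x i) ^ p - (\<Sum>i\<in>A. x i ^ p)) \<le> vnorm (of_nat p :: 'a)"
  using assms
proof (induction A rule: infinite_finite_induct)
  case (insert j A)
  have "vnorm ((x j + sum x A) ^ p - x j ^ p - sum x A ^ p) \<le> vnorm (of_nat p :: 'a) * 1"
    using insert.prems by (intro vnorm_frobenius_defect vnorm_sum_le) auto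
  moreover have "vnorm (sum x A ^ p - (\<Sum>i\<in>A. x i ^ p)) \<le> vnorm (of_nat p :: 'a)"
    using insert by auto
  ultimately have "vnorm (((x j + sum x A) ^ p - x j ^ p - sum x A ^ p) + (sum x A ^ p - (\<Sum>i\<in>A. x i ^ p)))
      \<le> vnorm (of_nat p :: 'a)"
    by (intro vnorm_add_le) auto
  then show ?case
    using insert.hyps by (simp add: algebra_simps)
qed (use prime_gt_0_nat[OF prime] in \<open>auto simp: zero_power\<close>)

text \<open>With d = a - b, the power d^p has norm at most s^2 \<le> |p| s, and the mixed terms
  carry both a factor p and a factor d. Raising to the p-th power thus improves a congruence by a
  factor |p|.\<close>

lemma vnorm_power_diff_le:
  fixes a b :: "'a::complete_nonarch_field"
  assumes ab: "vnorm (a - b) \<le> s" "s \<le> vnorm (of_nat p :: 'a)" "vnorm b \<le> 1"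
  shows "vnorm (a ^ p - b ^ p) \<le> vnorm (of_nat p :: 'a) * s"
proof -
  have s: "0 \<le> s" "s \<le> 1"
    using ab(1,2) vnorm_of_nat_le[of p, where 'a = 'a] order_trans[OF vnorm_ge_0 ab(1)] by auto
  have "vnorm ((a - b) ^ p) \<le> s ^ p"
    using ab(1) by (simp add: vnorm_power power_mono)
  also have "\<dots> \<le> s ^ 2"
    using s prime_ge_2_nat[OF prime] by (intro power_decreasing) auto
  also have "\<dots> \<le> vnorm (of_nat p :: 'a) * s"
    using s ab(2) by (simp add: power2_eq_square mult_right_mono)
  finally have "vnorm ((a - b) ^ p) \<le> vnorm (of_nat p :: 'a) * s" .
  moreover have "vnorm ((a - b + b) ^ p - (a - b) ^ p - b ^ p) \<le> vnorm (of_nat p :: 'a) * s"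
    using ab s by (intro vnorm_frobenius_defect) auto
  ultimately have "vnorm (((a - b + b) ^ p - (a - b) ^ p - b ^ p) + (a - b) ^ p) \<le> vnorm (of_nat p :: 'a) * s"
    by (intro vnorm_add_le)
  then show ?thesis
    by simp
qed

text \<open>An approximate system of \<open>p\<close>-power roots is rigidified as in the construction of the map
  from the tilt: \<open>\<beta> m\<close> is the limit of \<open>b (m + h) ^ p ^ h\<close>.\<close>

lemma lift_power_roots:
  fixes b :: "nat \<Rightarrow> 'a::complete_nonarch_field"
  assumes less: "vnorm (of_nat p :: 'a) < 1"
    and b: "\<And>m. vnorm (b m) \<le> 1" "\<And>m. vnorm (b (Suc m) ^ p - b m) \<le> vnorm (of_nat p :: 'a)"
  obtains \<beta> where "\<And>m. \<beta> (Suc m) ^ p = \<beta> m" "\<And>m. vnorm (\<beta> m - b m) \<le> vnorm (of_nat p :: 'a)"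
    "\<And>m. vnorm (\<beta> m) \<le> 1"
proof -
  define P where "P = vnorm (of_nat p :: 'a)"
  have P: "0 \<le> P" "P < 1"
    using less by (simp_all add: P_def)
  \<comment> \<open>Each of the h further p-th powers gains a factor \<open>P\<close> over the
    initial congruence modulo p.\<close>
  have step1: "vnorm (b (Suc m + h) ^ p ^ Suc h - b (m + h) ^ p ^ h) \<le> P ^ Suc h" for m h
  proof (induction h arbitrary: m)
    case 0
    then show ?case
      using b(2) by (simp add: P_def)
  next
    case (Suc h)
    have "P ^ Suc h \<le> P"
      using P by (simp add: mult_left_le power_le_one)
    then have "vnorm ((b (Suc (Suc m) + h) ^ p ^ Suc h) ^ p - (b (Suc m + h) ^ p ^ h) ^ p) \<le> P * P ^ Suc h"
      unfolding P_def using Suc[of "Suc m"] b(1)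
      by (intro vnorm_power_diff_le) (auto simp: P_def vnorm_power power_le_one)
    then show ?case
      by (simp add: power_mult[symmetric] mult.commute)
  qed
  have dist: "vnorm (b (m + k) ^ p ^ k - b (m + h) ^ p ^ h) \<le> P ^ Suc h" if "h \<le> k" for m h k
    using that
  proof (induction k rule: dec_induct)
    case (step k)
    have "vnorm (b (Suc m + k) ^ p ^ Suc k - b (m + k) ^ p ^ k) \<le> P ^ Suc h"
      using \<open>h \<le> k\<close> P by (intro order_trans[OF step1] power_decreasing) auto
    then show ?case
      using vnorm_add_le[OF _ step.IH, of "b (Suc m + k) ^ p ^ Suc k - b (m + k) ^ p ^ k"] by simp
  qed (use P in simp)
  have "convergent (\<lambda>h. b (m + h) ^ p ^ h)" for m
  proof (rule Cauchy_convergent, rule metric_CauchyI)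
    fix \<epsilon> :: real assume \<epsilon>: "\<epsilon> > 0"
    have "(\<lambda>h. P ^ Suc h) \<longlonglongrightarrow> 0"
      using P by (intro LIMSEQ_power_zero[THEN LIMSEQ_Suc]) simp
    then obtain M where M: "P ^ Suc M < \<epsilon>"
      using order_tendstoD(2)[of "\<lambda>h. P ^ Suc h" 0 sequentially \<epsilon>] \<epsilon> by (auto simp: eventually_sequentially)
    have "dist (b (m + k) ^ p ^ k) (b (m + h) ^ p ^ h) < \<epsilon>" if "k \<ge> M" "h \<ge> M" for k h
      using vnorm_diff_le[OF dist[OF that(1), of m] dist[OF that(2), of m]] M
      by (simp add: dist_vnorm)
    then show "\<exists>M. \<forall>k\<ge>M. \<forall>h\<ge>M. dist (b (m + k) ^ p ^ k) (b (m + h) ^ p ^ h) < \<epsilon>"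
      by blast
  qed
  then obtain \<beta> where \<beta>: "\<And>m. (\<lambda>h. b (m + h) ^ p ^ h) \<longlonglongrightarrow> \<beta> m"
    unfolding convergent_def by metis
  have near: "vnorm (\<beta> m - b m) \<le> P" for m
  proof -
    have "(\<lambda>h. dist (b (m + h) ^ p ^ h) (b m)) \<longlonglongrightarrow> dist (\<beta> m) (b m)"
      by (intro tendsto_dist \<beta> tendsto_const)
    then have "dist (\<beta> m) (b m) \<le> P"
      by (rule LIMSEQ_le_const2) (use dist[of 0] in \<open>auto simp: dist_vnorm\<close>)
    then show ?thesis
      by (simp add: dist_vnorm)
  qed
  have le1: "vnorm (\<beta> m) \<le> 1" for m
    using vnorm_add_le[of "\<beta> m - b m" 1 "b m"] near[of m] b(1)[of m] P by simp
  have root: "\<beta> (Suc m) ^ p = \<beta> m" for m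
  proof -
    have pow: "(\<lambda>h. x h ^ j) \<longlonglongrightarrow> y ^ j" if "x \<longlonglongrightarrow> y" for x :: "nat \<Rightarrow> 'a" and y j
    proof (induction j)
      case (Suc j)
      then show ?case
        using tendsto_mult[OF that Suc] by simp
    qed simp
    have "(\<lambda>h. (b (Suc m + h) ^ p ^ h) ^ p) \<longlonglongrightarrow> \<beta> (Suc m) ^ p"
      by (intro pow \<beta>)
    moreover have "(\<lambda>h. b (m + Suc h) ^ p ^ Suc h) \<longlonglongrightarrow> \<beta> m"
      using \<beta>[of m] by (rule LIMSEQ_Suc)
    then have "(\<lambda>h. (b (Suc m + h) ^ p ^ h) ^ p) \<longlonglongrightarrow> \<beta> m"
      by (simp add: power_mult[symmetric] mult.commute)
    ultimately show ?thesis
      by (rule LIMSEQ_unique)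
  qed
  show ?thesis
    using that[of \<beta>] root near le1 by (simp add: P_def)
qed

lemma p_nonneg_iff: "q \<in> p_nonneg p \<longleftrightarrow> q \<in> p_rationals p \<and> q \<ge> 0"
proof
  assume "q \<in> p_nonneg p"
  then show "q \<in> p_rationals p \<and> q \<ge> 0"
    unfolding p_nonneg_def p_rationals_def by (force intro: exI[of _ "int _"])
next
  assume q: "q \<in> p_rationals p \<and> q \<ge> 0"
  then obtain a k where a: "q = of_int a / of_nat p ^ k"
    unfolding p_rationals_def by blast
  have "(of_nat p ^ k :: rat) > 0"
    using prime_gt_0_nat[OF prime] by simp
  then have "(of_int a :: rat) = q * of_nat p ^ k" "0 \<le> q * of_nat p ^ k"
    using q by (metis a less_irrefl nonzero_divide_eq_eq) (use \<open>0 < _\<close> q in simp)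
  then have "a \<ge> 0"
    by linarith
  then have "q = of_nat (nat a) / of_nat p ^ k"
    by (simp add: a)
  then show "q \<in> p_nonneg p"
    by (simp only: p_nonnegI)
qed

lemma p_rationals_add:
  assumes "q \<in> p_rationals p" "r \<in> p_rationals p"
  shows "q + r \<in> p_rationals p"
proof -
  obtain a k b l where "q = of_int a / of_nat p ^ k" "r = of_int b / of_nat p ^ l"
    using assms unfolding p_rationals_def by blast
  then have "q + r = of_int (a * int p ^ l + b * int p ^ k) / of_nat p ^ (k + l)"
    using prime_gt_0_nat[OF prime] by (simp add: add_frac_eq power_add)
  then show ?thesis
    unfolding p_rationals_def by blast
qed

lemma p_rationals_diff: "q \<in> p_rationals p \<Longrightarrow> r \<in> p_rationals p \<Longrightarrow> q - r \<in> p_rationals p"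
  using p_rationals_add[OF _ p_rationals_uminus] by fastforce

lemma p_rationals_dense:
  fixes x :: real
  assumes "\<epsilon> > 0"
  obtains q where "q \<in> p_rationals p" "x \<le> real_of_rat q" "real_of_rat q < x + \<epsilon>"
proof -
  have p: "real p > 1"
    using prime_gt_1_nat[OF prime] by simp
  obtain m where m: "1 / \<epsilon> < real p ^ m"
    using real_arch_pow[OF p] by blast
  have pm: "real p ^ m > 0"
    by (rule zero_less_power) (use p in linarith)
  have m': "1 / real p ^ m < \<epsilon>"
    using m pm assms by (simp add: field_simps)
  define q where "q = (of_int \<lceil>x * real p ^ m\<rceil> / of_nat p ^ m :: rat)"
  have "real_of_rat q = real_of_int \<lceil>x * real p ^ m\<rceil> / real p ^ m"
    by (simp add: q_def of_rat_divide of_rat_power)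
  moreover have "x * real p ^ m / real p ^ m \<le> real_of_int \<lceil>x * real p ^ m\<rceil> / real p ^ m"
    using pm by (intro divide_right_mono) (auto intro: less_imp_le)
  moreover have "real_of_int \<lceil>x * real p ^ m\<rceil> / real p ^ m < (x * real p ^ m + 1) / real p ^ m"
    using pm by (intro divide_strict_right_mono) linarith+
  ultimately have "x \<le> real_of_rat q" "real_of_rat q < x + \<epsilon>"
    using m' pm by (auto simp: add_divide_distrib)
  moreover have "q \<in> p_rationals p"
    unfolding q_def p_rationals_def by blast
  ultimately show ?thesis
    using that by blast
qed

text \<open>A compatible system of roots amounts to a multiplicative map on the nonnegative part of
  Z[1/p]. Two fractions for the same exponent are compared by rewriting both powers in terms of the
  root of level k + k'.\<close>

lemma power_system:
  fixes \<beta> :: "nat \<Rightarrow> 'a::complete_nonarch_field"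
  assumes root: "\<And>m. \<beta> (Suc m) ^ p = \<beta> m"
  obtains V where "\<And>m k. V (of_nat m / of_nat p ^ k) = \<beta> k ^ m"
    "\<And>q r. q \<in> p_nonneg p \<Longrightarrow> r \<in> p_nonneg p \<Longrightarrow> V (q + r) = V q * V r"
proof -
  have p: "p > 0"
    using prime by (rule prime_gt_0_nat)
  have root': "\<beta> (k + j) ^ p ^ j = \<beta> k" for k j
  proof (induction j)
    case (Suc j)
    have "\<beta> (k + Suc j) ^ p ^ Suc j = (\<beta> (Suc (k + j)) ^ p) ^ p ^ j"
      by (simp add: power_mult[symmetric])
    then show ?case
      using Suc by (simp add: root)
  qed simp
  have root'': "\<beta> k ^ m = \<beta> (k + j) ^ (m * p ^ j)" for k m j
    using root'[of k j] by (metis mult.commute power_mult)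
  have wd: "\<beta> k ^ m = \<beta> k' ^ m'" if "(of_nat m / of_nat p ^ k :: rat) = of_nat m' / of_nat p ^ k'" for m k m' k'
  proof -
    have "(of_nat (m * p ^ k') :: rat) = of_nat (m' * p ^ k)"
      using that p by (simp add: field_simps)
    then have "m * p ^ k' = m' * p ^ k"
      by (simp only: of_nat_eq_iff)
    then show ?thesis
      using root''[of k m k'] root''[of k' m' k] by (simp add: add.commute)
  qed
  define V where "V q = (let (m, k) = SOME (m, k). q = of_nat m / of_nat p ^ k in \<beta> k ^ m)" for q :: rat
  have V: "V (of_nat m / of_nat p ^ k) = \<beta> k ^ m" for m k
  proof -
    define z where "z = (SOME (m', k'). (of_nat m / of_nat p ^ k :: rat) = of_nat m' / of_nat p ^ k')"
    have "case z of (m', k') \<Rightarrow> (of_nat m / of_nat p ^ k :: rat) = of_nat m' / of_nat p ^ k'"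
      unfolding z_def by (rule someI[of _ "(m, k)"]) simp
    then have "\<beta> (snd z) ^ fst z = \<beta> k ^ m"
      using wd[of m k "fst z" "snd z"] by (simp add: case_prod_unfold)
    then show ?thesis
      by (simp only: V_def Let_def z_def case_prod_unfold)
  qed
  have "V (q + r) = V q * V r" if qr: "q \<in> p_nonneg p" "r \<in> p_nonneg p" for q r
  proof -
    obtain m k m' k' where eq: "q = of_nat m / of_nat p ^ k" "r = of_nat m' / of_nat p ^ k'"
      using qr unfolding p_nonneg_def by blast
    then have "q + r = of_nat (m * p ^ k' + m' * p ^ k) / of_nat p ^ (k + k')"
      using p by (simp add: add_frac_eq power_add)
    then have "V (q + r) = \<beta> (k + k') ^ (m * p ^ k' + m' * p ^ k)"
      by (simp only: V)
    also have "\<dots> = \<beta> k ^ m * \<beta> k' ^ m'"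
      using root''[of k m k'] root''[of k' m' k] by (simp add: power_add add.commute)
    finally show ?thesis
      by (simp add: eq V)
  qed
  then show ?thesis
    using that V by blast
qed

text \<open>Since \<beta> 0 is invertible, the map of \<open>power_system\<close> extends to the
  group Z[1/p]. The norms are forced, because |\<beta> k| is the positive p^k-th root of |\<beta>
  0|.\<close>

lemma powr_system:
  fixes \<beta> :: "nat \<Rightarrow> 'a::complete_nonarch_field"
  assumes root: "\<And>m. \<beta> (Suc m) ^ p = \<beta> m" and nz: "\<beta> 0 \<noteq> 0"
  obtains pw :: "rat \<Rightarrow> 'a::complete_nonarch_field"
    where "\<And>q r. q \<in> p_rationals p \<Longrightarrow> r \<in> p_rationals p \<Longrightarrow> pw (q + r) = pw q * pw r"
    "\<And>q. q \<in> p_rationals p \<Longrightarrow> vnorm (pw q) = vnorm (\<beta> 0) powr real_of_rat q"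
proof -
  have p: "p > 0"
    using prime by (rule prime_gt_0_nat)
  obtain V where V: "\<And>m k. V (of_nat m / of_nat p ^ k) = \<beta> k ^ m"
    "\<And>q r. q \<in> p_nonneg p \<Longrightarrow> r \<in> p_nonneg p \<Longrightarrow> V (q + r) = V q * V r"
    using power_system[of \<beta>, OF root] by metis
  have pow: "vnorm (\<beta> k) ^ p ^ k = vnorm (\<beta> 0)" for k
  proof (induction k)
    case (Suc k)
    have "vnorm (\<beta> (Suc k)) ^ p ^ Suc k = (vnorm (\<beta> (Suc k) ^ p)) ^ p ^ k"
      by (simp add: vnorm_power power_mult[symmetric])
    then show ?case
      using Suc by (simp add: root)
  qed simp
  have nz_k: "vnorm (\<beta> k) > 0" for k
    using pow[of k] nz p by (metis vnorm_pos vnorm_zero zero_power zero_less_power vnorm_eq_0)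
  have norm_k: "vnorm (\<beta> k) = vnorm (\<beta> 0) powr (1 / real p ^ k)" for k
  proof -
    have "vnorm (\<beta> 0) powr (1 / real p ^ k) = (vnorm (\<beta> k) powr real (p ^ k)) powr (1 / real p ^ k)"
      using nz_k[of k] pow[of k] by (simp add: powr_realpow del: of_nat_power)
    also have "\<dots> = vnorm (\<beta> k)"
      using p nz_k[of k] by (simp add: powr_powr)
    finally show ?thesis ..
  qed
  have norm_V: "vnorm (V q) = vnorm (\<beta> 0) powr real_of_rat q" if "q \<in> p_nonneg p" for q
  proof -
    obtain m k where q: "q = of_nat m / of_nat p ^ k"
      using \<open>q \<in> p_nonneg p\<close> unfolding p_nonneg_def by blast
    have "vnorm (V q) = (vnorm (\<beta> 0) powr (1 / real p ^ k)) powr real m"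
      using nz_k[of k] by (simp add: q V vnorm_power norm_k[symmetric] powr_realpow)
    then show ?thesis
      by (simp add: q powr_powr of_rat_divide of_rat_power)
  qed
  have V_nz: "V q \<noteq> 0" if "q \<in> p_nonneg p" for q
    using norm_V[OF that] nz by (metis powr_eq_0_iff vnorm_eq_0)
  define pw where "pw q = (if q \<ge> 0 then V q else inverse (V (- q)))" for q
  \<comment> \<open>Writing every exponent as a difference of nonnegative ones confines the case
    distinction on signs to this place.\<close>
  have eq: "pw (q - r) = V q / V r" if qr: "q \<in> p_nonneg p" "r \<in> p_nonneg p" for q r
  proof (cases "q \<ge> r")
    case True
    then have "q - r \<in> p_nonneg p"
      using qr by (simp add: p_nonneg_iff p_rationals_diff)
    then have "V q = V (q - r) * V r"
      using V(2)[of "q - r" r] qr by simp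
    then show ?thesis
      using True V_nz[OF qr(2)] by (simp add: pw_def)
  next
    case False
    then have "r - q \<in> p_nonneg p"
      using qr by (simp add: p_nonneg_iff p_rationals_diff)
    then have "V r = V (r - q) * V q"
      using V(2)[of "r - q" q] qr by simp
    then show ?thesis
      using False V_nz[OF qr(1)] by (simp add: pw_def field_simps)
  qed
  have split: "\<exists>a\<in>p_nonneg p. \<exists>b\<in>p_nonneg p. q = a - b" if "q \<in> p_rationals p" for q
    using that p_rationals_of_int[of 0] p_rationals_uminus[OF that]
    by (cases "q \<ge> 0") (force simp: p_nonneg_iff intro: bexI[of _ q] bexI[of _ 0] bexI[of _ "- q"])+
  have add: "a + b \<in> p_nonneg p" if "a \<in> p_nonneg p" "b \<in> p_nonneg p" for a b
    using that by (simp add: p_nonneg_iff p_rationals_add)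
  show ?thesis
  proof (rule that[of pw])
    fix q r assume "q \<in> p_rationals p" "r \<in> p_rationals p"
    then obtain a b c d where *: "a \<in> p_nonneg p" "b \<in> p_nonneg p" "c \<in> p_nonneg p" "d \<in> p_nonneg p"
      "q = a - b" "r = c - d"
      using split by meson
    have "q + r = (a + c) - (b + d)"
      using * by simp
    then have "pw (q + r) = pw ((a + c) - (b + d))"
      by (rule arg_cong)
    also have "\<dots> = pw q * pw r"
      using * by (simp add: eq add V(2))
    finally show "pw (q + r) = pw q * pw r" .
  next
    fix q assume "q \<in> p_rationals p"
    then obtain a b where *: "a \<in> p_nonneg p" "b \<in> p_nonneg p" "q = a - b"
      using split by meson
    then show "vnorm (pw q) = vnorm (\<beta> 0) powr real_of_rat q"
      by (simp add: eq divide_inverse vnorm_mult vnorm_inverse norm_V powr_diff of_rat_diff)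
  qed
qed

end

text \<open>Near a non-isolated value |a| lies another value |b|. The smaller of the two divided by
  the larger is a value below 1, and close to 1 when |b| is close to |a|.\<close>

lemma exists_norm_between:
  assumes "0 \<le> s" "s < 1"
  obtains c :: "'c::perfectoid_field" where "s < vnorm c" "vnorm c < 1"
proof -
  let ?G = "value_group TYPE('c)"
  obtain x where x: "x \<in> ?G" "\<not> x isolated_in ?G"
    using value_group_nondiscrete[where 'a = 'c] unfolding discrete_def by blast
  obtain a :: 'c where a: "a \<noteq> 0" "x = vnorm a"
    using x(1) unfolding value_group_def by blast
  define \<delta> where "\<delta> = vnorm a * (1 - s) / 2"
  have \<delta>: "\<delta> > 0"
    using a assms by (simp add: \<delta>_def)
  have "\<not> (ball x \<delta> \<inter> ?G = {x})"
    using x unfolding isolated_in_def by blast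
  moreover have "x \<in> ball x \<delta> \<inter> ?G"
    using x \<delta> by simp
  ultimately have "\<exists>y. y \<in> ball x \<delta> \<inter> ?G \<and> y \<noteq> x"
    by blast
  then obtain y where y: "y \<in> ?G" "y \<noteq> x" "dist x y < \<delta>"
    by auto
  obtain b :: 'c where b: "b \<noteq> 0" "y = vnorm b"
    using y(1) unfolding value_group_def by blast
  have ab: "vnorm a > 0" "vnorm b > 0"
    using a b by auto
  have d: "\<bar>vnorm a - vnorm b\<bar> < vnorm a * (1 - s) / 2"
    using y(3) a b by (simp add: dist_real_def \<delta>_def)
  show ?thesis
  proof (cases "vnorm b < vnorm a")
    case True
    have "s * vnorm a < vnorm b"
      using d True assms ab mult_strict_left_mono[OF assms(2) ab(1)] by (simp add: algebra_simps abs_if split: if_splits)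
    then show ?thesis
      using that[of "b / a"] True ab by (simp add: vnorm_divide pos_less_divide_eq)
  next
    case False
    then have less: "vnorm a < vnorm b"
      using y(2) a b by simp
    have "vnorm b < vnorm a + vnorm a * (1 - s) / 2"
      using d less by linarith
    then have "s * vnorm b \<le> s * (vnorm a + vnorm a * (1 - s) / 2)"
      using assms(1) by (intro mult_left_mono) auto
    also have "\<dots> < vnorm a"
    proof -
      have "s * (1 - s) \<le> 1 - s"
        using assms by (simp add: mult_left_le_one_le)
      then have "s + s * (1 - s) / 2 < 1"
        using assms by argo
      then have "vnorm a * (s + s * (1 - s) / 2) < vnorm a * 1"
        using ab by (intro mult_strict_left_mono)
      then show ?thesis
        by (simp add: algebra_simps)
    qed
    finally show ?thesis
      using that[of "a / b"] less ab by (simp add: vnorm_divide pos_less_divide_eq)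
  qed
qed

text \<open>Start from c with |p| < |c| < 1. Surjectivity of Frobenius modulo p supplies approximate
  p-power roots. Making them exact moves c by at most |p|, and as |p| < |c| is strict, the norm
  survives.\<close>

lemma exists_pseudo_uniformizer_roots:
  fixes p :: nat
  defines "p \<equiv> residue_char TYPE('c::perfectoid_field)"
  obtains \<beta> :: "nat \<Rightarrow> 'c::perfectoid_field" where "\<And>m. \<beta> (Suc m) ^ p = \<beta> m" "\<beta> 0 \<noteq> 0"
    "vnorm (of_nat p :: 'c::perfectoid_field) \<le> vnorm (\<beta> 0)" "vnorm (\<beta> 0) < 1"
proof -
  have prime: "Factorial_Ring.prime p"
    unfolding p_def by (rule prime_residue_char)
  define P where "P = vnorm (of_nat p :: 'c)"
  have P: "0 \<le> P" "P < 1"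
    using vnorm_residue_char_less_1[where 'c = 'c] by (simp_all add: P_def p_def)
  obtain c :: 'c where c: "P < vnorm c" "vnorm c < 1"
    using exists_norm_between[OF P] .
  have root: "\<exists>y. vnorm y \<le> 1 \<and> vnorm (y ^ p - x) \<le> P" if x: "vnorm x \<le> 1" for x :: 'c
  proof -
    obtain y z where yz: "vnorm y \<le> 1" "vnorm z \<le> 1" "x = y ^ p + of_nat p * z"
      using frobenius_surj[OF x] unfolding p_def by blast
    have "y ^ p - x = - (of_nat p * z)"
      using yz(3) by (simp add: algebra_simps)
    then have "vnorm (y ^ p - x) \<le> P"
      using yz(2) by (simp add: vnorm_mult P_def mult_left_le)
    then show ?thesis
      using yz(1) by blast
  qed
  have "\<exists>b :: nat \<Rightarrow> 'c. \<forall>m. (vnorm (b m) \<le> 1 \<and> (m = 0 \<longrightarrow> b m = c)) \<and> vnorm (b (Suc m) ^ p - b m) \<le> P"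
    by (rule dependent_nat_choice) (use c root in auto)
  then obtain b :: "nat \<Rightarrow> 'c" where b: "\<And>m. vnorm (b m) \<le> 1" "b 0 = c"
    "\<And>m. vnorm (b (Suc m) ^ p - b m) \<le> P"
    by blast
  obtain \<beta> where \<beta>: "\<And>m. \<beta> (Suc m) ^ p = \<beta> m" "\<And>m. vnorm (\<beta> m - b m) \<le> P"
    using lift_power_roots[OF prime, of b] b P unfolding P_def by metis
  have "vnorm (\<beta> 0) = vnorm c"
    using \<beta>(2)[of 0] b(2) c by (intro vnorm_eq_of_diff_less) auto
  moreover from this have "\<beta> 0 \<noteq> 0"
    using c P by (metis less_le_trans not_less vnorm_zero)
  ultimately show ?thesis
    using c P(1) by (intro that[of \<beta>] \<beta>(1)) (simp_all add: P_def)
qed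

section \<open>A sequence of points\<close>

lemma real_of_rat_abs: "real_of_rat \<bar>x\<bar> = \<bar>real_of_rat x\<bar>"
  by (simp add: abs_if of_rat_minus)

text \<open>
  Stage \<open>l\<close> concerns the monomial \<open>\<varpi>^(Q l) x^(N l)\<close> of the second coordinate: \<open>\<varpi>^(L l) x^(S l)\<close> clears the
  denominators of the earlier monomials, and \<open>p^(M l)\<close>-th roots are taken. With \<open>|\<varpi>| = \<rho>\<close> and \<open>\<gamma> = \<rho>^\<theta>\<close>,
  the number \<open>Q l + \<theta> * N l\<close> is the limit of the valuations of the monomial at the points.
\<close>

lemma exists_parameters:
  fixes \<theta> :: real and p :: nat
  assumes "\<theta> > 0" "p > 1"
  obtains N Q :: "nat \<Rightarrow> int" and M S L :: "nat \<Rightarrow> nat" where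
    "\<And>l. 2 \<le> Q l + \<theta> * N l"
    "\<And>j l. j < l \<Longrightarrow> 0 \<le> int (S l) + N j" "\<And>j l. j < l \<Longrightarrow> 0 \<le> int (L l) + Q j"
    "\<And>l. real l * (L l + \<theta> * S l + (Q l + \<theta> * N l)) \<le> \<bar>real (S l) + N l\<bar>"
    "\<And>l. if even l then int (S l) + N l > 0 else int (S l) + N l < 0"
    "\<And>l. \<bar>real (S l) + N l\<bar> \<le> real p ^ M l"
    "\<And>l. 2 * (Q l + \<theta> * N l + 1) \<le> real p ^ M l"
    "\<And>j l. j < l \<Longrightarrow> Q j + \<theta> * N j + 2 + real p ^ M j / 2 \<le> Q l + \<theta> * N l"
proof -
  define good where "good f l x \<longleftrightarrow> (case x of (N, Q, M, S, L) \<Rightarrow>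
      2 \<le> Q + \<theta> * N \<and>
      (\<forall>j<l. 0 \<le> int S + fst (f j) \<and> 0 \<le> int L + fst (snd (f j)) \<and>
         fst (snd (f j)) + \<theta> * fst (f j) + 2 + real p ^ fst (snd (snd (f j))) / 2 \<le> Q + \<theta> * N) \<and>
      real l * (L + \<theta> * S + (Q + \<theta> * N)) \<le> \<bar>real S + N\<bar> \<and>
      (if even l then int S + N > 0 else int S + N < 0) \<and>
      \<bar>real S + N\<bar> \<le> real p ^ M \<and> 2 * (Q + \<theta> * N + 1) \<le> real p ^ M)"
    for f :: "nat \<Rightarrow> int \<times> int \<times> nat \<times> nat \<times> nat" and l and x :: "int \<times> int \<times> nat \<times> nat \<times> nat"
  have step: "\<exists>x. good f l x" for f l
  proof -
    \<comment> \<open>Sums of absolute values dominate all the earlier exponents at once;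
      \<open>E\<close> below likewise dominates the lower bounds \<open>T j\<close> required by the
      valuation gap.\<close>
    define S where "S = nat (\<Sum>j<l. \<bar>fst (f j)\<bar>)"
    define L where "L = nat (\<Sum>j<l. \<bar>fst (snd (f j))\<bar>)"
    define T where "T j = fst (snd (f j)) + \<theta> * fst (f j) + 2 + real p ^ fst (snd (snd (f j))) / 2" for j
    define E where "E = 2 + (\<Sum>j<l. \<bar>T j\<bar>)"
    have E2: "E \<ge> 2"
      by (simp add: E_def sum_nonneg)
    have E: "T j \<le> E" if "j < l" for j
      using member_le_sum[of j "{..<l}" "\<lambda>j. \<bar>T j\<bar>"] that by (simp add: E_def)
    have S: "0 \<le> int S + fst (f j)" if "j < l" for j
      using member_le_sum[of j "{..<l}" "\<lambda>j. \<bar>fst (f j)\<bar>"] that by (simp add: S_def sum_nonneg)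
    have L: "0 \<le> int L + fst (snd (f j))" if "j < l" for j
      using member_le_sum[of j "{..<l}" "\<lambda>j. \<bar>fst (snd (f j))\<bar>"] that by (simp add: L_def sum_nonneg)
    \<comment> \<open>The order of choices matters. \<open>K\<close> is the intended value of |S +
      N|, fixed once \<open>E\<close> is known. The integer \<open>Q\<close> is chosen after
      \<open>N\<close> and puts Q + \<theta> N into the interval from E to E + 1 whatever
      \<open>N\<close> is, so the slope condition only has to be met for E + 1. \<open>M\<close>
      comes last.\<close>
    define K where "K = nat \<lceil>real l * (L + \<theta> * S + (E + 1))\<rceil> + 1"
    have K: "real l * (L + \<theta> * S + (E + 1)) \<le> K"
      unfolding K_def by linarith
    have K0: "K > 0"
      by (simp add: K_def)
    define N where "N = (if even l then int K else - int K) - int S"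
    define Q where "Q = \<lceil>E - \<theta> * N\<rceil>"
    have Q: "E \<le> Q + \<theta> * N" "Q + \<theta> * N \<le> E + 1"
      unfolding Q_def by linarith+
    have SN: "\<bar>real S + N\<bar> = K"
      by (auto simp: N_def)
    have sign: "if even l then int S + N > 0 else int S + N < 0"
      using K0 by (auto simp: N_def)
    have "real p > 1"
      using assms(2) by simp
    then obtain M where M: "max (real K) (2 * (Q + \<theta> * N + 1)) < real p ^ M"
      using real_arch_pow by blast
    have "real l * (L + \<theta> * S + (Q + \<theta> * N)) \<le> real l * (L + \<theta> * S + (E + 1))"
      using Q(2) by (intro mult_left_mono) auto
    then have big: "real l * (L + \<theta> * S + (Q + \<theta> * N)) \<le> K"
      using K by linarith
    have "good f l (N, Q, M, S, L)"
      unfolding good_def prod.case SN using S L E[unfolded T_def] Q E2 M big sign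
      by (auto intro: order_trans)
    then show ?thesis
      by blast
  qed
  have cong: "good f l x = good g l x" if "\<And>j. j < l \<Longrightarrow> f j = g j" for f g l x
    using that by (auto simp: good_def)
  have "\<exists>f. \<forall>l. good f l (f l)"
  proof (rule dependent_wf_choice[OF wf_less])
    show "good f l x = good g l x" if "\<And>j. (j, l) \<in> {(x, y). x < y} \<Longrightarrow> f j = g j" for f g l x
      using that by (intro cong) auto
  qed (use step in blast)
  then obtain f where f: "\<And>l. good f l (f l)"
    by blast
  define N where "N l = fst (f l)" for l
  define Q where "Q l = fst (snd (f l))" for l
  define M where "M l = fst (snd (snd (f l)))" for l
  define S where "S l = fst (snd (snd (snd (f l))))" for l
  define L where "L l = snd (snd (snd (snd (f l))))" for l
  have "good f l (N l, Q l, M l, S l, L l)" for l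
    using f[of l] by (simp add: N_def Q_def M_def S_def L_def)
  then show ?thesis
    using that[of Q N S L M] unfolding good_def prod.case
    by (simp add: N_def[symmetric] Q_def[symmetric] M_def[symmetric])
qed

lemma multiplicative_power:
  fixes pw :: "rat \<Rightarrow> 'a::field"
  assumes p: "Factorial_Ring.prime p"
    and add: "\<And>a b. a \<in> p_rationals p \<Longrightarrow> b \<in> p_rationals p \<Longrightarrow> pw (a + b) = pw a * pw b"
    and nz: "pw 0 \<noteq> 0" and a: "a \<in> p_rationals p"
  shows "pw (a * of_nat j) = pw a ^ j"
proof (induction j)
  case 0
  have "(0 :: rat) \<in> p_rationals p"
    using p_rationals_of_int[of 0] by simp
  then have "pw 0 * pw 0 = pw 0 * 1"
    using add[of 0 0] by simp
  then have "pw 0 = 1"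
    using nz by (metis mult_left_cancel)
  then show ?case
    by simp
next
  case (Suc j)
  have "(of_nat j :: rat) \<in> p_rationals p"
    using p_rationals_of_int[of "int j"] by simp
  then have "pw (a + a * of_nat j) = pw a * pw (a * of_nat j)"
    using a by (intro add p_rationals_mult)
  then show ?case
    using Suc by (simp add: algebra_simps)
qed

text \<open>Here \<open>pw a\<close> is \<varpi>^a, the first coordinate of the k-th point is
  \<open>pw (r k)\<close>, and \<open>V k (1 / of_nat p ^ m)\<close> is the p^m-th root of the
  second. \<open>V_near\<close> ties this root to the sum of the roots of the first k monomials,
  with an error independent of m. \<open>r_near\<close> keeps the valuation of each of them within 1
  of its limit.\<close>

locale tate_points =
  fixes n p :: nat and pw :: "rat \<Rightarrow> 'c::perfectoid_field" and \<rho> \<theta> :: real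
    and N Q :: "nat \<Rightarrow> int" and M S L :: "nat \<Rightarrow> nat"
    and r :: "nat \<Rightarrow> rat" and V :: "nat \<Rightarrow> rat \<Rightarrow> 'c"
  assumes n: "n \<ge> 2" and p: "p = residue_char TYPE('c)"
    and \<rho>: "0 < \<rho>" "\<rho> < 1" "vnorm (of_nat p :: 'c) \<le> \<rho>"
    and pw_add: "\<And>a b. a \<in> p_rationals p \<Longrightarrow> b \<in> p_rationals p \<Longrightarrow> pw (a + b) = pw a * pw b"
    and vnorm_pw: "\<And>a. a \<in> p_rationals p \<Longrightarrow> vnorm (pw a) = \<rho> powr real_of_rat a"
    and \<theta>: "\<theta> > 0"
    and valuation_ge: "\<And>l. 2 \<le> Q l + \<theta> * N l"
    and S: "\<And>j l. j < l \<Longrightarrow> 0 \<le> int (S l) + N j"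
    and L: "\<And>j l. j < l \<Longrightarrow> 0 \<le> int (L l) + Q j"
    and slope: "\<And>l. real l * (L l + \<theta> * S l + (Q l + \<theta> * N l)) \<le> \<bar>real (S l) + N l\<bar>"
    and sign: "\<And>l. if even l then int (S l) + N l > 0 else int (S l) + N l < 0"
    and M: "\<And>l. \<bar>real (S l) + N l\<bar> \<le> real p ^ M l" "\<And>l. 2 * (Q l + \<theta> * N l + 1) \<le> real p ^ M l"
    and valuation_gap: "\<And>j l. j < l \<Longrightarrow> Q j + \<theta> * N j + 2 + real p ^ M j / 2 \<le> Q l + \<theta> * N l"
    and r: "\<And>k. r k \<in> p_rationals p" "\<And>k. \<theta> < real_of_rat (r k)" "(\<lambda>k. real_of_rat (r k)) \<longlonglongrightarrow> \<theta>"
    and r_near: "\<And>j k. j < k \<Longrightarrow> \<bar>N j * real_of_rat (r k) - N j * \<theta>\<bar> \<le> 1"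
    and V_add: "\<And>k a b. a \<in> p_nonneg p \<Longrightarrow> b \<in> p_nonneg p \<Longrightarrow> V k (a + b) = V k a * V k b"
    and V_le: "\<And>k a. a \<in> p_nonneg p \<Longrightarrow> vnorm (V k a) \<le> 1"
    and V_near: "\<And>k m. vnorm (V k (1 / of_nat p ^ m)
      - (\<Sum>j<k. pw ((of_int (Q j) + of_int (N j) * r k) / of_nat p ^ m))) \<le> vnorm (of_nat p :: 'c)"
    and V_0: "\<And>k. V k 0 = 1"
begin

lemma prime: "Factorial_Ring.prime p"
  unfolding p by (rule prime_residue_char)

lemma p_gt_0: "p > 0"
  using prime by (rule prime_gt_0_nat)

lemmas p_rationals_intros =
  p_rationals_add[OF prime] p_rationals_mult p_rationals_of_int p_rationals_inverse_power
  p_rationals_uminus p_rationals_diff[OF prime] r(1)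

lemma p_rationals_of_nat: "of_nat m \<in> p_rationals p"
  using p_rationals_of_int[of "int m"] by simp

lemma p_rationals_divide_power: "a \<in> p_rationals p \<Longrightarrow> a / of_nat p ^ m \<in> p_rationals p"
  using p_rationals_mult[OF _ p_rationals_inverse_power, of a p m] by simp

lemma pw_power: "a \<in> p_rationals p \<Longrightarrow> pw a ^ j = pw (a * of_nat j)"
proof (rule multiplicative_power[OF prime pw_add, symmetric])
  show "pw 0 \<noteq> 0"
    using vnorm_pw[of 0] p_rationals_of_nat[of 0] \<rho>(1) by auto
qed

lemma pw_0: "pw 0 = 1"
  using pw_power[of 0 0] p_rationals_of_nat[of 0] by simp

text \<open>The variables with index 2 and above, if any, are evaluated at 1.\<close>

definition point :: "nat \<Rightarrow> (nat \<Rightarrow>\<^sub>0 rat) \<Rightarrow> 'c" where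
  "point k e = pw (r k * Poly_Mapping.lookup e 0) * V k (Poly_Mapping.lookup e 1)"

abbreviation R :: "('c, (nat \<Rightarrow>\<^sub>0 rat) \<Rightarrow> 'c) module" where
  "R \<equiv> perfectoid_tate_algebra n"

lemma lookup_p_nonneg: "e \<in> p_exponents p n \<Longrightarrow> Poly_Mapping.lookup e i \<in> p_nonneg p"
  unfolding p_exponents_def p_nonneg_def by blast

lemma point_add:
  assumes "a \<in> p_exponents p n" "b \<in> p_exponents p n"
  shows "point k (a + b) = point k a * point k b"
proof -
  note * = lookup_p_nonneg[OF assms(1)] lookup_p_nonneg[OF assms(2)]
  have "Poly_Mapping.lookup a 0 \<in> p_rationals p" "Poly_Mapping.lookup b 0 \<in> p_rationals p"
    using * p_nonneg_iff[OF prime] by blast+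
  then show ?thesis
    using * by (simp add: point_def lookup_add distrib_left pw_add V_add p_rationals_mult r(1))
qed

lemma vnorm_pw_le_1: "a \<in> p_rationals p \<Longrightarrow> 0 \<le> a \<Longrightarrow> vnorm (pw a) \<le> 1"
  using \<rho> by (simp add: vnorm_pw powr_le1)

lemma r_pos: "r k > 0"
proof -
  have "real_of_rat (r k) > 0"
    using r(2)[of k] \<theta> by linarith
  then show ?thesis
    by simp
qed

lemma vnorm_point_le:
  assumes "e \<in> p_exponents p n"
  shows "vnorm (point k e) \<le> 1"
proof -
  note * = lookup_p_nonneg[OF assms]
  have "Poly_Mapping.lookup e 0 \<in> p_rationals p" "Poly_Mapping.lookup e 0 \<ge> 0"
    using * p_nonneg_iff[OF prime] by blast+
  then have "vnorm (pw (r k * Poly_Mapping.lookup e 0)) \<le> 1"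
    using r(1) r_pos[of k] by (intro vnorm_pw_le_1 p_rationals_mult) auto
  then show ?thesis
    unfolding point_def using vnorm_mult_le[OF _ V_le[OF *, of k 1]] by fastforce
qed

abbreviation ev :: "nat \<Rightarrow> ((nat \<Rightarrow>\<^sub>0 rat) \<Rightarrow> 'c) \<Rightarrow> 'c" where
  "ev k \<equiv> evaluate (point k)"

lemma ev_mult:
  assumes "f \<in> carrier R" "g \<in> carrier R"
  shows "ev k (f \<otimes>\<^bsub>R\<^esub> g) = ev k f * ev k g"
  unfolding tate_mult[OF assms] using assms point_add vnorm_point_le
  by (intro evaluate_convolution[of f g "p_exponents p n"]) (auto simp: tate_carrier p)

lemma ev_add:
  assumes "f \<in> carrier R" "g \<in> carrier R"
  shows "ev k (\<lambda>e. f e + g e) = ev k f + ev k g"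
  using assms vnorm_point_le
  by (intro evaluate_add[of f g "p_exponents p n"]) (auto simp: tate_carrier p)

lemma ev_minus: "ev k (\<lambda>e. - f e) = - ev k f"
  unfolding evaluate_def by (simp add: infsum_uminus)

lemma ev_diff:
  assumes "f \<in> carrier R" "g \<in> carrier R"
  shows "ev k (\<lambda>e. f e - g e) = ev k f - ev k g"
  using ev_add[OF assms(1) tate_minus_closed[OF assms(2)]] by (simp add: ev_minus)

lemma point_0: "point k 0 = 1"
  by (simp add: point_def pw_0 V_0)

lemma vnorm_ev_le:
  assumes "f \<in> carrier R" "\<And>e. vnorm (f e) \<le> s"
  shows "vnorm (ev k f) \<le> s"
  using assms vnorm_point_le
  by (intro vnorm_evaluate_le[of "p_exponents p n"]) (auto simp: tate_carrier p)

text \<open>This forgets the series and retains its values together with a bound on its Gauss norm,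
  so that series can be built by pointwise operations on sequences.\<close>

definition value_seq :: "real \<Rightarrow> (nat \<Rightarrow> 'c) \<Rightarrow> bool" where
  "value_seq s a \<longleftrightarrow> (\<exists>f\<in>carrier R. (\<forall>e. vnorm (f e) \<le> s) \<and> (\<forall>k. a k = ev k f))"

lemma value_seq_monomial:
  assumes "e \<in> p_exponents p n"
  shows "value_seq (vnorm c) (\<lambda>k. c * point k e)"
  unfolding value_seq_def
  by (rule bexI[of _ "monomial e c"])
    (use assms in \<open>auto simp: evaluate_monomial tate_monomial_closed p[symmetric]\<close>, simp add: monomial_def)

lemma value_seq_const: "value_seq (vnorm c) (\<lambda>k. c)"
  using value_seq_monomial[of 0 c] by (simp add: point_0)

lemma single_p_exponents:
  assumes "q \<in> p_nonneg p" "i < n"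
  shows "Poly_Mapping.single i q \<in> p_exponents p n"
proof -
  have "\<exists>m k. Poly_Mapping.lookup (Poly_Mapping.single i q) j = of_nat m / of_nat p ^ k" for j
  proof (cases "j = i")
    case True
    then show ?thesis
      using assms(1) by (auto simp: p_nonneg_def)
  next
    case False
    then show ?thesis
      by (intro exI[of _ 0]) (auto simp: lookup_single when_def)
  qed
  then show ?thesis
    using assms(2) by (auto simp: p_exponents_def)
qed

lemma value_seq_x:
  assumes "q \<in> p_nonneg p"
  shows "value_seq 1 (\<lambda>k. pw (r k * q))"
  using value_seq_monomial[OF single_p_exponents[OF assms, of 0], of 1] n
  by (simp add: point_def lookup_single when_def V_0)

lemma value_seq_y:
  assumes "q \<in> p_nonneg p"
  shows "value_seq 1 (\<lambda>k. V k q)"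
  using value_seq_monomial[OF single_p_exponents[OF assms, of 1], of 1] n
  by (simp add: point_def lookup_single when_def pw_0)

lemma value_seq_add:
  assumes "value_seq s a" "value_seq s b"
  shows "value_seq s (\<lambda>k. a k + b k)"
proof -
  obtain f g where "f \<in> carrier R" "g \<in> carrier R" "\<And>e. vnorm (f e) \<le> s" "\<And>e. vnorm (g e) \<le> s"
    "\<And>k. a k = ev k f" "\<And>k. b k = ev k g"
    using assms unfolding value_seq_def by blast
  then show ?thesis
    unfolding value_seq_def
    by (intro bexI[of _ "\<lambda>e. f e + g e"]) (auto simp: ev_add tate_add_closed vnorm_add_le)
qed

lemma value_seq_mult:
  assumes "value_seq s a" "value_seq t b"
  shows "value_seq (s * t) (\<lambda>k. a k * b k)"
proof -
  obtain f g where "f \<in> carrier R" "g \<in> carrier R" "\<And>e. vnorm (f e) \<le> s" "\<And>e. vnorm (g e) \<le> t"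
    "\<And>k. a k = ev k f" "\<And>k. b k = ev k g"
    using assms unfolding value_seq_def by blast
  moreover from this have "\<And>k. a k * b k = ev k (convolution f g)"
    using ev_mult[of f g] by (simp add: tate_mult)
  ultimately show ?thesis
    unfolding value_seq_def
    by (intro bexI[of _ "convolution f g"]) (auto simp: convolution_mem_tate_carrier vnorm_convolution_le)
qed

lemma value_seq_mono: "value_seq s a \<Longrightarrow> s \<le> t \<Longrightarrow> value_seq t a"
  unfolding value_seq_def by (meson order_trans)

lemma value_seq_cmult: "value_seq s a \<Longrightarrow> value_seq (vnorm c * s) (\<lambda>k. c * a k)"
  using value_seq_mult[OF value_seq_const] .

lemma value_seq_diff:
  assumes "value_seq s a" "value_seq s b"
  shows "value_seq s (\<lambda>k. a k - b k)"
  using value_seq_add[OF assms(1) value_seq_cmult[OF assms(2), of "-1", simplified]] by simp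

lemma value_seq_sum:
  assumes "\<And>i. i \<in> A \<Longrightarrow> value_seq s (a i)" "0 \<le> s"
  shows "value_seq s (\<lambda>k. \<Sum>i\<in>A. a i k)"
proof -
  have 0: "value_seq s (\<lambda>k. 0)"
    using value_seq_mono[OF value_seq_const[of 0]] assms(2) by simp
  show ?thesis
    using assms(1) by (induction A rule: infinite_finite_induct) (auto intro: 0 value_seq_add)
qed

lemma value_seq_power:
  assumes "value_seq 1 a"
  shows "value_seq 1 (\<lambda>k. a k ^ j)"
proof (induction j)
  case (Suc j)
  then show ?case
    using value_seq_mult[OF assms Suc] by simp
qed (use value_seq_const[of 1] in simp)

text \<open>The valuation of the j-th monomial at the k-th point, normalised so that \<varpi> has
  valuation 1.\<close>

abbreviation expo :: "nat \<Rightarrow> nat \<Rightarrow> rat" where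
  "expo k j \<equiv> of_int (Q j) + of_int (N j) * r k"

lemma expo_p_rationals: "expo k j \<in> p_rationals p"
  by (intro p_rationals_intros)

lemma expo_bounds:
  assumes "j < k"
  shows "real_of_rat (expo k j) \<le> Q j + \<theta> * N j + 1" "Q j + \<theta> * N j - 1 \<le> real_of_rat (expo k j)"
  using r_near[OF assms] by (simp_all add: of_rat_add of_rat_mult abs_le_iff algebra_simps)

text \<open>The subtraction is performed on p^(M l)-th roots; the monomial in front clears the
  denominators of the subtracted terms, so that \<open>W l\<close> comes from an honest
  series.\<close>

definition W :: "nat \<Rightarrow> nat \<Rightarrow> 'c" where
  "W l k = pw (of_nat (L l) / of_nat p ^ M l) * pw (r k * (of_nat (S l) / of_nat p ^ M l))
    * (V k (1 / of_nat p ^ M l) - (\<Sum>j<l. pw (expo k j / of_nat p ^ M l)))"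

text \<open>What \<open>W l k\<close> would be if the root of the second coordinate were exactly the
  sum of the roots of the monomials with index at most l.\<close>

definition W_main :: "nat \<Rightarrow> nat \<Rightarrow> 'c" where
  "W_main l k = pw ((of_nat (L l) + of_int (Q l)) / of_nat p ^ M l)
    * pw (r k * ((of_nat (S l) + of_int (N l)) / of_nat p ^ M l))"

lemma pw_shift:
  "pw (of_nat (L l) / of_nat p ^ m) * pw (r k * (of_nat (S l) / of_nat p ^ m)) * pw (expo k j / of_nat p ^ m)
    = pw ((of_nat (L l) + of_int (Q j)) / of_nat p ^ m) * pw (r k * ((of_nat (S l) + of_int (N j)) / of_nat p ^ m))"
proof -
  note mem = p_rationals_add[OF prime] p_rationals_mult p_rationals_of_nat p_rationals_of_int
    p_rationals_divide_power r(1)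
  have eq: "of_nat (L l) / of_nat p ^ m + r k * (of_nat (S l) / of_nat p ^ m) + expo k j / of_nat p ^ m
      = (of_nat (L l) + of_int (Q j)) / of_nat p ^ m + r k * ((of_nat (S l) + of_int (N j)) / of_nat p ^ m)"
    by (simp add: add_divide_distrib algebra_simps)
  have "pw (of_nat (L l) / of_nat p ^ m) * pw (r k * (of_nat (S l) / of_nat p ^ m)) * pw (expo k j / of_nat p ^ m)
      = pw (of_nat (L l) / of_nat p ^ m + r k * (of_nat (S l) / of_nat p ^ m) + expo k j / of_nat p ^ m)"
    by (subst pw_add, (intro mem)+)+ (rule refl)
  also have "\<dots> = pw ((of_nat (L l) + of_int (Q j)) / of_nat p ^ m)
      * pw (r k * ((of_nat (S l) + of_int (N j)) / of_nat p ^ m))"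
    unfolding eq by (subst pw_add, (intro mem)+) (rule refl)
  finally show ?thesis .
qed

text \<open>After multiplication by the clearing factor every subtracted term is a scalar of norm at
  most 1 times a nonnegative power of the first variable, by the conditions \<open>S\<close> and
  \<open>L\<close>.\<close>

lemma value_seq_W: "value_seq 1 (W l)"
proof -
  have nonneg: "of_nat a / of_nat p ^ M l \<in> p_nonneg p" for a
    by (rule p_nonnegI)
  have summand: "value_seq 1 (\<lambda>k. pw ((of_nat (L l) + of_int (Q j)) / of_nat p ^ M l)
      * pw (r k * ((of_nat (S l) + of_int (N j)) / of_nat p ^ M l)))" if jl: "j < l" for j
  proof -
    obtain a b where ab: "int (L l) + Q j = int a" "int (S l) + N j = int b"
      using S[OF jl] L[OF jl] nonneg_int_cases by metis
    have "of_nat (L l) + of_int (Q j) = (of_nat a :: rat)" "of_nat (S l) + of_int (N j) = (of_nat b :: rat)"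
      using ab by (metis of_int_add of_int_of_nat_eq)+
    moreover have "vnorm (pw (of_nat a / of_nat p ^ M l)) \<le> 1"
      by (intro vnorm_pw_le_1 p_rationals_divide_power p_rationals_of_nat) simp
    moreover have "value_seq (vnorm (pw (of_nat a / of_nat p ^ M l)) * 1)
        (\<lambda>k. pw (of_nat a / of_nat p ^ M l) * pw (r k * (of_nat b / of_nat p ^ M l)))"
      by (intro value_seq_cmult value_seq_x nonneg)
    ultimately show ?thesis
      using value_seq_mono by simp
  qed
  have "value_seq 1 (\<lambda>k. V k (1 / of_nat p ^ M l))"
    using value_seq_y[OF nonneg[of 1]] by simp
  then have "value_seq (vnorm (pw (of_nat (L l) / of_nat p ^ M l)) * (1 * 1))
      (\<lambda>k. pw (of_nat (L l) / of_nat p ^ M l) * (pw (r k * (of_nat (S l) / of_nat p ^ M l)) * V k (1 / of_nat p ^ M l)))"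
    by (intro value_seq_cmult value_seq_mult value_seq_x nonneg)
  moreover have "vnorm (pw (of_nat (L l) / of_nat p ^ M l)) \<le> 1"
    by (intro vnorm_pw_le_1 p_rationals_divide_power p_rationals_of_nat) simp
  ultimately have "value_seq 1 (\<lambda>k. pw (of_nat (L l) / of_nat p ^ M l)
      * (pw (r k * (of_nat (S l) / of_nat p ^ M l)) * V k (1 / of_nat p ^ M l)))"
    using value_seq_mono by simp
  then have "value_seq 1 (\<lambda>k. pw (of_nat (L l) / of_nat p ^ M l)
      * (pw (r k * (of_nat (S l) / of_nat p ^ M l)) * V k (1 / of_nat p ^ M l))
      - (\<Sum>j<l. pw ((of_nat (L l) + of_int (Q j)) / of_nat p ^ M l)
      * pw (r k * ((of_nat (S l) + of_int (N j)) / of_nat p ^ M l))))"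
    by (intro value_seq_diff value_seq_sum summand) auto
  then show ?thesis
    unfolding W_def[abs_def] pw_shift[symmetric]
    by (simp add: right_diff_distrib sum_distrib_left mult.assoc)
qed

text \<open>Two errors compete with the l-th term, whose norm is \<rho>^(x l). The error of
  \<open>V_near\<close> is at most \<rho>, and \<open>M\<close> gives x l \<le> 1/2, so it is at
  most \<rho>^(1/2 + x l). The later terms are equally small by
  \<open>valuation_gap\<close>.\<close>

lemma W_approx:
  assumes "l < k"
  shows "vnorm (W l k - W_main l k) \<le> \<rho> powr (1 / 2) * vnorm (W_main l k)"
proof -
  define x where "x j = real_of_rat (expo k j) / real p ^ M l" for j
  have pM: "real p ^ M l > 0"
    using p_gt_0 by simp
  have norm: "vnorm (pw (expo k j / of_nat p ^ M l)) = \<rho> powr x j" for j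
    by (subst vnorm_pw) (auto intro!: p_rationals_divide_power expo_p_rationals simp: x_def of_rat_divide of_rat_power)
  have xl: "x l \<le> 1 / 2"
  proof -
    have "real_of_rat (expo k l) \<le> real p ^ M l / 2"
      using expo_bounds(1)[OF assms] M(2)[of l] by argo
    then show ?thesis
      using pM by (simp add: x_def divide_le_eq)
  qed
  \<comment> \<open>The summand 2 in \<open>valuation_gap\<close> absorbs the deviation, by at most
    1 each, of the two exponents from their limits.\<close>
  have xj: "x l + 1 / 2 \<le> x j" if "j \<in> {Suc l..<k}" for j
  proof -
    have "real_of_rat (expo k l) + real p ^ M l / 2 \<le> real_of_rat (expo k j)"
      using expo_bounds(1)[OF assms] expo_bounds(2)[of j k] valuation_gap[of l j] that by force
    then have "(real_of_rat (expo k l) + real p ^ M l / 2) / real p ^ M l \<le> x j"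
      unfolding x_def using pM by (intro divide_right_mono) auto
    moreover have "real p ^ M l / 2 / real p ^ M l = 1 / 2"
      using p_gt_0 by simp
    ultimately show ?thesis
      by (simp only: x_def add_divide_distrib)
  qed
  have split: "{..<k} = {..<l} \<union> {l} \<union> {Suc l..<k}"
    using assms by auto
  have "(\<Sum>j<k. pw (expo k j / of_nat p ^ M l)) = (\<Sum>j<l. pw (expo k j / of_nat p ^ M l))
      + pw (expo k l / of_nat p ^ M l) + (\<Sum>j\<in>{Suc l..<k}. pw (expo k j / of_nat p ^ M l))"
    unfolding split by (subst sum.union_disjoint; auto)+
  then have eq: "V k (1 / of_nat p ^ M l) - (\<Sum>j<l. pw (expo k j / of_nat p ^ M l)) - pw (expo k l / of_nat p ^ M l)
      = (V k (1 / of_nat p ^ M l) - (\<Sum>j<k. pw (expo k j / of_nat p ^ M l)))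
        + (\<Sum>j\<in>{Suc l..<k}. pw (expo k j / of_nat p ^ M l))"
    by simp
  have "vnorm (V k (1 / of_nat p ^ M l) - (\<Sum>j<k. pw (expo k j / of_nat p ^ M l))) \<le> \<rho> powr 1"
    using V_near[of k "M l"] \<rho> by simp
  also have "\<dots> \<le> \<rho> powr (1 / 2 + x l)"
    using xl \<rho> by (intro powr_mono') auto
  finally have 1: "vnorm (V k (1 / of_nat p ^ M l) - (\<Sum>j<k. pw (expo k j / of_nat p ^ M l))) \<le> \<rho> powr (1 / 2 + x l)" .
  have 2: "vnorm (\<Sum>j\<in>{Suc l..<k}. pw (expo k j / of_nat p ^ M l)) \<le> \<rho> powr (1 / 2 + x l)"
    using xj \<rho> by (intro vnorm_sum_le) (auto simp: norm add.commute intro!: powr_mono')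
  have "vnorm (V k (1 / of_nat p ^ M l) - (\<Sum>j<l. pw (expo k j / of_nat p ^ M l)) - pw (expo k l / of_nat p ^ M l))
      \<le> \<rho> powr (1 / 2 + x l)"
    unfolding eq by (intro vnorm_add_le 1 2)
  then have 3: "vnorm (V k (1 / of_nat p ^ M l) - (\<Sum>j<l. pw (expo k j / of_nat p ^ M l)) - pw (expo k l / of_nat p ^ M l))
      \<le> \<rho> powr (1 / 2) * vnorm (pw (expo k l / of_nat p ^ M l))"
    by (simp add: norm powr_add)
  define c where "c = pw (of_nat (L l) / of_nat p ^ M l) * pw (r k * (of_nat (S l) / of_nat p ^ M l))"
  have main: "W_main l k = c * pw (expo k l / of_nat p ^ M l)"
    unfolding W_main_def c_def pw_shift ..
  have "W l k - W_main l k
      = c * (V k (1 / of_nat p ^ M l) - (\<Sum>j<l. pw (expo k j / of_nat p ^ M l)) - pw (expo k l / of_nat p ^ M l))"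
    unfolding main by (simp add: W_def c_def right_diff_distrib)
  then have "vnorm (W l k - W_main l k) \<le> vnorm c * (\<rho> powr (1 / 2) * vnorm (pw (expo k l / of_nat p ^ M l)))"
    using 3 by (simp add: vnorm_mult mult_left_mono)
  then show ?thesis
    by (simp add: main vnorm_mult mult_ac)
qed

text \<open>In the ultrametric setting a relative error does not accumulate under powers, so
  \<open>W l k\<close> may be raised to an arbitrarily high power.\<close>

lemma vnorm_power_approx:
  fixes x y :: 'c
  assumes "vnorm (x - y) \<le> \<delta> * vnorm y" "0 \<le> \<delta>" "\<delta> \<le> 1"
  shows "vnorm (x ^ j - y ^ j) \<le> \<delta> * vnorm (y ^ j)"
proof (induction j)
  case (Suc j)
  have "vnorm (x - y) \<le> vnorm y"
    using assms mult_left_le_one_le[of "vnorm y" \<delta>] by simp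
  then have x: "vnorm x \<le> vnorm y"
    using vnorm_add_le[of "x - y" "vnorm y" y] by simp
  have "vnorm (x * (x ^ j - y ^ j)) \<le> vnorm y * (\<delta> * vnorm (y ^ j))"
    by (intro vnorm_mult_le x Suc)
  moreover have "vnorm ((x - y) * y ^ j) \<le> \<delta> * vnorm y * vnorm (y ^ j)"
    by (intro vnorm_mult_le assms) simp
  ultimately have "vnorm (x * (x ^ j - y ^ j) + (x - y) * y ^ j) \<le> \<delta> * vnorm (y ^ Suc j)"
    by (intro vnorm_add_le) (simp_all add: vnorm_mult mult_ac)
  then show ?case
    by (simp add: algebra_simps)
qed (use assms in simp)

text \<open>In the exponent, 1 pays for the powers of \<open>W\<close> and \<theta> for a leftover
  power of the first variable with exponent at most 1.\<close>

definition loss :: real where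
  "loss = \<rho> powr (- (1 + \<theta>))"

lemma loss_gt_0: "loss > 0"
  using \<rho> by (simp add: loss_def)

text \<open>A power j of \<open>W l\<close> approximates a scalar times x^(s j), where s = (S l + N
  l) / p^(M l). \<open>W l\<close> has Gauss norm at most 1, while its main term has limiting
  valuation E / p^(M l). By \<open>slope\<close> the accumulated loss j E / p^(M l) is at most |s| j
  / l, hence at most 1 once l \<ge> |i| + 1 \<ge> |s| j. The remaining exponent i - s j is supplied
  by x itself.\<close>

lemma approximate_monomial:
  assumes i: "i \<in> p_rationals p"
  obtains a where "value_seq (loss * \<rho> powr (\<theta> * real_of_rat i)) a"
    "\<forall>\<^sub>F k in sequentially. vnorm (a k - pw (r k * i)) \<le> \<rho> powr (1 / 2) * vnorm (pw (r k * i))"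
proof -
  \<comment> \<open>The size of \<open>l\<close> makes the slope condition strong enough for i; its
    parity gives s the sign of i, or a positive sign if i = 0.\<close>
  define l0 where "l0 = nat \<lceil>\<bar>real_of_rat i\<bar> + 1\<rceil>"
  define l where "l = (if i \<ge> 0 then 2 * l0 else 2 * l0 + 1)"
  have "real l0 \<ge> \<bar>real_of_rat i\<bar> + 1"
    unfolding l0_def by linarith
  moreover have "real l0 \<le> real l"
    by (simp add: l_def)
  ultimately have l: "real l \<ge> \<bar>real_of_rat i\<bar> + 1"
    by (rule order_trans)
  define s where "s = (of_nat (S l) + of_int (N l)) / (of_nat p ^ M l :: rat)"
  have pM: "(of_nat p ^ M l :: rat) > 0" "real p ^ M l > 0"
    using p_gt_0 by simp_all
  have s_real: "real_of_rat s = (real (S l) + N l) / real p ^ M l"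
    by (simp add: s_def of_rat_divide of_rat_add of_rat_power)
  have SN: "(of_nat (S l) + of_int (N l) :: rat) = of_int (int (S l) + N l)"
    by simp
  have s_sign: "if i \<ge> 0 then s > 0 else s < 0"
  proof (cases "i \<ge> 0")
    case True
    then have "int (S l) + N l > 0"
      using sign[of l] by (simp add: l_def)
    then show ?thesis
      unfolding s_def SN using pM True by (simp add: zero_less_divide_iff del: of_int_add)
  next
    case False
    then have "int (S l) + N l < 0"
      using sign[of l] by (simp add: l_def)
    then show ?thesis
      unfolding s_def SN using pM False by (simp add: divide_less_0_iff del: of_int_add)
  qed
  have s_mem: "s \<in> p_rationals p"
    unfolding s_def by (intro p_rationals_divide_power p_rationals_add[OF prime] p_rationals_of_nat p_rationals_of_int)
  have s_le: "\<bar>s\<bar> \<le> 1"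
  proof -
    have "\<bar>real_of_rat s\<bar> \<le> 1"
      unfolding s_real using M(1)[of l] pM(2) by (simp add: abs_divide)
    then show ?thesis
      by (metis of_rat_1 of_rat_less_eq real_of_rat_abs)
  qed
  \<comment> \<open>The quotient i / s is rounded so that the leftover exponent is nonnegative: down
    for s > 0, up for s < 0. As |s| \<le> 1, the leftover is at most 1.\<close>
  obtain j :: nat where j: "0 \<le> i - s * of_nat j" "i - s * of_nat j \<le> 1" "\<bar>s\<bar> * of_nat j \<le> \<bar>i\<bar> + 1"
  proof (cases "i \<ge> 0")
    case True
    define j where "j = nat \<lfloor>i / s\<rfloor>"
    have s: "s > 0"
      using s_sign True by simp
    then have "i / s \<ge> 0"
      using True by simp
    then have j: "of_nat j \<le> i / s" "i / s < of_nat j + 1"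
      unfolding j_def by linarith+
    have "s * of_nat j \<le> i" "i < s * (of_nat j + 1)"
      using j s by (simp_all add: field_simps)
    then show ?thesis
      using that[of j] s s_le True by (simp add: algebra_simps)
  next
    case False
    define j where "j = nat \<lceil>i / s\<rceil>"
    have s: "s < 0"
      using s_sign False by simp
    then have "i / s \<ge> 0"
      using False by (simp add: zero_le_divide_iff)
    then have j: "i / s \<le> of_nat j" "of_nat j < i / s + 1"
      unfolding j_def by linarith+
    have "s * of_nat j \<le> i" "i + s < s * of_nat j"
      using j s by (simp_all add: field_simps)
    then show ?thesis
      using that[of j] s s_le False by (simp add: algebra_simps)
  qed
  \<comment> \<open>\<open>W_main l k ^ j\<close> is \<varpi>^q times x^(s j), so the scalar
    \<varpi>^(-q) remains to be multiplied in.\<close>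
  define q where "q = (of_nat (L l) + of_int (Q l)) / (of_nat p ^ M l :: rat) * of_nat j"
  define a where "a k = pw (- q) * (pw (r k * (i - s * of_nat j)) * W l k ^ j)" for k
  have q_mem: "q \<in> p_rationals p"
    unfolding q_def by (intro p_rationals_mult p_rationals_divide_power p_rationals_add[OF prime]
        p_rationals_of_nat p_rationals_of_int)
  have d_mem: "i - s * of_nat j \<in> p_rationals p"
    by (intro p_rationals_diff[OF prime] p_rationals_mult i s_mem p_rationals_of_nat)
  have cost: "real_of_rat q + \<theta> * real_of_rat i \<le> 1 + \<theta>"
  proof -
    define E where "E = L l + \<theta> * S l + (Q l + \<theta> * N l)"
    have "E = (real (L l) + Q l) + \<theta> * (real (S l) + N l)"
      by (simp add: E_def algebra_simps)
    moreover have "real_of_rat q = (real (L l) + Q l) / real p ^ M l * real j"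
      by (simp add: q_def of_rat_mult of_rat_divide of_rat_add of_rat_power)
    ultimately have q: "real_of_rat q = E * (real j / real p ^ M l) - \<theta> * (real_of_rat s * real j)"
      by (simp add: s_real add_divide_distrib algebra_simps)
    have lpos: "real l > 0"
      using l by linarith
    have "real l * E \<le> \<bar>real (S l) + N l\<bar>"
      using slope[of l] by (simp add: E_def)
    then have "real l * E * (real j / real p ^ M l) \<le> \<bar>real (S l) + N l\<bar> * (real j / real p ^ M l)"
      using pM(2) by (intro mult_right_mono) auto
    also have "\<dots> = \<bar>real_of_rat s\<bar> * real j"
      using pM(2) by (simp add: s_real abs_divide)
    also have "\<dots> \<le> \<bar>real_of_rat i\<bar> + 1"
    proof -
      have "real_of_rat (\<bar>s\<bar> * of_nat j) \<le> real_of_rat (\<bar>i\<bar> + 1)"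
        using j(3) by (simp only: of_rat_less_eq)
      then show ?thesis
        by (simp only: of_rat_mult of_rat_add real_of_rat_abs of_rat_of_nat_eq of_rat_1)
    qed
    also have "\<dots> \<le> real l * 1"
      using l by simp
    finally have "real l * (E * (real j / real p ^ M l)) \<le> real l * 1"
      by (simp only: mult.assoc)
    then have "E * (real j / real p ^ M l) \<le> 1"
      using lpos by (rule mult_left_le_imp_le)
    moreover have "real_of_rat (i - s * of_nat j) \<le> real_of_rat 1"
      using j(2) by (simp only: of_rat_less_eq)
    then have "\<theta> * (real_of_rat i - real_of_rat s * real j) \<le> \<theta> * 1"
      using \<theta> by (intro mult_left_mono) (auto simp: of_rat_diff of_rat_mult)
    ultimately show ?thesis
      unfolding q by (simp add: algebra_simps)
  qed
  have "value_seq (vnorm (pw (- q)) * (1 * 1)) a"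
    unfolding a_def[abs_def]
    by (intro value_seq_cmult value_seq_mult value_seq_x value_seq_power value_seq_W)
      (use j(1) d_mem p_nonneg_iff[OF prime] in blast)
  moreover have "vnorm (pw (- q)) * (1 * 1) \<le> loss * \<rho> powr (\<theta> * real_of_rat i)"
  proof -
    have "vnorm (pw (- q)) = \<rho> powr (- real_of_rat q)"
      using q_mem by (simp add: vnorm_pw p_rationals_uminus of_rat_minus)
    also have "\<dots> \<le> \<rho> powr (- (1 + \<theta>) + \<theta> * real_of_rat i)"
      using cost \<rho> by (intro powr_mono') auto
    finally show ?thesis
      by (simp add: loss_def powr_add)
  qed
  ultimately have "value_seq (loss * \<rho> powr (\<theta> * real_of_rat i)) a"
    by (rule value_seq_mono)
  moreover have "vnorm (a k - pw (r k * i)) \<le> \<rho> powr (1 / 2) * vnorm (pw (r k * i))" if "k > l" for k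
  proof -
    define c where "c = pw (- q) * pw (r k * (i - s * of_nat j))"
    have "W_main l k ^ j = pw q * pw (r k * (s * of_nat j))"
      unfolding W_main_def power_mult_distrib
    proof -
      have 1: "(of_nat (L l) + of_int (Q l)) / of_nat p ^ M l \<in> p_rationals p"
        by (intro p_rationals_divide_power p_rationals_add[OF prime] p_rationals_of_nat p_rationals_of_int)
      show "pw ((of_nat (L l) + of_int (Q l)) / of_nat p ^ M l) ^ j
          * pw (r k * ((of_nat (S l) + of_int (N l)) / of_nat p ^ M l)) ^ j
        = pw q * pw (r k * (s * of_nat j))"
        unfolding pw_power[OF 1] s_def[symmetric] pw_power[OF p_rationals_mult[OF r(1) s_mem]]
        by (simp only: q_def mult.assoc)
    qed
    then have "c * W_main l k ^ j = (pw (- q) * pw q) * (pw (r k * (i - s * of_nat j)) * pw (r k * (s * of_nat j)))"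
      by (simp add: c_def mult_ac)
    also have "pw (- q) * pw q = 1"
      using pw_add[of "- q" q] q_mem by (simp add: pw_0 p_rationals_uminus)
    also have "pw (r k * (i - s * of_nat j)) * pw (r k * (s * of_nat j)) = pw (r k * i)"
    proof -
      have "r k * i = r k * (i - s * of_nat j) + r k * (s * of_nat j)"
        by (simp add: algebra_simps)
      then show ?thesis
        using pw_add[OF p_rationals_mult[OF r(1) d_mem] p_rationals_mult[OF r(1) p_rationals_mult[OF s_mem p_rationals_of_nat]]]
        by simp
    qed
    finally have eq: "pw (r k * i) = c * W_main l k ^ j"
      by simp
    have "vnorm (W l k ^ j - W_main l k ^ j) \<le> \<rho> powr (1 / 2) * vnorm (W_main l k ^ j)"
      using W_approx[OF that] \<rho> by (intro vnorm_power_approx) (auto simp: powr_le1)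
    then have "vnorm c * vnorm (W l k ^ j - W_main l k ^ j) \<le> vnorm c * (\<rho> powr (1 / 2) * vnorm (W_main l k ^ j))"
      by (intro mult_left_mono) auto
    moreover have "a k - pw (r k * i) = c * (W l k ^ j - W_main l k ^ j)"
      unfolding eq by (simp add: a_def c_def algebra_simps)
    ultimately show ?thesis
      unfolding eq by (simp add: vnorm_mult mult_ac)
  qed
  then have "\<forall>\<^sub>F k in sequentially. vnorm (a k - pw (r k * i)) \<le> \<rho> powr (1 / 2) * vnorm (pw (r k * i))"
    by (rule eventually_mono[OF eventually_gt_at_top[of l]])
  ultimately show ?thesis
    using that by blast
qed

end

section \<open>Approximation by values of convergent series\<close>

lemma vnorm_sum_less:
  assumes "\<And>i. i \<in> A \<Longrightarrow> vnorm (f i :: 'a::complete_nonarch_field) < s" "0 < s"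
  shows "vnorm (sum f A) < s"
  using assms(1)
proof (induction A rule: infinite_finite_induct)
  case (insert i A)
  then have "vnorm (f i) < s" "vnorm (sum f A) < s"
    by auto
  then show ?case
    using vnorm_add[of "f i" "sum f A"] insert.hyps by simp
qed (use assms(2) in auto)

text \<open>A term of maximal norm, if nonzero, strictly dominates all the others and so determines
  the norm of the sum.\<close>

lemma vnorm_le_sum_if_distinct:
  fixes f :: "'i \<Rightarrow> 'a::complete_nonarch_field"
  assumes "finite F" "i \<in> F"
    and distinct: "\<And>i j. i \<in> F \<Longrightarrow> j \<in> F \<Longrightarrow> i \<noteq> j \<Longrightarrow> f i \<noteq> 0 \<Longrightarrow> vnorm (f i) \<noteq> vnorm (f j)"
  shows "vnorm (f i) \<le> vnorm (sum f F)"
proof -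
  obtain m where m: "m \<in> F" "\<And>j. j \<in> F \<Longrightarrow> vnorm (f j) \<le> vnorm (f m)"
  proof -
    have "Max ((\<lambda>j. vnorm (f j)) ` F) \<in> (\<lambda>j. vnorm (f j)) ` F"
      using assms(1,2) by (intro Max_in) auto
    then obtain m where "m \<in> F" "Max ((\<lambda>j. vnorm (f j)) ` F) = vnorm (f m)"
      by auto
    moreover have "vnorm (f j) \<le> Max ((\<lambda>j. vnorm (f j)) ` F)" if "j \<in> F" for j
      using that assms(1) by auto
    ultimately show ?thesis
      using that by simp
  qed
  show ?thesis
  proof (cases "f m = 0")
    case True
    then show ?thesis
      using m(2)[OF assms(2)] vnorm_ge_0[of "sum f F"] by (metis order_trans vnorm_zero)
  next
    case False
    have "vnorm (f j) < vnorm (f m)" if "j \<in> F - {m}" for j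
      using that m(2)[of j] distinct[OF m(1), of j] False by fastforce
    then have "vnorm (sum f (F - {m})) < vnorm (f m)"
      using False by (intro vnorm_sum_less) auto
    moreover have "sum f F - f m = sum f (F - {m})"
      using assms(1) m(1) by (simp add: sum_diff1)
    ultimately have "vnorm (sum f F) = vnorm (f m)"
      by (intro vnorm_eq_of_diff_less) simp
    then show ?thesis
      using m(2)[OF assms(2)] by simp
  qed
qed

context tate_points
begin

section \<open>Laurent polynomials in the first coordinate\<close>

lemma vnorm_pw_r: "i \<in> p_rationals p \<Longrightarrow> vnorm (pw (r k * i)) = \<rho> powr (real_of_rat (r k) * real_of_rat i)"
  by (simp add: vnorm_pw p_rationals_mult r(1) of_rat_mult)

lemma tendsto_vnorm_pw_r:
  assumes "i \<in> p_rationals p"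
  shows "(\<lambda>k. vnorm (pw (r k * i))) \<longlonglongrightarrow> \<rho> powr (\<theta> * real_of_rat i)"
  unfolding vnorm_pw_r[OF assms] using \<rho>(1) by (intro tendsto_intros r(3)) auto

text \<open>The exponents and coefficients are the same for all k; only the point varies.\<close>

definition laurent :: "(nat \<Rightarrow> 'c) \<Rightarrow> bool" where
  "laurent a \<longleftrightarrow> (\<exists>F c. finite F \<and> F \<subseteq> p_rationals p \<and> (\<forall>k. a k = (\<Sum>i\<in>F. c i * pw (r k * i))))"

text \<open>Collects terms with equal exponents. Sums and products produce repeated exponents,
  whereas \<open>laurent\<close> and the coefficient bound speak of a set of exponents.\<close>

lemma laurent_regroup:
  assumes "finite A" "h ` A \<subseteq> p_rationals p"
  shows "laurent (\<lambda>k. \<Sum>z\<in>A. c z * pw (r k * h z))"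
  unfolding laurent_def
proof (intro exI conjI allI)
  show "finite (h ` A)" "h ` A \<subseteq> p_rationals p"
    using assms by auto
  fix k
  have "(\<Sum>z\<in>A. c z * pw (r k * h z)) = (\<Sum>i\<in>h ` A. \<Sum>z\<in>{z \<in> A. h z = i}. c z * pw (r k * h z))"
    by (rule sum.image_gen[OF assms(1)])
  also have "\<dots> = (\<Sum>i\<in>h ` A. sum c {z \<in> A. h z = i} * pw (r k * i))"
    by (intro sum.cong) (auto simp: sum_distrib_right)
  finally show "(\<Sum>z\<in>A. c z * pw (r k * h z)) = (\<Sum>i\<in>h ` A. sum c {z \<in> A. h z = i} * pw (r k * i))" .
qed

lemma laurent_monomial: "i \<in> p_rationals p \<Longrightarrow> laurent (\<lambda>k. c * pw (r k * i))"
  using laurent_regroup[of "{i}" "\<lambda>i. i" "\<lambda>_. c"] by simp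

lemma laurent_add:
  assumes "laurent a" "laurent b"
  shows "laurent (\<lambda>k. a k + b k)"
proof -
  obtain F c G d where *: "finite F" "F \<subseteq> p_rationals p" "\<And>k. a k = (\<Sum>i\<in>F. c i * pw (r k * i))"
    "finite G" "G \<subseteq> p_rationals p" "\<And>k. b k = (\<Sum>i\<in>G. d i * pw (r k * i))"
    using assms unfolding laurent_def by blast
  have "laurent (\<lambda>k. \<Sum>z\<in>F <+> G. case_sum c d z * pw (r k * case_sum (\<lambda>i. i) (\<lambda>i. i) z))"
    using * by (intro laurent_regroup) auto
  then show ?thesis
    using * by (simp add: sum.Plus)
qed

lemma laurent_mult:
  assumes "laurent a" "laurent b"
  shows "laurent (\<lambda>k. a k * b k)"
proof -
  obtain F c G d where *: "finite F" "F \<subseteq> p_rationals p" "\<And>k. a k = (\<Sum>i\<in>F. c i * pw (r k * i))"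
    "finite G" "G \<subseteq> p_rationals p" "\<And>k. b k = (\<Sum>i\<in>G. d i * pw (r k * i))"
    using assms unfolding laurent_def by blast
  have mem: "i + j \<in> p_rationals p" if "i \<in> F" "j \<in> G" for i j
    using that * by (intro p_rationals_add[OF prime]) auto
  have "laurent (\<lambda>k. \<Sum>z\<in>F \<times> G. (c (fst z) * d (snd z)) * pw (r k * (fst z + snd z)))"
    using * mem by (intro laurent_regroup) auto
  moreover have "a k * b k = (\<Sum>z\<in>F \<times> G. (c (fst z) * d (snd z)) * pw (r k * (fst z + snd z)))" for k
  proof -
    have pw: "pw (r k * (i + j)) = pw (r k * i) * pw (r k * j)" if "i \<in> F" "j \<in> G" for i j
      using that * unfolding distrib_left by (intro pw_add p_rationals_mult r(1)) auto
    have "a k * b k = (\<Sum>(i, j)\<in>F \<times> G. (c i * pw (r k * i)) * (d j * pw (r k * j)))"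
      by (simp add: * sum_product sum.cartesian_product)
    also have "\<dots> = (\<Sum>z\<in>F \<times> G. (c (fst z) * d (snd z)) * pw (r k * (fst z + snd z)))"
      using pw by (intro sum.cong) (auto simp: mult_ac)
    finally show ?thesis .
  qed
  ultimately show ?thesis
    by simp
qed

lemma laurent_sum: "finite A \<Longrightarrow> (\<And>i. i \<in> A \<Longrightarrow> laurent (a i)) \<Longrightarrow> laurent (\<lambda>k. \<Sum>i\<in>A. a i k)"
proof (induction A rule: finite_induct)
  case empty
  then show ?case
    using laurent_regroup[of "{}"] by simp
qed (simp add: laurent_add)

lemma laurent_bounded:
  assumes "laurent a"
  obtains B where "B > 0" "\<forall>\<^sub>F k in sequentially. vnorm (a k) \<le> B"
proof -
  obtain F c where F: "finite F" "F \<subseteq> p_rationals p" "\<And>k. a k = (\<Sum>i\<in>F. c i * pw (r k * i))"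
    using assms unfolding laurent_def by blast
  define B where "B = 1 + (\<Sum>i\<in>F. vnorm (c i) * (\<rho> powr (\<theta> * real_of_rat i) + 1))"
  have nonneg: "0 \<le> vnorm (c i) * (\<rho> powr (\<theta> * real_of_rat i) + 1)" for i
    by (intro mult_nonneg_nonneg add_nonneg_nonneg) auto
  have "B > 0"
    unfolding B_def using nonneg by (intro add_pos_nonneg sum_nonneg) auto
  have ev_i: "\<forall>\<^sub>F k in sequentially. vnorm (c i * pw (r k * i)) \<le> B" if i: "i \<in> F" for i
  proof -
    have "\<forall>\<^sub>F k in sequentially. vnorm (pw (r k * i)) < \<rho> powr (\<theta> * real_of_rat i) + 1"
      using F(2) i by (intro order_tendstoD(2)[OF tendsto_vnorm_pw_r]) auto
    then show ?thesis
    proof eventually_elim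
      case (elim k)
      have "vnorm (c i * pw (r k * i)) \<le> vnorm (c i) * (\<rho> powr (\<theta> * real_of_rat i) + 1)"
        using elim by (intro vnorm_mult_le) auto
      also have "\<dots> \<le> B"
        unfolding B_def using member_le_sum[OF i, of "\<lambda>i. vnorm (c i) * (\<rho> powr (\<theta> * real_of_rat i) + 1)"] nonneg F(1)
        by fastforce
      finally show ?case .
    qed
  qed
  have "\<forall>\<^sub>F k in sequentially. \<forall>i\<in>F. vnorm (c i * pw (r k * i)) \<le> B"
    using ev_i by (intro eventually_ball_finite F(1)) auto
  then have "\<forall>\<^sub>F k in sequentially. vnorm (a k) \<le> B"
    by eventually_elim (use \<open>B > 0\<close> in \<open>auto simp: F(3) intro!: vnorm_sum_le\<close>)
  then show ?thesis
    using that \<open>B > 0\<close> by blast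
qed

text \<open>A number x \<le> \<theta> is never attained because r k > \<theta> is strict, and any
  larger number is eventually passed.\<close>

lemma eventually_r_neq: "\<forall>\<^sub>F k in sequentially. real_of_rat (r k) \<noteq> x"
proof (cases "x \<le> \<theta>")
  case True
  then show ?thesis
    using r(2) by (auto intro!: always_eventually dest: le_less_trans)
next
  case False
  then have "\<forall>\<^sub>F k in sequentially. real_of_rat (r k) < x"
    by (intro order_tendstoD(2)[OF r(3)]) auto
  then show ?thesis
    by eventually_elim auto
qed

text \<open>Since \<open>r k \<rightarrow> \<theta>\<close> but \<open>r k \<noteq> \<theta>\<close>, the terms of a Laurent polynomial
  eventually have different norms, even if two of the limits agree.\<close>

lemma laurent_coeff_bound:
  assumes F: "finite F" "F \<subseteq> p_rationals p" and i: "i \<in> F"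
    and s: "\<forall>\<^sub>F k in sequentially. vnorm (\<Sum>i\<in>F. c i * pw (r k * i)) \<le> s"
  shows "vnorm (c i) * \<rho> powr (\<theta> * real_of_rat i) \<le> s"
proof -
  have pw_pos: "vnorm (pw (r k * i)) > 0" if "i \<in> F" for k i
    using that F(2) \<rho>(1) by (subst vnorm_pw_r) auto
  have neq: "\<forall>\<^sub>F k in sequentially. c i * pw (r k * i) \<noteq> 0 \<longrightarrow> vnorm (c i * pw (r k * i)) \<noteq> vnorm (c j * pw (r k * j))"
    if ij: "i \<in> F" "j \<in> F" "i \<noteq> j" for i j
  proof (cases "c i = 0 \<or> c j = 0")
    case True
    then show ?thesis
      by (auto intro!: always_eventually)
  next
    case False
    then have pos: "vnorm (c i) > 0" "vnorm (c j) > 0"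
      by auto
    \<comment> \<open>The only value of \<open>r k\<close> at which the i-th and j-th terms have
      equal norms, found by taking logarithms.\<close>
    define x where "x = (ln (vnorm (c j)) - ln (vnorm (c i))) / ((real_of_rat i - real_of_rat j) * ln \<rho>)"
    show ?thesis
      using eventually_r_neq[of x]
    proof eventually_elim
      case (elim k)
      have "vnorm (c i * pw (r k * i)) \<noteq> vnorm (c j * pw (r k * j))"
      proof
        assume "vnorm (c i * pw (r k * i)) = vnorm (c j * pw (r k * j))"
        then have "ln (vnorm (c i) * \<rho> powr (real_of_rat (r k) * real_of_rat i))
            = ln (vnorm (c j) * \<rho> powr (real_of_rat (r k) * real_of_rat j))"
          using ij F(2) by (simp add: vnorm_mult vnorm_pw_r subset_iff)
        then have "ln (vnorm (c i)) + real_of_rat (r k) * real_of_rat i * ln \<rho>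
            = ln (vnorm (c j)) + real_of_rat (r k) * real_of_rat j * ln \<rho>"
          using pos \<rho>(1) by (simp add: ln_mult ln_powr)
        then have "real_of_rat (r k) * ((real_of_rat i - real_of_rat j) * ln \<rho>) = ln (vnorm (c j)) - ln (vnorm (c i))"
          by (simp add: algebra_simps)
        moreover have "(real_of_rat i - real_of_rat j) * ln \<rho> \<noteq> 0"
          using ij(3) \<rho> by simp
        ultimately have "real_of_rat (r k) = x"
          unfolding x_def by (metis nonzero_mult_div_cancel_right)
        then show False
          using elim by simp
      qed
      then show ?case
        by blast
    qed
  qed
  have "\<forall>\<^sub>F k in sequentially. \<forall>i\<in>F. \<forall>j\<in>F. i \<noteq> j \<longrightarrow> c i * pw (r k * i) \<noteq> 0 \<longrightarrow>
      vnorm (c i * pw (r k * i)) \<noteq> vnorm (c j * pw (r k * j))"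
  proof (intro eventually_ball_finite F(1) ballI)
    show "\<forall>\<^sub>F k in sequentially. i \<noteq> j \<longrightarrow> c i * pw (r k * i) \<noteq> 0 \<longrightarrow>
      vnorm (c i * pw (r k * i)) \<noteq> vnorm (c j * pw (r k * j))" if "i \<in> F" "j \<in> F" for i j
      using neq[OF that] by (cases "i = j") auto
  qed
  then have "\<forall>\<^sub>F k in sequentially. vnorm (c i) * vnorm (pw (r k * i)) \<le> s"
    using s
  proof eventually_elim
    case (elim k)
    have "vnorm (c i * pw (r k * i)) \<le> vnorm (\<Sum>i\<in>F. c i * pw (r k * i))"
      using elim(1) by (intro vnorm_le_sum_if_distinct[OF F(1) i]) blast
    then show ?case
      using elim(2) by (simp add: vnorm_mult)
  qed
  moreover have "(\<lambda>k. vnorm (c i) * vnorm (pw (r k * i))) \<longlonglongrightarrow> vnorm (c i) * \<rho> powr (\<theta> * real_of_rat i)"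
    using F(2) i by (intro tendsto_mult_left tendsto_vnorm_pw_r) auto
  ultimately show ?thesis
    by (intro tendsto_upperbound) auto
qed

text \<open>The closure of the Laurent polynomials under the limsup seminorm. Successive
  approximation needs a class that contains the values of all series, so that remainders stay in it,
  and in which the coefficient bound can be applied up to small errors.\<close>

definition approximable :: "(nat \<Rightarrow> 'c) \<Rightarrow> bool" where
  "approximable a \<longleftrightarrow> (\<forall>\<epsilon>>0. \<exists>g. laurent g \<and> (\<forall>\<^sub>F k in sequentially. vnorm (a k - g k) \<le> \<epsilon>))"

lemma approximable_laurent: "laurent a \<Longrightarrow> approximable a"
  unfolding approximable_def by (auto intro!: exI[of _ a] always_eventually)

lemma approximable_limit:
  assumes "\<And>\<epsilon>. \<epsilon> > 0 \<Longrightarrow> \<exists>b. approximable b \<and> (\<forall>\<^sub>F k in sequentially. vnorm (a k - b k) \<le> \<epsilon>)"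
  shows "approximable a"
  unfolding approximable_def
proof (intro allI impI)
  fix \<epsilon> :: real assume \<epsilon>: "\<epsilon> > 0"
  then obtain b where b: "approximable b" "\<forall>\<^sub>F k in sequentially. vnorm (a k - b k) \<le> \<epsilon>"
    using assms by blast
  then obtain g where g: "laurent g" "\<forall>\<^sub>F k in sequentially. vnorm (b k - g k) \<le> \<epsilon>"
    using \<epsilon> unfolding approximable_def by blast
  have "\<forall>\<^sub>F k in sequentially. vnorm (a k - g k) \<le> \<epsilon>"
    using b(2) g(2)
  proof eventually_elim
    case (elim k)
    then show ?case
      using vnorm_add_le[of "a k - b k" \<epsilon> "b k - g k"] by simp
  qed
  then show "\<exists>g. laurent g \<and> (\<forall>\<^sub>F k in sequentially. vnorm (a k - g k) \<le> \<epsilon>)"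
    using g(1) by blast
qed

lemma approximable_add:
  assumes "approximable a" "approximable b"
  shows "approximable (\<lambda>k. a k + b k)"
  unfolding approximable_def
proof (intro allI impI)
  fix \<epsilon> :: real assume \<epsilon>: "\<epsilon> > 0"
  then obtain g h where gh: "laurent g" "\<forall>\<^sub>F k in sequentially. vnorm (a k - g k) \<le> \<epsilon>"
    "laurent h" "\<forall>\<^sub>F k in sequentially. vnorm (b k - h k) \<le> \<epsilon>"
    using assms unfolding approximable_def by meson
  have "\<forall>\<^sub>F k in sequentially. vnorm (a k + b k - (g k + h k)) \<le> \<epsilon>"
    using gh(2,4)
  proof eventually_elim
    case (elim k)
    then show ?case
      using vnorm_add_le[of "a k - g k" \<epsilon> "b k - h k"] by (simp add: algebra_simps)
  qed
  then show "\<exists>g. laurent g \<and> (\<forall>\<^sub>F k in sequentially. vnorm (a k + b k - g k) \<le> \<epsilon>)"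
    using laurent_add[OF gh(1,3)] by blast
qed

lemma approximable_bounded:
  assumes "approximable a"
  obtains B where "B > 0" "\<forall>\<^sub>F k in sequentially. vnorm (a k) \<le> B"
proof -
  obtain g where g: "laurent g" "\<forall>\<^sub>F k in sequentially. vnorm (a k - g k) \<le> 1"
    using assms zero_less_one unfolding approximable_def by blast
  obtain B where B: "B > 0" "\<forall>\<^sub>F k in sequentially. vnorm (g k) \<le> B"
    using laurent_bounded[OF g(1)] .
  have "\<forall>\<^sub>F k in sequentially. vnorm (a k) \<le> max 1 B"
    using g(2) B(2)
  proof eventually_elim
    case (elim k)
    then show ?case
      using vnorm_add_le[of "a k - g k" "max 1 B" "g k"] by simp
  qed
  then show ?thesis
    using that[of "max 1 B"] by simp
qed

lemma approximable_mult:
  assumes "approximable a" "approximable b"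
  shows "approximable (\<lambda>k. a k * b k)"
  unfolding approximable_def
proof (intro allI impI)
  fix \<epsilon> :: real assume \<epsilon>: "\<epsilon> > 0"
  obtain B where B: "B > 0" "\<forall>\<^sub>F k in sequentially. vnorm (b k) \<le> B"
    using approximable_bounded[OF assms(2)] .
  have "\<epsilon> / B > 0"
    using \<epsilon> B(1) by simp
  then obtain g where g: "laurent g" "\<forall>\<^sub>F k in sequentially. vnorm (a k - g k) \<le> \<epsilon> / B"
    using assms(1) unfolding approximable_def by blast
  obtain G where G: "G > 0" "\<forall>\<^sub>F k in sequentially. vnorm (g k) \<le> G"
    using laurent_bounded[OF g(1)] .
  have "\<epsilon> / G > 0"
    using \<epsilon> G(1) by simp
  then obtain h where h: "laurent h" "\<forall>\<^sub>F k in sequentially. vnorm (b k - h k) \<le> \<epsilon> / G"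
    using assms(2) unfolding approximable_def by blast
  have "\<forall>\<^sub>F k in sequentially. vnorm (a k * b k - g k * h k) \<le> \<epsilon>"
    using B(2) g(2) G(2) h(2)
  proof eventually_elim
    case (elim k)
    have "vnorm ((a k - g k) * b k) \<le> \<epsilon> / B * B" "vnorm (g k * (b k - h k)) \<le> G * (\<epsilon> / G)"
      using elim by (intro vnorm_mult_le; simp)+
    then have "vnorm ((a k - g k) * b k + g k * (b k - h k)) \<le> \<epsilon>"
      using B(1) G(1) by (intro vnorm_add_le) auto
    then show ?case
      by (simp add: algebra_simps)
  qed
  then show "\<exists>g. laurent g \<and> (\<forall>\<^sub>F k in sequentially. vnorm (a k * b k - g k) \<le> \<epsilon>)"
    using laurent_mult[OF g(1) h(1)] by blast
qed

lemma laurent_const: "laurent (\<lambda>k. c)"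
  using laurent_monomial[of 0 c] p_rationals_of_nat[of 0] by (simp add: pw_0)

lemma approximable_power: "approximable a \<Longrightarrow> approximable (\<lambda>k. a k ^ j)"
  by (induction j) (simp_all add: approximable_mult approximable_laurent[OF laurent_const])

lemma approximable_cmult: "approximable a \<Longrightarrow> approximable (\<lambda>k. c * a k)"
  by (intro approximable_mult approximable_laurent[OF laurent_const])

lemma approximable_sum: "finite A \<Longrightarrow> (\<And>i. i \<in> A \<Longrightarrow> approximable (a i)) \<Longrightarrow> approximable (\<lambda>k. \<Sum>i\<in>A. a i k)"
  by (induction A rule: finite_induct) (auto intro: approximable_add approximable_laurent laurent_const)

section \<open>Values of series as limits of Laurent polynomials\<close>

lemma valuation_growth: "2 * real j + 2 \<le> Q j + \<theta> * N j"
proof (induction j)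
  case (Suc j)
  have "0 \<le> real p ^ M j / 2"
    by simp
  then have "Q j + \<theta> * N j + 2 \<le> Q (Suc j) + \<theta> * N (Suc j)"
    using valuation_gap[of j "Suc j"] by linarith
  then show ?case
    using Suc by simp
qed (use valuation_ge[of 0] in simp)

lemma vnorm_pw_expo_le:
  assumes "j < k"
  shows "vnorm (pw (expo k j / of_nat p ^ m)) \<le> (\<rho> powr (1 / real p ^ m)) ^ j"
proof -
  have "real j \<le> real_of_rat (expo k j)"
    using expo_bounds(2)[OF assms] valuation_growth[of j] by linarith
  then have "real j / real p ^ m \<le> real_of_rat (expo k j) / real p ^ m"
    by (intro divide_right_mono) auto
  moreover have "vnorm (pw (expo k j / of_nat p ^ m)) = \<rho> powr (real_of_rat (expo k j) / real p ^ m)"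
    by (subst vnorm_pw) (auto intro!: p_rationals_divide_power expo_p_rationals simp: of_rat_divide of_rat_power)
  ultimately have "vnorm (pw (expo k j / of_nat p ^ m)) \<le> \<rho> powr (real j / real p ^ m)"
    using \<rho> by (simp add: powr_mono')
  then show ?thesis
    using \<rho> by (simp add: powr_powr[symmetric] powr_realpow[symmetric] powr_powr)
qed

text \<open>The number of terms grows with k, but by \<open>vnorm_pw_expo_le\<close> the terms decay
  geometrically at a rate independent of k, so a fixed truncation works for all large k.\<close>

lemma approximable_expo_sum: "approximable (\<lambda>k. \<Sum>j<k. pw (expo k j / of_nat p ^ m))"
proof (rule approximable_limit)
  fix \<epsilon> :: real assume \<epsilon>: "\<epsilon> > 0"
  define \<sigma> where "\<sigma> = \<rho> powr (1 / real p ^ m)"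
  have \<sigma>: "0 < \<sigma>" "\<sigma> < 1"
    using \<rho> p_gt_0 powr_less_mono'[of \<rho> 0 "1 / real p ^ m"] by (auto simp: \<sigma>_def)
  obtain l where l: "\<sigma> ^ l < \<epsilon>"
    using real_arch_pow_inv[OF \<epsilon> \<sigma>(2)] by blast
  have term_eq: "pw (expo k j / of_nat p ^ m) = pw (of_int (Q j) / of_nat p ^ m) * pw (r k * (of_int (N j) / of_nat p ^ m))" for j k
    by (subst pw_add[symmetric])
      (auto simp: add_divide_distrib mult.commute intro!: p_rationals_divide_power p_rationals_mult p_rationals_of_int r(1))
  have "laurent (\<lambda>k. \<Sum>j<l. pw (expo k j / of_nat p ^ m))"
    unfolding term_eq by (intro laurent_sum laurent_monomial p_rationals_divide_power p_rationals_of_int) auto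
  moreover have "vnorm ((\<Sum>j<k. pw (expo k j / of_nat p ^ m)) - (\<Sum>j<l. pw (expo k j / of_nat p ^ m))) \<le> \<epsilon>"
    if "k \<ge> l" for k
  proof -
    have "(\<Sum>j<k. pw (expo k j / of_nat p ^ m)) - (\<Sum>j<l. pw (expo k j / of_nat p ^ m))
        = (\<Sum>j\<in>{..<k} - {..<l}. pw (expo k j / of_nat p ^ m))"
      using that by (subst sum_diff) auto
    also have "vnorm \<dots> \<le> \<epsilon>"
    proof (rule vnorm_sum_le)
      fix j assume "j \<in> {..<k} - {..<l}"
      then have j: "l \<le> j" "j < k"
        by auto
      have "\<sigma> ^ j \<le> \<sigma> ^ l"
        using j \<sigma> by (intro power_decreasing) auto
      then show "vnorm (pw (expo k j / of_nat p ^ m)) \<le> \<epsilon>"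
        using vnorm_pw_expo_le[OF j(2), of m] l by (simp add: \<sigma>_def)
    qed (use \<epsilon> in simp)
    finally show ?thesis .
  qed
  ultimately show "\<exists>b. approximable b \<and> (\<forall>\<^sub>F k in sequentially. vnorm ((\<Sum>j<k. pw (expo k j / of_nat p ^ m)) - b k) \<le> \<epsilon>)"
    by (intro exI[of _ "\<lambda>k. \<Sum>j<l. pw (expo k j / of_nat p ^ m)"] conjI approximable_laurent)
      (auto simp: eventually_sequentially)
qed

lemma V_power:
  assumes "a \<in> p_nonneg p"
  shows "V k (a * of_nat j) = V k a ^ j"
proof (induction j)
  case (Suc j)
  have "a * of_nat j \<in> p_nonneg p"
    using assms by (auto simp: p_nonneg_iff[OF prime] p_rationals_mult p_rationals_of_nat)
  then have "V k (a + a * of_nat j) = V k a * V k (a * of_nat j)"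
    using assms by (intro V_add)
  then show ?case
    using Suc by (simp add: algebra_simps)
qed (simp add: V_0)

lemma p_nonneg_inverse_power: "1 / of_nat p ^ m \<in> p_nonneg p"
  using p_nonnegI[of 1 p m] by simp

lemma vnorm_power_p_approx:
  fixes x y :: 'c
  assumes "vnorm (x - y) \<le> vnorm (of_nat p :: 'c)" "vnorm y \<le> 1"
  shows "vnorm (x ^ p ^ h - y ^ p ^ h) \<le> vnorm (of_nat p :: 'c) ^ Suc h"
proof (induction h)
  case (Suc h)
  have "vnorm (of_nat p :: 'c) ^ Suc h \<le> vnorm (of_nat p :: 'c)"
    using vnorm_of_nat_le[of p, where 'a = 'c] by (simp add: mult_left_le power_le_one)
  then have "vnorm ((x ^ p ^ h) ^ p - (y ^ p ^ h) ^ p) \<le> vnorm (of_nat p :: 'c) * vnorm (of_nat p :: 'c) ^ Suc h"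
    using Suc assms(2) by (intro vnorm_power_diff_le[OF prime]) (auto simp: vnorm_power power_le_one)
  then show ?case
    by (simp add: power_mult[symmetric] mult.commute)
qed (use assms in simp)

text \<open>\<open>V_near\<close> at level m only gives the fixed error |p|. Applied at level m + h
  and followed by h successive p-th powers, it gives |p|^(h+1).\<close>

lemma approximable_V: "approximable (\<lambda>k. V k (1 / of_nat p ^ m))"
proof (rule approximable_limit)
  fix \<epsilon> :: real assume \<epsilon>: "\<epsilon> > 0"
  have P: "vnorm (of_nat p :: 'c) < 1"
    using \<rho> by simp
  obtain h where h: "vnorm (of_nat p :: 'c) ^ h < \<epsilon>"
    using real_arch_pow_inv[OF \<epsilon> P] by blast
  have "vnorm (V k (1 / of_nat p ^ m) - (\<Sum>j<k. pw (expo k j / of_nat p ^ (m + h))) ^ p ^ h) \<le> \<epsilon>" for k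
  proof -
    have "(1 / of_nat p ^ m :: rat) = 1 / of_nat p ^ (m + h) * of_nat (p ^ h)"
      using p_gt_0 by (simp add: power_add)
    then have "V k (1 / of_nat p ^ m) = V k (1 / of_nat p ^ (m + h)) ^ p ^ h"
      by (simp only: V_power[OF p_nonneg_inverse_power])
    moreover have "vnorm (pw (expo k j / of_nat p ^ (m + h))) \<le> 1" if "j < k" for j
      using vnorm_pw_expo_le[OF that, of "m + h"]
      by (rule order_trans) (use \<rho> in \<open>auto intro!: power_le_one powr_le1\<close>)
    then have "vnorm (\<Sum>j<k. pw (expo k j / of_nat p ^ (m + h))) \<le> 1"
      by (intro vnorm_sum_le) auto
    ultimately have "vnorm (V k (1 / of_nat p ^ m) - (\<Sum>j<k. pw (expo k j / of_nat p ^ (m + h))) ^ p ^ h)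
        \<le> vnorm (of_nat p :: 'c) ^ Suc h"
      using vnorm_power_p_approx[OF V_near] by simp
    also have "\<dots> \<le> vnorm (of_nat p :: 'c) ^ h"
      using P by (intro power_decreasing) auto
    finally show ?thesis
      using h by simp
  qed
  then show "\<exists>b. approximable b \<and> (\<forall>\<^sub>F k in sequentially. vnorm (V k (1 / of_nat p ^ m) - b k) \<le> \<epsilon>)"
    by (intro exI[of _ "\<lambda>k. (\<Sum>j<k. pw (expo k j / of_nat p ^ (m + h))) ^ p ^ h"] conjI
        approximable_power approximable_expo_sum always_eventually allI)
qed

lemma approximable_point:
  assumes "e \<in> p_exponents p n"
  shows "approximable (\<lambda>k. point k e)"
proof -
  have 0: "Poly_Mapping.lookup e 0 \<in> p_rationals p"
    using lookup_p_nonneg[OF assms] p_nonneg_iff[OF prime] by blast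
  obtain a m where "Poly_Mapping.lookup e 1 = of_nat a / of_nat p ^ m"
    using lookup_p_nonneg[OF assms] unfolding p_nonneg_def by blast
  then have "V k (Poly_Mapping.lookup e 1) = V k (1 / of_nat p ^ m) ^ a" for k
    using V_power[OF p_nonneg_inverse_power, of k m a] by simp
  then show ?thesis
    unfolding point_def
    using approximable_mult[OF approximable_laurent[OF laurent_monomial[OF 0, of 1]]
        approximable_power[OF approximable_V, of m a]] by simp
qed

text \<open>Only finitely many coefficients have norm at least \<epsilon>; the rest of the series
  has values of norm at most \<epsilon> at every point.\<close>

lemma approximable_ev:
  assumes f: "f \<in> carrier R"
  shows "approximable (\<lambda>k. ev k f)"
proof (rule approximable_limit)
  fix \<epsilon> :: real assume \<epsilon>: "\<epsilon> > 0"
  define A where "A = {e. vnorm (f e) \<ge> \<epsilon>}"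
  have fin: "finite A"
    using f \<epsilon> by (auto simp: A_def tate_carrier null_family_def)
  have A_sub: "A \<subseteq> p_exponents p n"
  proof
    fix e assume "e \<in> A"
    then have "f e \<noteq> 0"
      using \<epsilon> by (auto simp: A_def)
    then show "e \<in> p_exponents p n"
      using f by (auto simp: tate_carrier p)
  qed
  define g where "g e = (if e \<in> A then f e else 0)" for e
  have g: "g \<in> carrier R"
    using f null_family_finite_support[OF fin, of g] by (auto simp: tate_carrier g_def)
  have ev_g: "ev k g = (\<Sum>e\<in>A. f e * point k e)" for k
  proof -
    have "ev k g = infsum (\<lambda>e. f e * point k e) A"
      unfolding evaluate_def by (rule infsum_cong_neutral) (auto simp: g_def)
    then show ?thesis
      using fin by simp
  qed
  have "vnorm (ev k f - ev k g) \<le> \<epsilon>" for k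
    unfolding ev_diff[OF f g, symmetric]
    by (intro vnorm_ev_le tate_diff_closed f g) (use \<epsilon> in \<open>auto simp: g_def A_def\<close>)
  moreover have "approximable (\<lambda>k. ev k g)"
    unfolding ev_g using A_sub by (intro approximable_sum fin approximable_cmult approximable_point) auto
  ultimately show "\<exists>b. approximable b \<and> (\<forall>\<^sub>F k in sequentially. vnorm (ev k f - b k) \<le> \<epsilon>)"
    by (intro exI[of _ "\<lambda>k. ev k g"]) (auto intro: always_eventually)
qed

text \<open>The gap between the relative error \<rho>^(1/2) of \<open>approximate_monomial\<close>
  and \<rho>^(1/4) leaves room for replacing the norm at the k-th point by its limit.\<close>

definition contraction :: real where
  "contraction = \<rho> powr (1 / 4)"

lemma contraction: "0 < contraction" "contraction < 1"
  using \<rho> powr_less_mono'[of \<rho> 0 "1 / 4"] by (auto simp: contraction_def)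

lemma approximate_monomial_limit:
  assumes i: "i \<in> p_rationals p"
  obtains a where "value_seq (loss * \<rho> powr (\<theta> * real_of_rat i)) a"
    "\<forall>\<^sub>F k in sequentially. vnorm (pw (r k * i) - a k) \<le> contraction * \<rho> powr (\<theta> * real_of_rat i)"
proof -
  obtain a where a: "value_seq (loss * \<rho> powr (\<theta> * real_of_rat i)) a"
    "\<forall>\<^sub>F k in sequentially. vnorm (a k - pw (r k * i)) \<le> \<rho> powr (1 / 2) * vnorm (pw (r k * i))"
    using approximate_monomial[OF i] .
  have "(\<lambda>k. \<rho> powr (1 / 2) * vnorm (pw (r k * i))) \<longlonglongrightarrow> \<rho> powr (1 / 2) * \<rho> powr (\<theta> * real_of_rat i)"
    by (intro tendsto_mult_left tendsto_vnorm_pw_r i)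
  moreover have "\<rho> powr (1 / 2) * \<rho> powr (\<theta> * real_of_rat i) < contraction * \<rho> powr (\<theta> * real_of_rat i)"
    using \<rho> by (auto simp: contraction_def intro!: mult_strict_right_mono powr_less_mono')
  ultimately have "\<forall>\<^sub>F k in sequentially. \<rho> powr (1 / 2) * vnorm (pw (r k * i)) < contraction * \<rho> powr (\<theta> * real_of_rat i)"
    by (rule order_tendstoD(2))
  with a(2) have "\<forall>\<^sub>F k in sequentially. vnorm (pw (r k * i) - a k) \<le> contraction * \<rho> powr (\<theta> * real_of_rat i)"
    by eventually_elim (simp add: vnorm_minus_commute)
  then show ?thesis
    using that a(1) by blast
qed

text \<open>Approximate by a Laurent polynomial and replace each monomial by the sequence from
  \<open>approximate_monomial_limit\<close>. The coefficient bound keeps both the Gauss norms and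
  the errors of the summands under control; the ultrametric inequality lets the number of summands
  drop out.\<close>

lemma approximation_step:
  assumes a: "approximable a" "\<forall>\<^sub>F k in sequentially. vnorm (a k) \<le> s" and s: "s > 0"
  obtains b where "value_seq (loss * s) b" "\<forall>\<^sub>F k in sequentially. vnorm (a k - b k) \<le> contraction * s"
proof -
  have cs: "contraction * s > 0" "contraction * s \<le> s"
    using contraction s by (auto simp: mult_left_le_one_le)
  obtain g where g: "laurent g" "\<forall>\<^sub>F k in sequentially. vnorm (a k - g k) \<le> contraction * s"
    using a(1) cs(1) unfolding approximable_def by blast
  have "\<forall>\<^sub>F k in sequentially. vnorm (g k) \<le> s"
    using a(2) g(2)
  proof eventually_elim
    case (elim k)
    then show ?case
      using vnorm_diff_le[of "a k" s "a k - g k"] cs(2) by simp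
  qed
  moreover obtain F c where F: "finite F" "F \<subseteq> p_rationals p" "\<And>k. g k = (\<Sum>i\<in>F. c i * pw (r k * i))"
    using g(1) unfolding laurent_def by blast
  ultimately have coeff: "vnorm (c i) * \<rho> powr (\<theta> * real_of_rat i) \<le> s" if "i \<in> F" for i
    using laurent_coeff_bound[OF F(1,2) that] by simp
  have "\<forall>i\<in>F. \<exists>b. value_seq (loss * \<rho> powr (\<theta> * real_of_rat i)) b \<and>
      (\<forall>\<^sub>F k in sequentially. vnorm (pw (r k * i) - b k) \<le> contraction * \<rho> powr (\<theta> * real_of_rat i))"
    using approximate_monomial_limit F(2) by blast
  then have "\<exists>b. \<forall>i\<in>F. value_seq (loss * \<rho> powr (\<theta> * real_of_rat i)) (b i) \<and>
      (\<forall>\<^sub>F k in sequentially. vnorm (pw (r k * i) - b i k) \<le> contraction * \<rho> powr (\<theta> * real_of_rat i))"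
    by (rule bchoice)
  then obtain b where b: "\<And>i. i \<in> F \<Longrightarrow> value_seq (loss * \<rho> powr (\<theta> * real_of_rat i)) (b i)"
    "\<And>i. i \<in> F \<Longrightarrow> \<forall>\<^sub>F k in sequentially. vnorm (pw (r k * i) - b i k) \<le> contraction * \<rho> powr (\<theta> * real_of_rat i)"
    by blast
  define B where "B k = (\<Sum>i\<in>F. c i * b i k)" for k
  have "value_seq (loss * s) (\<lambda>k. c i * b i k)" if "i \<in> F" for i
  proof (rule value_seq_mono[OF value_seq_cmult[OF b(1)[OF that]]])
    show "vnorm (c i) * (loss * \<rho> powr (\<theta> * real_of_rat i)) \<le> loss * s"
      using mult_left_mono[OF coeff[OF that] less_imp_le[OF loss_gt_0]] by (simp add: mult_ac)
  qed
  then have 1: "value_seq (loss * s) B"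
    unfolding B_def[abs_def] using loss_gt_0 s by (intro value_seq_sum) auto
  have "\<forall>\<^sub>F k in sequentially. \<forall>i\<in>F. vnorm (pw (r k * i) - b i k) \<le> contraction * \<rho> powr (\<theta> * real_of_rat i)"
    using b(2) by (intro eventually_ball_finite F(1)) auto
  then have 2: "\<forall>\<^sub>F k in sequentially. vnorm (a k - B k) \<le> contraction * s"
    using g(2)
  proof eventually_elim
    case (elim k)
    have "vnorm (c i * (pw (r k * i) - b i k)) \<le> contraction * s" if i: "i \<in> F" for i
    proof -
      have "vnorm (c i * (pw (r k * i) - b i k)) \<le> vnorm (c i) * (contraction * \<rho> powr (\<theta> * real_of_rat i))"
        using elim(1) i by (intro vnorm_mult_le) auto
      also have "\<dots> \<le> contraction * s"
        using mult_left_mono[OF coeff[OF i] less_imp_le[OF contraction(1)]] by (simp add: mult_ac)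
      finally show ?thesis .
    qed
    then have "vnorm (\<Sum>i\<in>F. c i * (pw (r k * i) - b i k)) \<le> contraction * s"
      using cs(1) by (intro vnorm_sum_le) auto
    moreover have "(\<Sum>i\<in>F. c i * (pw (r k * i) - b i k)) = g k - B k"
      by (simp add: F(3) B_def right_diff_distrib sum_subtractf)
    ultimately show ?case
      using vnorm_add_le[OF elim(2), of "g k - B k"] by simp
  qed
  show ?thesis
    using that 1 2 by blast
qed

text \<open>Iterating \<open>approximation_step\<close> on the remainders. The corrections decrease
  geometrically in Gauss norm, so their sum exists and, by the ultrametric inequality, is bounded by
  the first bound \<open>loss * s\<close>.\<close>

lemma approximable_limit_of_ev:
  assumes a: "approximable a" "\<forall>\<^sub>F k in sequentially. vnorm (a k) \<le> s" and s: "s > 0"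
  obtains f where "f \<in> carrier R" "\<And>e. vnorm (f e) \<le> loss * s" "(\<lambda>k. a k - ev k f) \<longlonglongrightarrow> 0"
proof -
  \<comment> \<open>The clause for h = 0 fixes the start at the zero series, so that the Gauss norm
    bound can be read off as the distance to \<open>F 0\<close>.\<close>
  define good where "good h f \<longleftrightarrow> f \<in> carrier R \<and> (h = 0 \<longrightarrow> f = (\<lambda>e. 0)) \<and>
      (\<forall>\<^sub>F k in sequentially. vnorm (a k - ev k f) \<le> s * contraction ^ h)" for h :: nat and f
  have ev_0: "ev k (\<lambda>e. 0) = 0" for k
    by (simp add: evaluate_def)
  have "\<exists>F. \<forall>h. good h (F h) \<and> (\<forall>e. vnorm (F (Suc h) e - F h e) \<le> loss * s * contraction ^ h)"
  proof (rule dependent_nat_choice)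
    show "\<exists>f. good 0 f"
      using a(2) by (intro exI[of _ "\<lambda>e. 0"]) (simp add: good_def tate_zero_closed ev_0)
    fix f h assume f: "good h f"
    then have fR: "f \<in> carrier R"
      by (simp add: good_def)
    have "approximable (\<lambda>k. a k + (- 1) * ev k f)"
      by (intro approximable_add a(1) approximable_cmult approximable_ev fR)
    then have appr: "approximable (\<lambda>k. a k - ev k f)"
      by simp
    obtain b where b: "value_seq (loss * (s * contraction ^ h)) b"
      "\<forall>\<^sub>F k in sequentially. vnorm (a k - ev k f - b k) \<le> contraction * (s * contraction ^ h)"
      using approximation_step[OF appr, of "s * contraction ^ h"] f s contraction(1) by (auto simp: good_def)
    obtain g where g: "g \<in> carrier R" "\<And>e. vnorm (g e) \<le> loss * (s * contraction ^ h)" "\<And>k. b k = ev k g"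
      using b(1) unfolding value_seq_def by blast
    have "good (Suc h) (\<lambda>e. f e + g e)"
      using b(2) fR g(1) by (simp add: good_def tate_add_closed ev_add g(3) algebra_simps)
    moreover have "vnorm ((f e + g e) - f e) \<le> loss * s * contraction ^ h" for e
      using g(2)[of e] by (simp add: mult_ac)
    ultimately show "\<exists>f'. good (Suc h) f' \<and> (\<forall>e. vnorm (f' e - f e) \<le> loss * s * contraction ^ h)"
      by (intro exI[of _ "\<lambda>e. f e + g e"]) blast
  qed
  then obtain F where F: "\<And>h. good h (F h)" "\<And>h e. vnorm (F (Suc h) e - F h e) \<le> loss * s * contraction ^ h"
    by blast
  have FR: "F h \<in> carrier R" for h
    using F(1) by (simp add: good_def)
  obtain f where f: "f \<in> carrier R" "\<And>h e. vnorm (f e - F h e) \<le> loss * s * contraction ^ h"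
    using tate_complete[OF FR F(2)] contraction by (metis less_imp_le)
  have "F 0 = (\<lambda>e. 0)"
    using F(1)[of 0] by (simp add: good_def)
  then have bound: "vnorm (f e) \<le> loss * s" for e
    using f(2)[of e 0] by simp
  define C where "C = max 1 loss * s"
  have C: "s \<le> C" "loss * s \<le> C"
    using s by (simp_all add: C_def)
  have ev_near: "\<forall>\<^sub>F k in sequentially. vnorm (a k - ev k f) \<le> C * contraction ^ h" for h
  proof -
    have "\<forall>\<^sub>F k in sequentially. vnorm (a k - ev k (F h)) \<le> s * contraction ^ h"
      using F(1) by (simp add: good_def)
    then show ?thesis
    proof eventually_elim
      case (elim k)
      have "vnorm (ev k f - ev k (F h)) \<le> loss * s * contraction ^ h"
        unfolding ev_diff[OF f(1) FR, symmetric] by (intro vnorm_ev_le tate_diff_closed f FR)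
      moreover have "loss * s * contraction ^ h \<le> C * contraction ^ h" "s * contraction ^ h \<le> C * contraction ^ h"
        using C contraction(1) by (auto intro!: mult_right_mono)
      ultimately have "vnorm ((a k - ev k (F h)) - (ev k f - ev k (F h))) \<le> C * contraction ^ h"
        using elim by (intro vnorm_diff_le[of "a k - ev k (F h)"]) linarith+
      then show ?case
        by simp
    qed
  qed
  have "(\<lambda>k. a k - ev k f) \<longlonglongrightarrow> 0"
  proof (rule tendstoI)
    fix \<epsilon> :: real assume \<epsilon>: "\<epsilon> > 0"
    have "C > 0"
      using C s by linarith
    then obtain h where "contraction ^ h < \<epsilon> / C"
      using real_arch_pow_inv[of "\<epsilon> / C" contraction] \<epsilon> contraction by auto
    then have "C * contraction ^ h < \<epsilon>"
      using \<open>C > 0\<close> by (simp add: field_simps)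
    then show "\<forall>\<^sub>F k in sequentially. dist (a k - ev k f) 0 < \<epsilon>"
      using ev_near[of h] by (auto elim!: eventually_mono simp: dist_vnorm)
  qed
  then show ?thesis
    using that f(1) bound by blast
qed

text \<open>The factor 2 only makes room for an eventual upper bound on a sequence that converges to
  \<rho>^(\<theta> i).\<close>

lemma limit_of_monomial:
  obtains f where "f \<in> carrier R" "\<And>e. vnorm (f e) \<le> 2 * loss * \<rho> powr (\<theta> * real_of_int i)"
    "(\<lambda>k. pw (r k * of_int i) - ev k f) \<longlonglongrightarrow> 0"
proof -
  have i: "of_int i \<in> p_rationals p"
    by (rule p_rationals_of_int)
  have pos: "\<rho> powr (\<theta> * real_of_int i) > 0"
    using \<rho> by simp
  have "(\<lambda>k. vnorm (pw (r k * of_int i))) \<longlonglongrightarrow> \<rho> powr (\<theta> * real_of_int i)"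
    using tendsto_vnorm_pw_r[OF i] by simp
  then have "\<forall>\<^sub>F k in sequentially. vnorm (pw (r k * of_int i)) < 2 * \<rho> powr (\<theta> * real_of_int i)"
    using pos by (intro order_tendstoD(2)) auto
  then have "\<forall>\<^sub>F k in sequentially. vnorm (pw (r k * of_int i)) \<le> 2 * \<rho> powr (\<theta> * real_of_int i)"
    by eventually_elim simp
  moreover have "approximable (\<lambda>k. pw (r k * of_int i))"
    using approximable_laurent[OF laurent_monomial[OF i, of 1]] by simp
  ultimately show ?thesis
    using approximable_limit_of_ev[of "\<lambda>k. pw (r k * of_int i)" "2 * \<rho> powr (\<theta> * real_of_int i)"] pos that
    by (auto simp: mult_ac)
qed

section \<open>The ideal of series vanishing in the limit, and its characters\<close>

definition vanishing :: "((nat \<Rightarrow>\<^sub>0 rat) \<Rightarrow> 'c) set" where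
  "vanishing = {f \<in> carrier R. (\<lambda>k. ev k f) \<longlonglongrightarrow> 0}"

lemma ev_bounded_mult_null:
  assumes f: "f \<in> carrier R" and b: "b \<longlonglongrightarrow> 0"
  shows "(\<lambda>k. ev k f * b k) \<longlonglongrightarrow> 0"
proof (rule tendstoI)
  fix \<epsilon> :: real assume \<epsilon>: "\<epsilon> > 0"
  obtain B where B: "B > 0" "\<And>e. vnorm (f e) \<le> B"
    using null_family_bounded[of f] f by (auto simp: tate_carrier)
  have "\<epsilon> / B > 0"
    using \<epsilon> B(1) by simp
  then have "\<forall>\<^sub>F k in sequentially. dist (b k) 0 < \<epsilon> / B"
    by (rule tendstoD[OF b])
  then show "\<forall>\<^sub>F k in sequentially. dist (ev k f * b k) 0 < \<epsilon>"
  proof eventually_elim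
    case (elim k)
    have "vnorm (ev k f * b k) \<le> B * vnorm (b k)"
      by (intro vnorm_mult_le vnorm_ev_le f B) simp
    also have "\<dots> < \<epsilon>"
      using elim B(1) by (simp add: dist_vnorm field_simps)
    finally show ?case
      by (simp add: dist_vnorm)
  qed
qed

lemma ideal_vanishing: "ideal vanishing R"
proof -
  interpret cring R
    by (rule cring_tate)
  show ?thesis
  proof (rule idealI)
    show "ring R"
      by (rule ring_axioms)
    show "subgroup vanishing (add_monoid R)"
    proof (rule add.subgroupI)
      show "vanishing \<subseteq> carrier R"
        by (auto simp: vanishing_def)
      show "vanishing \<noteq> {}"
        using tate_zero_closed by (auto simp: vanishing_def evaluate_def intro!: exI[of _ "\<lambda>e. 0"])
      show "\<ominus>\<^bsub>R\<^esub> f \<in> vanishing" if "f \<in> vanishing" for f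
        using that tendsto_minus[of "\<lambda>k. ev k f" 0 sequentially]
        by (auto simp: vanishing_def tate_a_inv tate_minus_closed ev_minus)
      show "f \<oplus>\<^bsub>R\<^esub> g \<in> vanishing" if "f \<in> vanishing" "g \<in> vanishing" for f g
        using that tendsto_add[of "\<lambda>k. ev k f" 0 sequentially "\<lambda>k. ev k g" 0]
        by (auto simp: vanishing_def tate_add tate_add_closed ev_add)
    qed
    show left: "g \<otimes>\<^bsub>R\<^esub> f \<in> vanishing" if "f \<in> vanishing" "g \<in> carrier R" for f g
      using that ev_bounded_mult_null[of g "\<lambda>k. ev k f"] by (auto simp: vanishing_def ev_mult)
    show "f \<otimes>\<^bsub>R\<^esub> g \<in> vanishing" if "f \<in> vanishing" "g \<in> carrier R" for f g
      using left[OF that] that by (simp add: m_comm vanishing_def)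
  qed
qed

lemma ev_one: "ev k \<one>\<^bsub>R\<^esub> = 1"
  by (simp add: tate_one evaluate_monomial point_0)

lemma one_not_vanishing: "\<one>\<^bsub>R\<^esub> \<notin> vanishing"
  by (auto simp: vanishing_def ev_one LIMSEQ_const_iff)

text \<open>A series \<open>Y i\<close> stands for x^i for every integer i. At the points
  \<open>Y (i + j)\<close> and the product of \<open>Y i\<close> and \<open>Y j\<close> have the
  same limiting behaviour, so they differ by an element of \<open>vanishing\<close>, which \<Psi>
  kills. Hence the values \<open>c i\<close> = \<Psi> (Y i) are multiplicative in i.\<close>

lemma value_group_if_nullstellensatz_pair:
  assumes "nullstellensatz_pair (ring_of_type_algebra :: 'c ring) R"
  shows "\<rho> powr \<theta> \<in> value_group TYPE('c)"
proof -
  interpret cring R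
    by (rule cring_tate)
  obtain \<Psi> where add: "\<And>f g. f \<in> carrier R \<Longrightarrow> g \<in> carrier R \<Longrightarrow> \<Psi> (f \<oplus>\<^bsub>R\<^esub> g) = \<Psi> f + \<Psi> g"
    and mult: "\<And>f g. f \<in> carrier R \<Longrightarrow> g \<in> carrier R \<Longrightarrow> \<Psi> (f \<otimes>\<^bsub>R\<^esub> g) = \<Psi> f * \<Psi> g"
    and one: "\<Psi> \<one>\<^bsub>R\<^esub> = (1 :: 'c)" and zero: "\<And>f. f \<in> vanishing \<Longrightarrow> \<Psi> f = 0"
    and le: "\<And>f s. f \<in> carrier R \<Longrightarrow> (\<And>e. vnorm (f e) \<le> s) \<Longrightarrow> vnorm (\<Psi> f) \<le> s"
  proof (rule character_of_nullstellensatz_pair[OF assms ideal_vanishing one_not_vanishing], goal_cases)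
    case (1 \<Psi>)
    show thesis
      by (rule that[of \<Psi>]) (fact 1)+
  qed
  have eq: "\<Psi> f = \<Psi> g" if fg: "f \<in> carrier R" "g \<in> carrier R" "(\<lambda>k. ev k f - ev k g) \<longlonglongrightarrow> 0" for f g
  proof -
    define d where "d e = f e - g e" for e
    have d: "d \<in> carrier R" "f = d \<oplus>\<^bsub>R\<^esub> g"
      using fg tate_diff_closed[of f n g] by (simp_all add: d_def[abs_def] tate_add)
    have "d \<in> vanishing"
      using fg d(1) ev_diff[OF fg(1,2)] by (simp add: vanishing_def d_def[abs_def])
    then show ?thesis
      using add[OF d(1) fg(2)] zero[of d] d(2) by simp
  qed
  have "\<exists>f. f \<in> carrier R \<and> (\<forall>e. vnorm (f e) \<le> 2 * loss * \<rho> powr (\<theta> * real_of_int i)) \<and>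
      (\<lambda>k. pw (r k * of_int i) - ev k f) \<longlonglongrightarrow> 0" for i
  proof (rule limit_of_monomial[of i], goal_cases)
    case (1 f)
    then show ?case
      by (intro exI[of _ f] conjI allI)
  qed
  then have "\<exists>Y. \<forall>i. Y i \<in> carrier R \<and> (\<forall>e. vnorm (Y i e) \<le> 2 * loss * \<rho> powr (\<theta> * real_of_int i)) \<and>
      (\<lambda>k. pw (r k * of_int i) - ev k (Y i)) \<longlonglongrightarrow> 0"
    by (intro choice allI)
  then obtain Y where Y: "\<And>i. Y i \<in> carrier R"
    "\<And>i e. vnorm (Y i e) \<le> 2 * loss * \<rho> powr (\<theta> * real_of_int i)"
    "\<And>i. (\<lambda>k. pw (r k * of_int i) - ev k (Y i)) \<longlonglongrightarrow> 0"
    by blast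
  define c where "c i = \<Psi> (Y i)" for i
  have c_le: "vnorm (c i) \<le> 2 * loss * \<rho> powr (\<theta> * real_of_int i)" for i
    unfolding c_def by (intro le Y)
  have c_0: "c 0 = 1"
  proof -
    have "(\<lambda>k. ev k \<one>\<^bsub>R\<^esub> - ev k (Y 0)) \<longlonglongrightarrow> 0"
      using Y(3)[of 0] by (simp add: ev_one pw_0)
    then show ?thesis
      using eq[OF one_closed Y(1)] by (simp add: c_def one)
  qed
  have c_add: "c (i + j) = c i * c j" for i j
  proof -
    define u where "u i k = pw (r k * of_int i) - ev k (Y i)" for i k
    have u: "u i \<longlonglongrightarrow> 0" for i
      using Y(3) by (simp add: u_def[abs_def])
    have "ev k (Y (i + j)) - ev k (Y i \<otimes>\<^bsub>R\<^esub> Y j)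
        = (ev k (Y i) * u j k + ev k (Y j) * u i k + u i k * u j k) - u (i + j) k" for k
    proof -
      have "pw (r k * of_int (i + j)) = pw (r k * of_int i) * pw (r k * of_int j)"
        unfolding of_int_add distrib_left by (intro pw_add p_rationals_mult r(1) p_rationals_of_int)
      then show ?thesis
        using ev_mult[OF Y(1)[of i] Y(1)[of j], of k] by (simp add: u_def algebra_simps)
    qed
    moreover have "(\<lambda>k. (ev k (Y i) * u j k + ev k (Y j) * u i k + u i k * u j k) - u (i + j) k) \<longlonglongrightarrow> (0 + 0 + 0 * 0) - 0"
      by (intro tendsto_diff tendsto_add tendsto_mult ev_bounded_mult_null Y(1) u)
    ultimately have "(\<lambda>k. ev k (Y (i + j)) - ev k (Y i \<otimes>\<^bsub>R\<^esub> Y j)) \<longlonglongrightarrow> 0"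
      by simp
    then have "\<Psi> (Y (i + j)) = \<Psi> (Y i \<otimes>\<^bsub>R\<^esub> Y j)"
      by (intro eq Y(1) m_closed)
    then show ?thesis
      using mult[OF Y(1) Y(1)] by (simp add: c_def)
  qed
  define \<gamma> where "\<gamma> = \<rho> powr \<theta>"
  have \<gamma>: "\<gamma> > 0"
    using \<rho> by (simp add: \<gamma>_def)
  have power_le: "vnorm (c i) ^ m \<le> 2 * loss * (\<rho> powr (\<theta> * real_of_int i)) ^ m" for i m
  proof -
    have "c (int m * i) = c i ^ m"
      by (induction m) (simp_all add: c_0 distrib_right c_add)
    then have "vnorm (c i) ^ m \<le> 2 * loss * \<rho> powr (\<theta> * real_of_int (int m * i))"
      using c_le[of "int m * i"] by (simp add: vnorm_power)
    also have "\<rho> powr (\<theta> * real_of_int (int m * i)) = (\<rho> powr (\<theta> * real_of_int i)) ^ m"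
      using \<rho> by (simp add: powr_realpow[symmetric] powr_powr mult_ac)
    finally show ?thesis .
  qed
  \<comment> \<open>If x exceeded y, the powers of x / y would outgrow the constant. This removes
    \<open>2 * loss\<close> from the bound on \<open>c i\<close>.\<close>
  have le_if_powers_le: "x \<le> y" if "\<And>m. x ^ m \<le> B * y ^ m" "0 < y" "0 < B" for x y B :: real
  proof (rule ccontr)
    assume "\<not> x \<le> y"
    then have "x / y > 1"
      using that by simp
    then obtain m where "B < (x / y) ^ m"
      using real_arch_pow by blast
    then show False
      using that(1)[of m] that(2) by (simp add: power_divide pos_less_divide_eq)
  qed
  have 1: "vnorm (c i) \<le> \<rho> powr (\<theta> * real_of_int i)" for i
  proof (rule le_if_powers_le)
    show "vnorm (c i) ^ m \<le> 2 * loss * (\<rho> powr (\<theta> * real_of_int i)) ^ m" for m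
      by (rule power_le)
  qed (use \<rho> loss_gt_0 in auto)
  \<comment> \<open>The upper bound on |c (-1)| becomes the lower bound \<gamma> \<le> |c 1|; this
    is the use of negative powers.\<close>
  have "c 1 * c (- 1) = 1"
    using c_add[of 1 "- 1"] c_0 by simp
  then have nz: "c 1 \<noteq> 0" and prod: "vnorm (c 1) * vnorm (c (- 1)) = 1"
    by (auto simp flip: vnorm_mult)
  have "vnorm (c (- 1)) \<le> inverse \<gamma>"
    using 1[of "- 1"] by (simp add: \<gamma>_def powr_minus)
  then have "1 \<le> vnorm (c 1) * inverse \<gamma>"
    unfolding prod[symmetric] by (intro mult_left_mono) auto
  then have "\<gamma> \<le> vnorm (c 1)"
    using \<gamma> by (simp add: field_simps)
  moreover have "vnorm (c 1) \<le> \<gamma>"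
    using 1[of 1] by (simp add: \<gamma>_def)
  ultimately have "vnorm (c 1) = \<gamma>"
    by simp
  then show ?thesis
    using nz unfolding value_group_def \<gamma>_def by (auto intro!: image_eqI[of _ _ "c 1"])
qed

end

theorem theorem1p6:
  fixes n :: nat
  assumes "n \<ge> 2"
    and "value_group TYPE('c::perfectoid_field) \<subset> {0<..}"
  shows "\<not> nullstellensatz_pair (ring_of_type_algebra :: 'c ring)
           (perfectoid_tate_algebra n :: ('c, (nat \<Rightarrow>\<^sub>0 rat) \<Rightarrow> 'c) module)"
proof
  assume pair: "nullstellensatz_pair (ring_of_type_algebra :: 'c ring)
           (perfectoid_tate_algebra n :: ('c, (nat \<Rightarrow>\<^sub>0 rat) \<Rightarrow> 'c) module)"
  define p where "p = residue_char TYPE('c)"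
  have prime: "Factorial_Ring.prime p"
    unfolding p_def by (rule prime_residue_char)
  \<comment> \<open>The value group contains 1 and is closed under inverses, so a missing positive
    number may be taken below 1.\<close>
  obtain \<gamma> where \<gamma>: "0 < \<gamma>" "\<gamma> < 1" "\<gamma> \<notin> value_group TYPE('c)"
  proof -
    obtain g where g: "g > 0" "g \<notin> value_group TYPE('c)"
      using assms(2) by auto
    have "1 \<in> value_group TYPE('c)"
      unfolding value_group_def by (rule image_eqI[of _ _ 1]) auto
    then have "g \<noteq> 1"
      using g(2) by auto
    have "inverse g \<notin> value_group TYPE('c)"
    proof
      assume "inverse g \<in> value_group TYPE('c)"
      then obtain c :: 'c where "c \<noteq> 0" "inverse g = vnorm c"
        unfolding value_group_def by blast
      then have "inverse c \<noteq> 0" "g = vnorm (inverse c)"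
        by (simp_all add: vnorm_inverse flip: \<open>inverse g = vnorm c\<close>)
      then show False
        using g(2) unfolding value_group_def by blast
    qed
    then show ?thesis
      using that[of g] that[of "inverse g"] g \<open>g \<noteq> 1\<close>
      by (cases "g < 1") (auto simp: inverse_less_1_iff)
  qed
  obtain \<beta> :: "nat \<Rightarrow> 'c" where \<beta>: "\<And>m. \<beta> (Suc m) ^ p = \<beta> m" "\<beta> 0 \<noteq> 0"
    "vnorm (of_nat p :: 'c) \<le> vnorm (\<beta> 0)" "vnorm (\<beta> 0) < 1"
    unfolding p_def using exists_pseudo_uniformizer_roots[where 'c = 'c] by blast
  define \<rho> where "\<rho> = vnorm (\<beta> 0)"
  have \<rho>: "0 < \<rho>" "\<rho> < 1" "vnorm (of_nat p :: 'c) \<le> \<rho>"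
    using \<beta> by (auto simp: \<rho>_def)
  obtain pw :: "rat \<Rightarrow> 'c" where pw_add: "\<And>a b. a \<in> p_rationals p \<Longrightarrow> b \<in> p_rationals p \<Longrightarrow> pw (a + b) = pw a * pw b"
    and vnorm_pw: "\<And>a. a \<in> p_rationals p \<Longrightarrow> vnorm (pw a) = \<rho> powr real_of_rat a"
    unfolding \<rho>_def using powr_system[OF prime, of \<beta>, OF \<beta>(1,2)] by blast
  define \<theta> where "\<theta> = ln \<gamma> / ln \<rho>"
  have \<theta>: "\<theta> > 0" and powr_\<theta>: "\<rho> powr \<theta> = \<gamma>"
    using \<gamma> \<rho> by (auto simp: \<theta>_def powr_def divide_neg_neg)
  \<comment> \<open>Exponents in Z[1/p] yield values of C, so \<theta> is not one of them. This
    makes \<theta> < r k strict, which keeps the norms of distinct Laurent terms apart.\<close>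
  have \<theta>_neq: "real_of_rat a \<noteq> \<theta>" if "a \<in> p_rationals p" for a
  proof
    assume "real_of_rat a = \<theta>"
    then have "vnorm (pw a) = \<gamma>"
      using vnorm_pw[OF that] powr_\<theta> by simp
    then show False
      using \<gamma> unfolding value_group_def by (metis DiffI UNIV_I imageI less_irrefl singletonD vnorm_zero)
  qed
  obtain N Q :: "nat \<Rightarrow> int" and M S L :: "nat \<Rightarrow> nat" where
    valuation_ge: "\<And>l. 2 \<le> Q l + \<theta> * N l"
    and S: "\<And>j l. j < l \<Longrightarrow> 0 \<le> int (S l) + N j"
    and L: "\<And>j l. j < l \<Longrightarrow> 0 \<le> int (L l) + Q j"
    and slope: "\<And>l. real l * (L l + \<theta> * S l + (Q l + \<theta> * N l)) \<le> \<bar>real (S l) + N l\<bar>"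
    and sign: "\<And>l. if even l then int (S l) + N l > 0 else int (S l) + N l < 0"
    and M: "\<And>l. \<bar>real (S l) + N l\<bar> \<le> real p ^ M l" "\<And>l. 2 * (Q l + \<theta> * N l + 1) \<le> real p ^ M l"
    and gap: "\<And>j l. j < l \<Longrightarrow> Q j + \<theta> * N j + 2 + real p ^ M j / 2 \<le> Q l + \<theta> * N l"
  proof (rule exists_parameters[OF \<theta> prime_gt_1_nat[OF prime]], goal_cases)
    case (1 N Q M S L)
    show thesis
      by (rule that[of Q N S L M]) (fact 1)+
  qed
  \<comment> \<open>The factor k + 1 forces r k \<rightarrow> \<theta>; the other factor keeps |N j|
    (r k - \<theta>) \<le> 1 for all j < k.\<close>
  define \<epsilon> where "\<epsilon> k = 1 / (real (Suc k) * (1 + (\<Sum>j<k. \<bar>real_of_int (N j)\<bar>)))" for k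
  have sum_pos: "0 < 1 + (\<Sum>j<k. \<bar>real_of_int (N j)\<bar>)" for k
    by (intro add_pos_nonneg sum_nonneg) auto
  have \<epsilon>_pos: "\<epsilon> k > 0" for k
    unfolding \<epsilon>_def using sum_pos by simp
  have "\<exists>q. q \<in> p_rationals p \<and> \<theta> \<le> real_of_rat q \<and> real_of_rat q < \<theta> + \<epsilon> k" for k
    using p_rationals_dense[OF prime \<epsilon>_pos] by metis
  then obtain r where r: "\<And>k. r k \<in> p_rationals p" "\<And>k. \<theta> \<le> real_of_rat (r k)" "\<And>k. real_of_rat (r k) < \<theta> + \<epsilon> k"
    by metis
  have r_gt: "\<theta> < real_of_rat (r k)" for k
    using r(2)[of k] \<theta>_neq[OF r(1)[of k]] by simp
  have \<epsilon>_le: "\<epsilon> k \<le> 1 / real (Suc k)" for k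
    unfolding \<epsilon>_def using sum_nonneg[of "{..<k}" "\<lambda>j. \<bar>real_of_int (N j)\<bar>"]
    by (intro divide_left_mono mult_pos_pos sum_pos) (auto intro: mult_left_mono[of 1, simplified])
  have r_lim: "(\<lambda>k. real_of_rat (r k)) \<longlonglongrightarrow> \<theta>"
  proof (rule tendsto_sandwich[of "\<lambda>_. \<theta>"])
    show "(\<lambda>k. \<theta> + 1 / real (Suc k)) \<longlonglongrightarrow> \<theta>"
      using tendsto_add[OF tendsto_const LIMSEQ_inverse_real_of_nat, of \<theta>] by (simp add: inverse_eq_divide)
    show "\<forall>\<^sub>F k in sequentially. real_of_rat (r k) \<le> \<theta> + 1 / real (Suc k)"
      using r(3) \<epsilon>_le by (intro always_eventually allI) (meson add_left_mono less_imp_le order_trans)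
  qed (use r(2) in auto)
  have r_near: "\<bar>N j * real_of_rat (r k) - N j * \<theta>\<bar> \<le> 1" if "j < k" for j k
  proof -
    have "\<bar>N j * real_of_rat (r k) - N j * \<theta>\<bar> = \<bar>real_of_int (N j)\<bar> * (real_of_rat (r k) - \<theta>)"
      using r(2)[of k] by (simp add: right_diff_distrib[symmetric] abs_mult)
    also have "\<dots> \<le> \<bar>real_of_int (N j)\<bar> * \<epsilon> k"
      using r(3)[of k] by (intro mult_left_mono) auto
    also have "\<dots> \<le> (1 + (\<Sum>j<k. \<bar>real_of_int (N j)\<bar>)) * \<epsilon> k"
      using member_le_sum[of j "{..<k}" "\<lambda>j. \<bar>real_of_int (N j)\<bar>"] that \<epsilon>_pos[of k]
      by (intro mult_right_mono) auto
    also have "\<dots> = 1 / real (Suc k)"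
      using sum_pos[of k] by (simp add: \<epsilon>_def)
    also have "\<dots> \<le> 1"
      by simp
    finally show ?thesis .
  qed
  define good where "good k V \<longleftrightarrow> (\<forall>a\<in>p_nonneg p. \<forall>b\<in>p_nonneg p. V (a + b) = V a * V b) \<and>
      (\<forall>a\<in>p_nonneg p. vnorm (V a) \<le> 1) \<and>
      (\<forall>m. vnorm (V (1 / of_nat p ^ m) - (\<Sum>j<k. pw ((of_int (Q j) + of_int (N j) * r k) / of_nat p ^ m)))
        \<le> vnorm (of_nat p :: 'c)) \<and> V 0 = 1" for k and V :: "rat \<Rightarrow> 'c"
  have "\<exists>V. good k V" for k
  proof -
    define x where "x j m = (of_int (Q j) + of_int (N j) * r k) / of_nat p ^ m" for j m
    \<comment> \<open>The sums of p^m-th roots are compatible only modulo p;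
      \<open>lift_power_roots\<close> turns them into an exact system close to them, the roots of
      the second coordinate.\<close>
    define b where "b m = (\<Sum>j<k. pw (x j m))" for m
    have x_mem: "x j m \<in> p_rationals p" for j m
      unfolding x_def using p_rationals_mult[OF _ p_rationals_inverse_power, of _ p m]
      by (simp add: p_rationals_add[OF prime] p_rationals_mult p_rationals_of_int r(1))
    \<comment> \<open>\<open>valuation_ge\<close> provides 2, of which \<open>r_near\<close> takes
      away at most 1.\<close>
    have x_nonneg: "0 \<le> x j m" if "j < k" for j m
    proof -
      have "0 \<le> real_of_rat (of_int (Q j) + of_int (N j) * r k)"
        using r_near[OF that] valuation_ge[of j] by (simp add: of_rat_add of_rat_mult mult.commute abs_le_iff)
      then show ?thesis
        unfolding x_def by (intro divide_nonneg_nonneg) simp_all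
    qed
    have pw_le: "vnorm (pw (x j m)) \<le> 1" if "j < k" for j m
      using x_nonneg[OF that] \<rho> by (simp add: vnorm_pw x_mem powr_le1)
    have pw_root: "pw (x j (Suc m)) ^ p = pw (x j m)" for j m
    proof -
      have "pw 0 \<noteq> 0"
        using vnorm_pw[of 0] p_rationals_of_int[of 0 p] \<rho>(1) by auto
      then have "pw (x j (Suc m)) ^ p = pw (x j (Suc m) * of_nat p)"
        using multiplicative_power[OF prime pw_add _ x_mem] by simp
      then show ?thesis
        using prime_gt_0_nat[OF prime] by (simp add: x_def)
    qed
    have b_le: "vnorm (b m) \<le> 1" for m
      unfolding b_def using pw_le by (intro vnorm_sum_le) auto
    have b_root: "vnorm (b (Suc m) ^ p - b m) \<le> vnorm (of_nat p :: 'c)" for m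
      using vnorm_sum_power_defect[OF prime, of "{..<k}" "\<lambda>j. pw (x j (Suc m))"] pw_le
      by (simp add: b_def pw_root)
    have less: "vnorm (of_nat p :: 'c) < 1"
      using \<rho> by simp
    obtain v where v: "\<And>m. v (Suc m) ^ p = v m" "\<And>m. vnorm (v m - b m) \<le> vnorm (of_nat p :: 'c)" "\<And>m. vnorm (v m) \<le> 1"
      using lift_power_roots[OF prime less, of b] b_le b_root by metis
    obtain V where V: "\<And>m k. V (of_nat m / of_nat p ^ k) = v k ^ m"
      "\<And>a b. a \<in> p_nonneg p \<Longrightarrow> b \<in> p_nonneg p \<Longrightarrow> V (a + b) = V a * V b"
      using power_system[OF prime, of v] v(1) by metis
    have "vnorm (V a) \<le> 1" if "a \<in> p_nonneg p" for a
      using that v(3) by (auto simp: p_nonneg_def V vnorm_power power_le_one)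
    moreover have "vnorm (V (1 / of_nat p ^ m) - b m) \<le> vnorm (of_nat p :: 'c)" for m
      using V(1)[of 1 m] v(2)[of m] by simp
    moreover have "V 0 = 1"
      using V(1)[of 0 0] by simp
    ultimately show ?thesis
      using V(2) by (intro exI[of _ V]) (auto simp: good_def b_def x_def)
  qed
  then obtain V where "\<And>k. good k (V k)"
    by metis
  then have V: "\<And>k a b. a \<in> p_nonneg p \<Longrightarrow> b \<in> p_nonneg p \<Longrightarrow> V k (a + b) = V k a * V k b"
    "\<And>k a. a \<in> p_nonneg p \<Longrightarrow> vnorm (V k a) \<le> 1"
    "\<And>k m. vnorm (V k (1 / of_nat p ^ m) - (\<Sum>j<k. pw ((of_int (Q j) + of_int (N j) * r k) / of_nat p ^ m)))
        \<le> vnorm (of_nat p :: 'c)" "\<And>k. V k 0 = 1"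
    by (simp_all add: good_def)
  interpret tate_points n p pw \<rho> \<theta> N Q M S L r V
    by unfold_locales
      (fact assms(1) p_def \<rho> pw_add vnorm_pw \<theta> valuation_ge S L slope sign M gap r(1) r_gt r_lim r_near V)+
  show False
    using value_group_if_nullstellensatz_pair[OF pair] \<gamma>(3) powr_\<theta> by simp
qed

end
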